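(* Let $f(x,y)=x^3+y^3\in\mathbb{Z}[x,y]$ and, for $m\in\mathbb{Z}$, let $N_f(m)=\#\{(x,y)\in\mathbb{Z}^2 : f(x,y)=m\}$. Let $m_0\in\mathbb{Z}$ be a nonzero integer and let $E$ be the projective plane cubic $x^3+y^3=m_0z^3$, made into an elliptic curve over $\mathbb{Q}$ by taking the rational point $[1,-1,0]$ as origin. Let $r=\operatorname{rank}E(\mathbb{Q})$ and assume $r\ge 1$. Let $E'$ be the elliptic curve $Y^2=X^3-432m_0^2$ over $\mathbb{Q}$ with origin the point $[0,1,0]$ at infinity, and let $\Phi:E\to E'$ be the isomorphism given by $\Phi([x,y,z])=\left[12m_0\frac{z}{x+y},\,36m_0\frac{y-x}{x+y},\,1\right]$ if $z\neq 0$ and $\Phi([x,y,z])=[0,1,0]$ if $z=0$. Let $P_1,\dots,P_r\in E(\mathbb{Q})$ be linearly independent points, and let $\bar P$ be a point among $\Phi(P_1),\dots,\Phi(P_r)$ with $\hat h(\bar P)=\max_{1\le i\le r}\hat h(\Phi(P_i))$. Then the inequality $$N_f(m)>\frac{1}{(9\times 2^{r+1}-20)^{r/(r+2)}\,\hat h(\bar P)^{r/(r+2)}}\,(\log|m|)^{r/(r+2)}$$ holds for infinitely many integers $m$.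
   Context: For a rational number $t=a/b$ in lowest terms, $H([t,1])=\max\{|a|,|b|\}$ is the usual height on $\mathbb{P}^1(\mathbb{Q})$. For a point $P\ne O$ on $E'$, $h_x(P)=\log H([X(P),1])$, where $X(P)$ is its $X$-coordinate. The canonical (Néron–Tate) height on $E'$ is $\hat h(P)=\frac12\lim_{k\to\infty}4^{-k}h_x([2^k]P)$. Linear independence of points in $E(\mathbb{Q})$ means independence in the Mordell–Weil group modulo torsion. *)

theory Defs
  imports "HOL-Analysis.Analysis" "HOL-Algebra.FiniteProduct"
begin

subsection \<open>Counting representations\<close>

text \<open>
  For \<open>f(x,y) = x^3 + y^3\<close> the set counted is finite for every \<open>m \<noteq> 0\<close>; it is infinite for
  \<open>m = 0\<close>, where \<open>card\<close> returns the junk value \<open>0\<close>.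
\<close>

definition num_reps :: "(int \<Rightarrow> int \<Rightarrow> int) \<Rightarrow> int \<Rightarrow> nat" where
  "num_reps f m = card {(x, y). f x y = m}"

definition sum_of_cubes :: "int \<Rightarrow> int \<Rightarrow> int" where
  "sum_of_cubes x y = x ^ 3 + y ^ 3"

subsection \<open>Rational points of the projective plane\<close>

definition proportional :: "rat ^ 3 \<Rightarrow> rat ^ 3 \<Rightarrow> bool" where
  "proportional v w \<longleftrightarrow> v \<noteq> 0 \<and> w \<noteq> 0 \<and> (\<exists>c. c \<noteq> 0 \<and> w = c *s v)"

lemma part_equivp_proportional: "part_equivp proportional"
proof (rule part_equivpI)
  show "\<exists>v. proportional v v"
    by (rule exI[of _ "1 :: rat ^ 3"])
      (auto simp: proportional_def intro!: exI[of _ "1 :: rat"])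
  show "symp proportional"
  proof (rule sympI)
    fix v w assume "proportional v w"
    then obtain c where c: "v \<noteq> 0" "w \<noteq> 0" "c \<noteq> 0" "w = c *s v"
      unfolding proportional_def by blast
    then have "v = inverse c *s w" by (simp add: vector_smult_assoc)
    with c show "proportional w v"
      unfolding proportional_def by (metis nonzero_imp_inverse_nonzero)
  qed
  show "transp proportional"
  proof (rule transpI)
    fix u v w assume "proportional u v" "proportional v w"
    then obtain c d where cd: "u \<noteq> 0" "w \<noteq> 0" "c \<noteq> 0" "d \<noteq> 0" "v = c *s u" "w = d *s v"
      unfolding proportional_def by blast
    then have "w = (d * c) *s u" by (simp add: vector_smult_assoc)
    with cd show "proportional u w"
      unfolding proportional_def by (metis mult_eq_0_iff)
  qed
qed

text \<open>\<open>pt v\<close> is the point with homogeneous coordinates \<open>v\<close>; it is meaningful only for \<open>v \<noteq> 0\<close>.\<close>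

quotient_type proj_plane = "rat ^ 3" / partial: proportional
  morphisms rep_pt pt
  by (rule part_equivp_proportional)

subsection \<open>The group of rational points of a plane cubic\<close>

text \<open>
  Curves are given by their ternary cubic form, seen as a function on homogeneous coordinates
  (no information is lost, the rationals being infinite).

  \<open>line_section F P Q R\<close>: some line meets the cubic \<open>F = 0\<close> exactly in \<open>P\<close>, \<open>Q\<close>, \<open>R\<close>, counted
  with multiplicity. The line is parametrised by two spanning vectors \<open>u\<close>, \<open>v\<close>; the condition says
  that the binary cubic form that \<open>F\<close> induces on it is a nonzero multiple of the product of the
  linear forms vanishing at the three points. For \<open>P = Q\<close> the line is thus the tangent at \<open>P\<close>.
\<close>

definition line_section ::
  "(rat ^ 3 \<Rightarrow> rat) \<Rightarrow> proj_plane \<Rightarrow> proj_plane \<Rightarrow> proj_plane \<Rightarrow> bool" where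
  "line_section F P Q R \<longleftrightarrow>
    (\<exists>u v p1 p2 q1 q2 r1 r2 c.
      (\<forall>s t. s *s u + t *s v = 0 \<longrightarrow> s = 0 \<and> t = 0) \<and>
      (p1, p2) \<noteq> (0, 0) \<and> P = pt (p1 *s u + p2 *s v) \<and>
      (q1, q2) \<noteq> (0, 0) \<and> Q = pt (q1 *s u + q2 *s v) \<and>
      (r1, r2) \<noteq> (0, 0) \<and> R = pt (r1 *s u + r2 *s v) \<and>
      c \<noteq> 0 \<and>
      (\<forall>s t. F (s *s u + t *s v) =
        c * (s * p2 - t * p1) * (s * q2 - t * q1) * (s * r2 - t * r1)))"

definition third_point ::
  "(rat ^ 3 \<Rightarrow> rat) \<Rightarrow> proj_plane \<Rightarrow> proj_plane \<Rightarrow> proj_plane" where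
  "third_point F P Q = (THE R. line_section F P Q R)"

text \<open>
  The chord-tangent group law with origin \<open>Z\<close>, for a smooth cubic \<open>F = 0\<close> through \<open>Z\<close>: the sum of
  \<open>P\<close> and \<open>Q\<close> is the third point on the line through \<open>Z\<close> and the third point on the line through
  \<open>P\<close> and \<open>Q\<close>. As usual in \<open>HOL-Algebra\<close> the abelian group is written multiplicatively, so
  \<open>[n]P\<close> is \<open>P [^] n\<close> and sums are \<open>finprod\<close>.
\<close>

definition cubic_group :: "(rat ^ 3 \<Rightarrow> rat) \<Rightarrow> proj_plane \<Rightarrow> proj_plane monoid" where
  "cubic_group F Z =
    \<lparr>carrier = {pt v | v. v \<noteq> 0 \<and> F v = 0},
     mult = (\<lambda>P Q. third_point F Z (third_point F P Q)),
     one = Z\<rparr>"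

definition curve_E :: "int \<Rightarrow> proj_plane monoid" where
  "curve_E m0 =
    cubic_group (\<lambda>v. v $ 1 ^ 3 + v $ 2 ^ 3 - of_int m0 * v $ 3 ^ 3) (pt (vector [1, -1, 0]))"

definition curve_E' :: "int \<Rightarrow> proj_plane monoid" where
  "curve_E' m0 =
    cubic_group (\<lambda>v. v $ 2 ^ 2 * v $ 3 - (v $ 1 ^ 3 - 432 * of_int m0 ^ 2 * v $ 3 ^ 3))
      (pt (vector [0, 1, 0]))"

text \<open>On \<open>E\<close> one has \<open>x + y \<noteq> 0\<close> whenever \<open>z \<noteq> 0\<close>, as \<open>m0 \<noteq> 0\<close>.\<close>

lift_definition Phi :: "int \<Rightarrow> proj_plane \<Rightarrow> proj_plane" is
  "\<lambda>m0 v. if v $ 3 \<noteq> 0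
     then vector [12 * of_int m0 * (v $ 3 / (v $ 1 + v $ 2)),
                  36 * of_int m0 * ((v $ 2 - v $ 1) / (v $ 1 + v $ 2)), 1]
     else vector [0, 1, 0]"
proof -
  fix m0 :: int and v w :: "rat ^ 3"
  assume "proportional v w"
  then obtain c where c: "c \<noteq> 0" "w = c *s v"
    unfolding proportional_def by blast
  have ratio: "c * a / (c * b + c * d) = a / (b + d)" for a b d :: rat
    using c(1) by (simp add: distrib_left[symmetric])
  have nz: "vector [a, b, 1] \<noteq> (0 :: rat ^ 3)" "vector [a, 1, b] \<noteq> (0 :: rat ^ 3)" for a b
    by (metis vector_3 zero_index zero_neq_one)+
  have refl: "proportional x x" if "x \<noteq> 0" for x
    using that unfolding proportional_def by (metis vector_smult_lid zero_neq_one)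
  show "proportional
     (if v $ 3 \<noteq> 0
      then vector [12 * of_int m0 * (v $ 3 / (v $ 1 + v $ 2)),
                   36 * of_int m0 * ((v $ 2 - v $ 1) / (v $ 1 + v $ 2)), 1]
      else vector [0, 1, 0])
     (if w $ 3 \<noteq> 0
      then vector [12 * of_int m0 * (w $ 3 / (w $ 1 + w $ 2)),
                   36 * of_int m0 * ((w $ 2 - w $ 1) / (w $ 1 + w $ 2)), 1]
      else vector [0, 1, 0])"
    using c by (auto simp: ratio right_diff_distrib[symmetric] intro!: refl nz)
qed

subsection \<open>Rank and independence modulo torsion\<close>

definition torsion_points :: "('a, 'b) monoid_scheme \<Rightarrow> 'a set" where
  "torsion_points G = {x \<in> carrier G. \<exists>k::nat. k > 0 \<and> x [^]\<^bsub>G\<^esub> k = \<one>\<^bsub>G\<^esub>}"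

definition indep_mod_torsion ::
  "('a, 'b) monoid_scheme \<Rightarrow> nat \<Rightarrow> (nat \<Rightarrow> 'a) \<Rightarrow> bool" where
  "indep_mod_torsion G r P \<longleftrightarrow>
    P \<in> {1..r} \<rightarrow> carrier G \<and>
    (\<forall>n :: nat \<Rightarrow> int.
      finprod G (\<lambda>i. P i [^]\<^bsub>G\<^esub> n i) {1..r} \<in> torsion_points G \<longrightarrow> (\<forall>i\<in>{1..r}. n i = 0))"

definition abelian_rank :: "('a, 'b) monoid_scheme \<Rightarrow> enat" where
  "abelian_rank G = Sup {enat r | r. \<exists>P. indep_mod_torsion G r P}"

subsection \<open>Heights\<close>

definition rat_height :: "rat \<Rightarrow> int" where
  "rat_height t = (case quotient_of t of (a, b) \<Rightarrow> max \<bar>a\<bar> \<bar>b\<bar>)"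

lift_definition X_coord :: "proj_plane \<Rightarrow> rat" is "\<lambda>v. v $ 1 / v $ 3"
  by (auto simp: proportional_def)

text \<open>
  The value of \<open>x_height\<close> at the origin of \<open>E'\<close> is a convention; the canonical height does not
  depend on it.
\<close>

definition x_height :: "proj_plane \<Rightarrow> real" where
  "x_height P =
    (if P = pt (vector [0, 1, 0]) then 0 else ln (real_of_int (rat_height (X_coord P))))"

definition canonical_height :: "int \<Rightarrow> proj_plane \<Rightarrow> real" where
  "canonical_height m0 P =
    1 / 2 * lim (\<lambda>k::nat. x_height (P [^]\<^bsub>curve_E' m0\<^esub> (2 ^ k :: nat)) / 4 ^ k)"

end

theory Submission
  imports Defs
begin

text \<open>The combinations \<open>n\<^sub>1 P\<^sub>1 + \<dots> + n\<^sub>r P\<^sub>r\<close> with \<open>1 \<le> n\<^sub>i \<le> N\<close> are \<open>N^r\<close> distinct rational points of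
  \<open>x^3 + y^3 = m0\<close>. The abscissa of a rational point on \<open>Y^2 = X^3 - B\<close> has the form \<open>a/e^2\<close>
  with ordinate denominator \<open>e^3\<close>, and \<open>6 a e\<close> is then a common denominator of the corresponding point of
  \<open>x^3 + y^3 = m0\<close>, of logarithm at most three times the canonical height plus a constant. By the
  parallelogram law the canonical heights are at most \<open>(3 \<sqdot> 2^(r-1) - 2) N^2\<close> times the maximal one, so
  clearing all denominators gives an \<open>m\<close> with at least \<open>N^r\<close> representations and
  \<open>log |m| \<le> 9 (3 \<sqdot> 2^(r-1) - 2) h N^(r+2) + O(N^r)\<close>, and
  \<open>9 (3 \<sqdot> 2^(r-1) - 2) < 9 \<sqdot> 2^(r+1) - 20\<close>.

  The chord-tangent law is handled through explicit biquadratic addition laws on \<open>x^3 + y^3 = m z^3\<close>;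
  associativity becomes a polynomial identity modulo the curve equations. The group structure is carried
  over to \<open>Y^2 = X^3 - B\<close> by \<open>Phi\<close>, which is induced by a linear map.\<close>

subsection \<open>Points and lines in the projective plane\<close>

text \<open>\<open>third_point\<close> is a definite description and \<open>canonical_height\<close>
  a \<open>lim\<close>, so neither can be computed before the third intersection is known to be
  unique and Tate's sequence to converge. Uniqueness rests on nonsingularity. The chosen addition
  law vanishes at some pairs of points; over the rationals the law and its transpose never vanish
  together, because rational cube roots are unique. So every sum is given by one of the two, and
  associativity must hold for all sixteen choices. Only E carries that computation; on E' the
  explicit formulas serve the heights alone. For heights, an upper bound for h(P + Q) + h(P - Q) and
  a lower bound for h(2P) are enough: the limit then satisfies the parallelogram law exactly. The
  strict gap between the two final constants absorbs the lower-order terms, and since the counts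
  exceed every bound, infinitely many m occur.\<close>

lemma vec3_eq_iff: "v = (w :: 'a ^ 3) \<longleftrightarrow> v $ 1 = w $ 1 \<and> v $ 2 = w $ 2 \<and> v $ 3 = w $ 3"
  by (simp add: vec_eq_iff forall_3)

lemma proportional_refl: "v \<noteq> 0 \<Longrightarrow> proportional v v"
  unfolding proportional_def by (metis vector_smult_lid zero_neq_one)

lemma pt_eq_iff: "v \<noteq> 0 \<Longrightarrow> w \<noteq> 0 \<Longrightarrow> pt v = pt w \<longleftrightarrow> proportional v w"
  by (metis Quotient3_proj_plane Quotient3_rel proportional_refl)

lemma pt_scale: "c \<noteq> 0 \<Longrightarrow> v \<noteq> 0 \<Longrightarrow> pt (c *s v) = pt v"
  by (subst pt_eq_iff) (auto simp: proportional_def vector_smult_assoc intro!: exI[of _ "inverse c"])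

lemma pt_surj: "\<exists>v. v \<noteq> 0 \<and> P = pt v"
  by (metis Quotient3_proj_plane Quotient3_abs_rep Quotient3_rep_reflp proportional_def)

definition independent2 :: "rat ^ 3 \<Rightarrow> rat ^ 3 \<Rightarrow> bool" where
  "independent2 u v \<longleftrightarrow> (\<forall>s t. s *s u + t *s v = 0 \<longrightarrow> s = 0 \<and> t = 0)"

lemma independent2D: "independent2 u v \<Longrightarrow> s *s u + t *s v = 0 \<Longrightarrow> s = 0 \<and> t = 0"
  by (auto simp: independent2_def)

lemma independent2_nonzero: "independent2 u v \<Longrightarrow> (s, t) \<noteq> (0, 0) \<Longrightarrow> s *s u + t *s v \<noteq> 0"
  by (auto simp: independent2_def)

lemma independent2_iff:
  assumes "u \<noteq> 0" "v \<noteq> 0"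
  shows "independent2 u v \<longleftrightarrow> pt u \<noteq> pt v"
proof
  assume i: "independent2 u v"
  show "pt u \<noteq> pt v"
  proof
    assume "pt u = pt v"
    then obtain c where "v = c *s u" using assms by (auto simp: pt_eq_iff proportional_def)
    then have "(-c) *s u + 1 *s v = 0" by (simp add: vec3_eq_iff)
    with i show False using independent2D by fastforce
  qed
next
  assume n: "pt u \<noteq> pt v"
  show "independent2 u v"
    unfolding independent2_def
  proof (intro allI impI)
    fix s t assume e: "s *s u + t *s v = 0"
    have "t = 0"
    proof (rule ccontr)
      assume t: "t \<noteq> 0"
      have v: "v = (- s / t) *s u" using e t
        by (simp add: vec3_eq_iff field_simps add_eq_0_iff)
      with assms have "- s / t \<noteq> 0" by (metis vector_smult_lzero)
      with v n assms show False by (metis pt_scale)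
    qed
    moreover have "s = 0" using e assms \<open>t = 0\<close> by (auto simp: vec3_eq_iff)
    ultimately show "s = 0 \<and> t = 0" by simp
  qed
qed

section \<open>Sections of a cubic by a line\<close>

lemma line_sectionI:
  assumes "independent2 u v" "c \<noteq> 0" "(p1, p2) \<noteq> (0, 0)" "(q1, q2) \<noteq> (0, 0)" "(r1, r2) \<noteq> (0, 0)"
    "P = pt (p1 *s u + p2 *s v)" "Q = pt (q1 *s u + q2 *s v)" "R = pt (r1 *s u + r2 *s v)"
    "\<And>s t. F (s *s u + t *s v) = c * (s * p2 - t * p1) * (s * q2 - t * q1) * (s * r2 - t * r1)"
  shows "line_section F P Q R"
  unfolding line_section_def using assms unfolding independent2_def by blast

lemma line_sectionE:
  assumes "line_section F P Q R"
  obtains u v p1 p2 q1 q2 r1 r2 c where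
    "independent2 u v" "c \<noteq> 0" "(p1, p2) \<noteq> (0, 0)" "(q1, q2) \<noteq> (0, 0)" "(r1, r2) \<noteq> (0, 0)"
    "P = pt (p1 *s u + p2 *s v)" "Q = pt (q1 *s u + q2 *s v)" "R = pt (r1 *s u + r2 *s v)"
    "\<And>s t. F (s *s u + t *s v) = c * (s * p2 - t * p1) * (s * q2 - t * q1) * (s * r2 - t * r1)"
  using assms unfolding line_section_def independent2_def by blast

lemma line_section_swap12: "line_section F P Q R \<Longrightarrow> line_section F Q P R"
  by (erule line_sectionE, rule line_sectionI, assumption, assumption) (auto simp: mult_ac)

lemma line_section_swap23: "line_section F P Q R \<Longrightarrow> line_section F P R Q"
  by (erule line_sectionE, rule line_sectionI, assumption, assumption) (auto simp: mult_ac)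

lemma line_section_on_curve:
  assumes "line_section F P Q R"
  shows "\<exists>v. v \<noteq> 0 \<and> F v = 0 \<and> R = pt v"
  using assms
proof (rule line_sectionE)
  fix u v p1 p2 q1 q2 r1 r2 c
  assume h: "independent2 u v" "(r1, r2) \<noteq> (0, 0)" "R = pt (r1 *s u + r2 *s v)"
    "\<And>s t. F (s *s u + t *s v) = c * (s * p2 - t * p1) * (s * q2 - t * q1) * (s * r2 - t * r1)"
  show ?thesis
    using independent2_nonzero[OF h(1,2)] h(3,4) by (intro exI[of _ "r1 *s u + r2 *s v"]) simp
qed

text \<open>A line section does not depend on the basis of the line. With a representative of
  \<open>P\<close> as first basis vector its linear form becomes a multiple of \<open>t\<close>, so
  two sections through the same \<open>P\<close> can be compared.\<close>

lemma line_section_rebase: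
  assumes "line_section F P Q R" "P = pt a" "a \<noteq> 0"
  obtains b q1 q2 r1 r2 c where
    "independent2 a b" "c \<noteq> 0" "(q1, q2) \<noteq> (0, 0)" "(r1, r2) \<noteq> (0, 0)"
    "Q = pt (q1 *s a + q2 *s b)" "R = pt (r1 *s a + r2 *s b)"
    "\<And>s t. F (s *s a + t *s b) = c * t * (s * q2 - t * q1) * (s * r2 - t * r1)"
  using assms(1)
proof (rule line_sectionE)
  fix u v p1 p2 q1 q2 r1 r2 c
  assume h: "independent2 u v" "c \<noteq> 0" "(p1, p2) \<noteq> (0, 0)" "(q1, q2) \<noteq> (0, 0)" "(r1, r2) \<noteq> (0, 0)"
    "P = pt (p1 *s u + p2 *s v)" "Q = pt (q1 *s u + q2 *s v)" "R = pt (r1 *s u + r2 *s v)"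
    "\<And>s t. F (s *s u + t *s v) = c * (s * p2 - t * p1) * (s * q2 - t * q1) * (s * r2 - t * r1)"
  have "proportional (p1 *s u + p2 *s v) a"
    using h(6) assms(2,3) pt_eq_iff independent2_nonzero[OF h(1,3)] by metis
  then obtain k where k: "k \<noteq> 0" "a = k *s (p1 *s u + p2 *s v)" by (auto simp: proportional_def)
  define \<alpha> \<beta> where "\<alpha> = k * p1" and "\<beta> = k * p2"
  have a: "a = \<alpha> *s u + \<beta> *s v" unfolding \<alpha>_def \<beta>_def k(2) by (simp add: vec3_eq_iff algebra_simps)
  have ab: "(\<alpha>, \<beta>) \<noteq> (0, 0)" using h(3) k(1) by (auto simp: \<alpha>_def \<beta>_def)
  \<comment> \<open>Any completion of (\<open>\<alpha>\<close>, \<open>\<beta>\<close>) to an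
    invertible matrix will do; a unit vector suffices.\<close>
  obtain \<gamma> \<delta> where D: "\<alpha> * \<delta> - \<beta> * \<gamma> \<noteq> 0"
    using ab by (cases "\<alpha> = 0") (auto intro: that[of 0 1] that[of 1 0])
  define D where "D = \<alpha> * \<delta> - \<beta> * \<gamma>"
  have D0: "D \<noteq> 0" using D D_def by simp
  define b where "b = \<gamma> *s u + \<delta> *s v"
  have comb: "s *s a + t *s b = (s * \<alpha> + t * \<gamma>) *s u + (s * \<beta> + t * \<delta>) *s v" for s t
    unfolding a b_def by (simp add: vec3_eq_iff algebra_simps)
  have inv: "x *s u + y *s v = ((x * \<delta> - y * \<gamma>) / D) *s a + ((y * \<alpha> - x * \<beta>) / D) *s b" for x y
  proof -
    have 1: "(x * \<delta> - y * \<gamma>) / D * \<alpha> + (y * \<alpha> - x * \<beta>) / D * \<gamma> = x"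
      "(x * \<delta> - y * \<gamma>) / D * \<beta> + (y * \<alpha> - x * \<beta>) / D * \<delta> = y"
      using D0 by (simp_all add: divide_simps) (simp_all add: D_def algebra_simps)
    show ?thesis unfolding comb 1 ..
  qed
  have ind: "independent2 a b" unfolding independent2_def
  proof (intro allI impI)
    fix s t assume "s *s a + t *s b = 0"
    then have e: "s * \<alpha> + t * \<gamma> = 0" "s * \<beta> + t * \<delta> = 0"
      using h(1) unfolding comb independent2_def by blast+
    have "s * D = (s * \<alpha> + t * \<gamma>) * \<delta> - (s * \<beta> + t * \<delta>) * \<gamma>"
      "t * D = (s * \<beta> + t * \<delta>) * \<alpha> - (s * \<alpha> + t * \<gamma>) * \<beta>" by (simp_all add: D_def algebra_simps)
    then have "s * D = 0" "t * D = 0" unfolding e by simp_all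
    with D0 show "s = 0 \<and> t = 0" by simp
  qed
  have nz: "((x * \<delta> - y * \<gamma>) / D, (y * \<alpha> - x * \<beta>) / D) \<noteq> (0, 0)" if "(x, y) \<noteq> (0, 0)" for x y
    using independent2_nonzero[OF h(1) that] unfolding inv[of x y] by auto
  show thesis
  proof (rule that[OF ind])
    \<comment> \<open>The linear forms of \<open>Q\<close> and \<open>R\<close> contribute a factor
      \<open>D\<close> each, that of \<open>P\<close> contributes \<open>- D / k\<close>.\<close>
    show "- c * D * D * D / k \<noteq> 0" using h(2) D0 k(1) by simp
    show "((q1 * \<delta> - q2 * \<gamma>) / D, (q2 * \<alpha> - q1 * \<beta>) / D) \<noteq> (0, 0)" using nz h(4) by blast
    show "((r1 * \<delta> - r2 * \<gamma>) / D, (r2 * \<alpha> - r1 * \<beta>) / D) \<noteq> (0, 0)" using nz h(5) by blast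
    show "Q = pt (((q1 * \<delta> - q2 * \<gamma>) / D) *s a + ((q2 * \<alpha> - q1 * \<beta>) / D) *s b)" using h(7) inv by metis
    show "R = pt (((r1 * \<delta> - r2 * \<gamma>) / D) *s a + ((r2 * \<alpha> - r1 * \<beta>) / D) *s b)" using h(8) inv by metis
    fix s t
    have 1: "(s * \<alpha> + t * \<gamma>) * y - (s * \<beta> + t * \<delta>) * x
        = D * (s * ((y * \<alpha> - x * \<beta>) / D) - t * ((x * \<delta> - y * \<gamma>) / D))" for x y
      using D0 by (simp add: divide_simps) (simp add: D_def algebra_simps)
    have 2: "(s * \<alpha> + t * \<gamma>) * p2 - (s * \<beta> + t * \<delta>) * p1 = - D / k * t"
      using k(1) by (simp add: field_simps) (simp add: D_def \<alpha>_def \<beta>_def algebra_simps)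
    show "F (s *s a + t *s b) = (- c * D * D * D / k) * t *
        (s * ((q2 * \<alpha> - q1 * \<beta>) / D) - t * ((q1 * \<delta> - q2 * \<gamma>) / D)) *
        (s * ((r2 * \<alpha> - r1 * \<beta>) / D) - t * ((r1 * \<delta> - r2 * \<gamma>) / D))"
      unfolding comb h(9) 2 1[of q2 q1] 1[of r2 r1] by simp
  qed
qed

section \<open>Uniqueness of the third intersection point\<close>

lemma proportionalI_cross:
  assumes "v \<noteq> 0" "w \<noteq> 0" "v $ 1 * w $ 2 = v $ 2 * w $ 1" "v $ 1 * w $ 3 = v $ 3 * w $ 1"
    "v $ 2 * w $ 3 = v $ 3 * w $ 2"
  shows "proportional v w"
proof -
  have *: "\<exists>c. w = c *s v"
  proof -
    consider "v $ 1 \<noteq> 0" | "v $ 2 \<noteq> 0" | "v $ 3 \<noteq> 0" using assms(1) by (auto simp: vec3_eq_iff)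
    then show ?thesis
    proof cases
      case 1
      then show ?thesis using assms(3-5)
        by (intro exI[of _ "w $ 1 / v $ 1"]) (simp add: vec3_eq_iff field_simps)
    next
      case 2
      then show ?thesis using assms(3-5)
        by (intro exI[of _ "w $ 2 / v $ 2"]) (simp add: vec3_eq_iff field_simps)
    next
      case 3
      then show ?thesis using assms(3-5)
        by (intro exI[of _ "w $ 3 / v $ 3"]) (simp add: vec3_eq_iff field_simps)
    qed
  qed
  then obtain c where c: "w = c *s v" by blast
  then have "c \<noteq> 0" using assms(2) by auto
  with c assms show ?thesis by (auto simp: proportional_def)
qed

text \<open>Since \<open>n3\<close> is nonzero, the plane orthogonal to the normal vector projects
  injectively to the first two coordinates; the two given vectors stay independent there, and
  Cramer's rule gives the coefficients.\<close>

lemma orthogonal_plane_aux: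
  fixes a1 :: rat
  assumes "n3 \<noteq> 0" "n1 * a1 + n2 * a2 + n3 * a3 = 0" "n1 * b1 + n2 * b2 + n3 * b3 = 0"
    "n1 * w1 + n2 * w2 + n3 * w3 = 0"
    and ind: "\<And>s t. s * a1 + t * b1 = 0 \<Longrightarrow> s * a2 + t * b2 = 0 \<Longrightarrow> s * a3 + t * b3 = 0 \<Longrightarrow> s = 0 \<and> t = 0"
  shows "\<exists>\<alpha> \<beta>. w1 = \<alpha> * a1 + \<beta> * b1 \<and> w2 = \<alpha> * a2 + \<beta> * b2 \<and> w3 = \<alpha> * a3 + \<beta> * b3"
proof -
  have third: "x3 = - (n1 * x1 + n2 * x2) / n3" if "n1 * x1 + n2 * x2 + n3 * x3 = 0" for x1 x2 x3
    using that assms(1) by (simp add: field_simps add_eq_0_iff)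
  have ind': "s = 0 \<and> t = 0" if e: "s * a1 + t * b1 = 0" "s * a2 + t * b2 = 0" for s t
  proof (rule ind[OF that])
    have "n3 * (s * a3 + t * b3) = - (n1 * (s * a1 + t * b1) + n2 * (s * a2 + t * b2))"
      using assms(2,3) by algebra
    then show "s * a3 + t * b3 = 0" using e assms(1) by simp
  qed
  define d where "d = a1 * b2 - a2 * b1"
  have d: "d \<noteq> 0"
  proof
    assume d: "d = 0"
    have "b1 = 0 \<and> - a1 = 0" by (rule ind') (use d in \<open>simp_all add: d_def algebra_simps\<close>)
    moreover have "b2 = 0 \<and> - a2 = 0" by (rule ind') (use d in \<open>simp_all add: d_def algebra_simps\<close>)
    ultimately show False using ind'[of 1 0] by simp
  qed
  define \<alpha> \<beta> where "\<alpha> = (w1 * b2 - w2 * b1) / d" and "\<beta> = (a1 * w2 - a2 * w1) / d"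
  have 12: "w1 = \<alpha> * a1 + \<beta> * b1" "w2 = \<alpha> * a2 + \<beta> * b2"
    using d by (simp_all add: \<alpha>_def \<beta>_def divide_simps) (simp_all add: d_def algebra_simps)
  have "n3 * w3 = n3 * (\<alpha> * a3 + \<beta> * b3)" using assms(2-4) 12 by algebra
  with assms(1) 12 show ?thesis by auto
qed

lemma orthogonal_plane:
  fixes a n :: "rat ^ 3"
  assumes "n \<noteq> 0" "n $ 1 * a $ 1 + n $ 2 * a $ 2 + n $ 3 * a $ 3 = 0"
    "n $ 1 * b $ 1 + n $ 2 * b $ 2 + n $ 3 * b $ 3 = 0"
    "n $ 1 * w $ 1 + n $ 2 * w $ 2 + n $ 3 * w $ 3 = 0" "independent2 a b"
  shows "\<exists>\<alpha> \<beta>. w = \<alpha> *s a + \<beta> *s b"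
proof -
  have ind: "s = 0 \<and> t = 0" if "s * a $ 1 + t * b $ 1 = 0" "s * a $ 2 + t * b $ 2 = 0" "s * a $ 3 + t * b $ 3 = 0" for s t
    using independent2D[OF assms(5), of s t] that by (simp add: vec3_eq_iff)
  have p1: "n $ 2 * x $ 2 + n $ 3 * x $ 3 + n $ 1 * x $ 1 = 0"
    and p2: "n $ 1 * x $ 1 + n $ 3 * x $ 3 + n $ 2 * x $ 2 = 0"
    and p3: "n $ 1 * x $ 1 + n $ 2 * x $ 2 + n $ 3 * x $ 3 = 0"
    if "n $ 1 * x $ 1 + n $ 2 * x $ 2 + n $ 3 * x $ 3 = 0" for x :: "rat ^ 3"
    using that by (simp_all add: add_ac)
  consider "n $ 1 \<noteq> 0" | "n $ 2 \<noteq> 0" | "n $ 3 \<noteq> 0" using assms(1) by (auto simp: vec3_eq_iff)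
  then show ?thesis
  proof cases
    case 1
    have "\<exists>\<alpha> \<beta>. w $ 2 = \<alpha> * a $ 2 + \<beta> * b $ 2 \<and> w $ 3 = \<alpha> * a $ 3 + \<beta> * b $ 3 \<and> w $ 1 = \<alpha> * a $ 1 + \<beta> * b $ 1"
      by (rule orthogonal_plane_aux[OF 1 p1[OF assms(2)] p1[OF assms(3)] p1[OF assms(4)]]) (use ind in blast)
    then show ?thesis by (auto simp: vec3_eq_iff)
  next
    case 2
    have "\<exists>\<alpha> \<beta>. w $ 1 = \<alpha> * a $ 1 + \<beta> * b $ 1 \<and> w $ 3 = \<alpha> * a $ 3 + \<beta> * b $ 3 \<and> w $ 2 = \<alpha> * a $ 2 + \<beta> * b $ 2"
      by (rule orthogonal_plane_aux[OF 2 p2[OF assms(2)] p2[OF assms(3)] p2[OF assms(4)]]) (use ind in blast)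
    then show ?thesis by (auto simp: vec3_eq_iff)
  next
    case 3
    have "\<exists>\<alpha> \<beta>. w $ 1 = \<alpha> * a $ 1 + \<beta> * b $ 1 \<and> w $ 2 = \<alpha> * a $ 2 + \<beta> * b $ 2 \<and> w $ 3 = \<alpha> * a $ 3 + \<beta> * b $ 3"
      by (rule orthogonal_plane_aux[OF 3 p3[OF assms(2)] p3[OF assms(3)] p3[OF assms(4)]]) (use ind in blast)
    then show ?thesis by (auto simp: vec3_eq_iff)
  qed
qed

text \<open>Nonsingularity in the only form needed: the directions \<open>b\<close> along which \<open>F\<close> vanishes doubly
  at \<open>a\<close> lie in a plane.\<close>

definition smooth_form :: "(rat ^ 3 \<Rightarrow> rat) \<Rightarrow> bool" where
  "smooth_form F \<longleftrightarrow> (\<forall>a. a \<noteq> 0 \<longrightarrow> F a = 0 \<longrightarrow>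
    (\<exists>n :: rat ^ 3. n \<noteq> 0 \<and> (\<forall>b k l. (\<forall>s t. F (s *s a + t *s b) = t ^ 2 * (s * k + t * l)) \<longrightarrow>
      n $ 1 * b $ 1 + n $ 2 * b $ 2 + n $ 3 * b $ 3 = 0)))"

lemma smooth_formE:
  assumes "smooth_form F" "a \<noteq> 0" "F a = 0"
  obtains n :: "rat ^ 3" where "n \<noteq> 0" "\<And>b k l. (\<And>s t. F (s *s a + t *s b) = t ^ 2 * (s * k + t * l)) \<Longrightarrow>
    n $ 1 * b $ 1 + n $ 2 * b $ 2 + n $ 3 * b $ 3 = 0"
proof -
  have "\<exists>n :: rat ^ 3. n \<noteq> 0 \<and> (\<forall>b k l. (\<forall>s t. F (s *s a + t *s b) = t ^ 2 * (s * k + t * l)) \<longrightarrow>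
      n $ 1 * b $ 1 + n $ 2 * b $ 2 + n $ 3 * b $ 3 = 0)"
    using assms unfolding smooth_form_def by blast
  then show ?thesis using that by blast
qed

lemma proportional_comb:
  assumes "independent2 a b" "pt (x *s a + y *s b) = pt (x' *s a + y' *s b)" "(x, y) \<noteq> (0, 0)" "(x', y') \<noteq> (0, 0)"
  obtains k where "k \<noteq> 0" "x' = k * x" "y' = k * y"
proof -
  have "proportional (x *s a + y *s b) (x' *s a + y' *s b)"
    using assms pt_eq_iff independent2_nonzero by metis
  then obtain k where k: "k \<noteq> 0" "x' *s a + y' *s b = k *s (x *s a + y *s b)" by (auto simp: proportional_def)
  then have "(x' - k * x) *s a + (y' - k * y) *s b = 0" by (simp add: vec3_eq_iff algebra_simps)
  then have "x' - k * x = 0 \<and> y' - k * y = 0" by (rule independent2D[OF assms(1)])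
  with k that show ?thesis by simp
qed

text \<open>The two lines coincide: for \<open>P \<noteq> Q\<close> both are spanned by these
  points; for \<open>P = Q\<close> the form vanishes doubly at \<open>P\<close> along each, so
  smoothness puts both into one plane. On a common line the third linear factor is determined once
  the first two are cancelled.\<close>

lemma line_section_unique:
  assumes F: "smooth_form F" and 1: "line_section F P Q R" and 2: "line_section F P Q R'"
  shows "R = R'"
proof -
  obtain a where a: "a \<noteq> 0" "P = pt a" using pt_surj by blast
  obtain b q1 q2 r1 r2 c where b: "independent2 a b" "c \<noteq> 0" "(q1, q2) \<noteq> (0, 0)" "(r1, r2) \<noteq> (0, 0)"
    "Q = pt (q1 *s a + q2 *s b)" "R = pt (r1 *s a + r2 *s b)"
    "\<And>s t. F (s *s a + t *s b) = c * t * (s * q2 - t * q1) * (s * r2 - t * r1)"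
    using line_section_rebase[OF 1 a(2,1)] by metis
  obtain b' q1' q2' r1' r2' c' where b': "independent2 a b'" "c' \<noteq> 0" "(q1', q2') \<noteq> (0, 0)" "(r1', r2') \<noteq> (0, 0)"
    "Q = pt (q1' *s a + q2' *s b')" "R' = pt (r1' *s a + r2' *s b')"
    "\<And>s t. F (s *s a + t *s b') = c' * t * (s * q2' - t * q1') * (s * r2' - t * r1')"
    using line_section_rebase[OF 2 a(2,1)] by metis
  have a_eq: "a = 1 *s a + 0 *s b" "a = 1 *s a + 0 *s b'" by (simp_all add: vec3_eq_iff)
  have q2: "P = Q \<longleftrightarrow> q2 = 0" if "independent2 a b" "Q = pt (q1 *s a + q2 *s b)" "(q1, q2) \<noteq> (0, 0)" for q1 q2 b
  proof
    assume "P = Q"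
    then have "pt (1 *s a + 0 *s b) = pt (q1 *s a + q2 *s b)" using a(2) that(2) by simp
    from proportional_comb[OF that(1) this] that(3) show "q2 = 0" by auto
  next
    assume "q2 = 0"
    then show "P = Q" using that a pt_scale[of q1 a] by simp
  qed
  note eq = q2[OF b(1,5,3)] q2[OF b'(1,5,3)]
  have "\<exists>\<alpha> \<beta>. b' = \<alpha> *s a + \<beta> *s b"
  proof (cases "P = Q")
    case True
    then have 0: "q2 = 0" "q2' = 0" using eq by auto
    have Fa: "F (s *s a) = 0" for s using b(7)[of s 0] by simp
    obtain n :: "rat ^ 3" where n: "n \<noteq> 0" "\<And>b k l. (\<And>s t. F (s *s a + t *s b) = t ^ 2 * (s * k + t * l)) \<Longrightarrow>
      n $ 1 * b $ 1 + n $ 2 * b $ 2 + n $ 3 * b $ 3 = 0"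
      using smooth_formE[OF F a(1)] Fa[of 1] by (metis vector_smult_lid)
    show ?thesis
    proof (rule orthogonal_plane[OF n(1) _ _ _ b(1)])
      \<comment> \<open>The direction \<open>a\<close> itself qualifies, with both coefficients 0,
        because \<open>F\<close> vanishes on all multiples of \<open>a\<close>.\<close>
      show "n $ 1 * a $ 1 + n $ 2 * a $ 2 + n $ 3 * a $ 3 = 0"
        by (rule n(2)[of _ 0 0]) (simp add: Fa flip: vector_sadd_rdistrib)
      show "n $ 1 * b $ 1 + n $ 2 * b $ 2 + n $ 3 * b $ 3 = 0"
        by (rule n(2)[of _ "- c * q1 * r2" "c * q1 * r1"]) (simp add: b(7) 0 power2_eq_square algebra_simps)
      show "n $ 1 * b' $ 1 + n $ 2 * b' $ 2 + n $ 3 * b' $ 3 = 0"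
        by (rule n(2)[of _ "- c' * q1' * r2'" "c' * q1' * r1'"]) (simp add: b'(7) 0 power2_eq_square algebra_simps)
    qed
  next
    case False
    then have 0: "q2 \<noteq> 0" "q2' \<noteq> 0" using eq by auto
    have "proportional (q1 *s a + q2 *s b) (q1' *s a + q2' *s b')"
      using b(5) b'(5) pt_eq_iff independent2_nonzero[OF b(1,3)] independent2_nonzero[OF b'(1,3)] by metis
    then obtain k where k: "q1' *s a + q2' *s b' = k *s (q1 *s a + q2 *s b)" by (auto simp: proportional_def)
    have "b' = ((k * q1 - q1') / q2') *s a + (k * q2 / q2') *s b"
      using k 0 by (simp add: vec3_eq_iff field_simps)
    then show ?thesis by blast
  qed
  then obtain \<alpha> \<beta> where ab: "b' = \<alpha> *s a + \<beta> *s b" by blast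
  have comb: "s *s a + t *s b' = (s + \<alpha> * t) *s a + (\<beta> * t) *s b" for s t
    unfolding ab by (simp add: vec3_eq_iff algebra_simps)
  have \<beta>: "\<beta> \<noteq> 0"
  proof
    assume "\<beta> = 0"
    then have "\<alpha> *s a + (-1) *s b' = 0" by (simp add: ab vec3_eq_iff)
    then show False using independent2D[OF b'(1)] by fastforce
  qed
  have nz: "(x + \<alpha> * y, \<beta> * y) \<noteq> (0, 0)" if "(x, y) \<noteq> (0, 0)" for x y using that \<beta> by auto
  have "pt (q1 *s a + q2 *s b) = pt ((q1' + \<alpha> * q2') *s a + (\<beta> * q2') *s b)"
    using b(5) b'(5) comb by metis
  then obtain k where k: "k \<noteq> 0" "q1' + \<alpha> * q2' = k * q1" "\<beta> * q2' = k * q2"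
    using proportional_comb[OF b(1) _ b(3) nz[OF b'(3)]] by metis
  \<comment> \<open>The basis change contributes one factor \<open>\<beta>\<close> from
    \<open>t\<close>, and a factor \<open>\<beta> / k\<close> from the linear form of
    \<open>Q\<close>, whose two representations agree up to the scalar \<open>k\<close>.\<close>
  define K where "K = c * \<beta> ^ 2 / k"
  have K: "K \<noteq> 0" using b(2) \<beta> k(1) by (simp add: K_def)
  have L: "(s + \<alpha> * t) * q2 - \<beta> * t * q1 = \<beta> / k * (s * q2' - t * q1')" for s t
  proof -
    have q: "q1 = (q1' + \<alpha> * q2') / k" "q2 = \<beta> * q2' / k" using k by simp_all
    show ?thesis unfolding q using k(1) by (simp add: field_simps)
  qed
  have key: "t * (s * q2' - t * q1') * (c' * (s * r2' - t * r1')) =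
      t * (s * q2' - t * q1') * (K * ((s + \<alpha> * t) * r2 - \<beta> * t * r1))" for s t
  proof -
    have "c' * t * (s * q2' - t * q1') * (s * r2' - t * r1') =
        c * (\<beta> * t) * (\<beta> / k * (s * q2' - t * q1')) * ((s + \<alpha> * t) * r2 - \<beta> * t * r1)"
      using b'(7)[of s t] unfolding comb b(7) L by simp
    then show ?thesis by (simp add: K_def power2_eq_square mult_ac)
  qed
  define g where "g s = c' * (s * r2' - r1') - K * ((s + \<alpha>) * r2 - \<beta> * r1)" for s
  have g: "s * q2' - q1' = 0 \<or> g s = 0" for s using key[of 1 s] by (simp add: g_def)
  have gl: "g s = s * (g 1 - g 0) + g 0" for s by (simp add: g_def algebra_simps)
  \<comment> \<open>The other factor is nonzero and of degree at most one, so it vanishes at no more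
    than one of 0, 1, 2; the affine function \<open>g\<close> has two zeros and is therefore
    0.\<close>
  have "g 0 = 0 \<and> g 1 = 0"
    using g[of 0] g[of 1] g[of 2] gl[of 2] b'(3) by auto
  then have r: "c' * r1' = K * (\<beta> * r1 - \<alpha> * r2)" "c' * r2' = K * r2" by (simp_all add: g_def algebra_simps)
  have "r1' *s a + r2' *s b' = (K * \<beta> / c') *s (r1 *s a + r2 *s b)"
  proof -
    have "r1' = K * (\<beta> * r1 - \<alpha> * r2) / c'" "r2' = K * r2 / c'" using r b'(2) by (simp_all add: field_simps)
    then have "r1' + \<alpha> * r2' = K * \<beta> / c' * r1" "\<beta> * r2' = K * \<beta> / c' * r2"
      using b'(2) by (simp_all add: field_simps)
    then show ?thesis unfolding comb by (simp add: vec3_eq_iff distrib_left mult_ac)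
  qed
  then show "R = R'" unfolding b(6) b'(6)
    using pt_scale[of "K * \<beta> / c'" "r1 *s a + r2 *s b"] independent2_nonzero[OF b(1,4)] K \<beta> b'(2) by simp
qed

lemma third_point_eqI:
  assumes "smooth_form F" "line_section F P Q R"
  shows "third_point F P Q = R"
  unfolding third_point_def using assms line_section_unique by blast

subsection \<open>The group law on the cubic\<close>

definition E_form :: "rat \<Rightarrow> rat ^ 3 \<Rightarrow> rat" where
  "E_form m v = v $ 1 ^ 3 + v $ 2 ^ 3 - m * v $ 3 ^ 3"

text \<open>The symmetric trilinear form with \<open>E_polar m v v v = E_form m v\<close>. The
  equation \<open>E_polar m a a b = 0\<close> says that \<open>b\<close> lies on the tangent at
  \<open>a\<close>.\<close>

definition E_polar :: "rat \<Rightarrow> rat ^ 3 \<Rightarrow> rat ^ 3 \<Rightarrow> rat ^ 3 \<Rightarrow> rat" where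
  "E_polar m u v w = u $ 1 * v $ 1 * w $ 1 + u $ 2 * v $ 2 * w $ 2 - m * u $ 3 * v $ 3 * w $ 3"

definition swap_xy :: "rat ^ 3 \<Rightarrow> rat ^ 3" where
  "swap_xy v = vector [v $ 2, v $ 1, v $ 3]"

text \<open>The rotated addition law of twisted Hessian curves (Bernstein, Chuengsatiansup, Kohel, Lange).
  It is bihomogeneous of bidegree \<open>(2,2)\<close>, but not symmetric, and vanishes identically at some
  pairs of points; over the rationals it never does so together with its transpose.\<close>

definition hessian_law :: "rat \<Rightarrow> rat ^ 3 \<Rightarrow> rat ^ 3 \<Rightarrow> rat ^ 3" where
  "hessian_law m a b = vector
    [b $ 1 * b $ 1 * a $ 1 * a $ 2 + m * a $ 3 * a $ 3 * b $ 3 * b $ 2,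
     - m * b $ 3 * b $ 3 * a $ 3 * a $ 1 - a $ 2 * a $ 2 * b $ 1 * b $ 2,
     b $ 2 * b $ 2 * a $ 3 * a $ 2 - a $ 1 * a $ 1 * b $ 3 * b $ 1]"

definition add_law :: "rat \<Rightarrow> bool \<Rightarrow> rat ^ 3 \<Rightarrow> rat ^ 3 \<Rightarrow> rat ^ 3" where
  "add_law m s a b = (if s then hessian_law m a b else hessian_law m b a)"

lemma swap_xy_simps [simp]: "swap_xy v $ 1 = v $ 2" "swap_xy v $ 2 = v $ 1" "swap_xy v $ 3 = v $ 3"
  by (simp_all add: swap_xy_def)

lemma swap_xy_swap_xy [simp]: "swap_xy (swap_xy v) = v"
  by (simp add: vec3_eq_iff)

lemma swap_xy_eq_0 [simp]: "swap_xy v = 0 \<longleftrightarrow> v = 0"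
  by (auto simp: vec3_eq_iff)

lemma swap_xy_scale: "swap_xy (c *s v) = c *s swap_xy v"
  by (simp add: vec3_eq_iff)

lemma E_form_swap [simp]: "E_form m (swap_xy v) = E_form m v"
  by (simp add: E_form_def)

lemma E_form_scale: "E_form m (c *s v) = c ^ 3 * E_form m v"
  by (simp add: E_form_def algebra_simps)

lemma hessian_law_simps [simp]:
  "hessian_law m a b $ 1 = b $ 1 * b $ 1 * a $ 1 * a $ 2 + m * a $ 3 * a $ 3 * b $ 3 * b $ 2"
  "hessian_law m a b $ 2 = - m * b $ 3 * b $ 3 * a $ 3 * a $ 1 - a $ 2 * a $ 2 * b $ 1 * b $ 2"
  "hessian_law m a b $ 3 = b $ 2 * b $ 2 * a $ 3 * a $ 2 - a $ 1 * a $ 1 * b $ 3 * b $ 1"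
  by (simp_all add: hessian_law_def)

text \<open>Exchanging x and y is negation for the origin [1, -1, 0], and it interchanges the two
  laws; this saves a second computation for associativity.\<close>

lemma add_law_swap: "add_law m s (swap_xy a) (swap_xy b) = (-1) *s swap_xy (add_law m (\<not> s) a b)"
  by (simp add: add_law_def vec3_eq_iff algebra_simps)

lemma add_law_scale_left: "add_law m s (k *s a) b = k\<^sup>2 *s add_law m s a b"
  by (simp add: add_law_def vec3_eq_iff algebra_simps power2_eq_square)

lemma add_law_commute: "add_law m s b a = add_law m (\<not> s) a b"
  by (simp add: add_law_def)

text \<open>\<open>algebra_simps\<close> nests products to the right, so a cube may stand in front
  of a remaining factor. Together with \<open>E_form_0D\<close> this eliminates x^3 for every point
  on the curve and brings polynomials to a normal form modulo the curve equations.\<close>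

lemma cube_red: "x * (x * x) = (c :: 'a :: comm_ring_1) \<Longrightarrow> x * (x * (x * t)) = c * t"
  by (metis mult.assoc)

lemma E_form_0D:
  assumes "E_form m a = 0"
  shows "a $ 1 * (a $ 1 * a $ 1) = m * (a $ 3 * (a $ 3 * a $ 3)) - a $ 2 * (a $ 2 * a $ 2)"
  using assms by (simp add: E_form_def power3_eq_cube)

lemma E_form_hessian_law:
  assumes "E_form m a = 0" "E_form m b = 0"
  shows "E_form m (hessian_law m a b) = 0"
  by (simp add: E_form_def power3_eq_cube algebra_simps assms[THEN E_form_0D] assms[THEN E_form_0D, THEN cube_red])

lemma E_form_add_law:
  "E_form m a = 0 \<Longrightarrow> E_form m b = 0 \<Longrightarrow> E_form m (add_law m s a b) = 0"
  by (simp add: add_law_def E_form_hessian_law)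

section \<open>Chords and tangents of x^3 + y^3 = m z^3\<close>

lemma E_form_comb:
  "E_form m (s *s a + t *s b) = s ^ 3 * E_form m a + 3 * s\<^sup>2 * t * E_polar m a a b
    + 3 * s * t\<^sup>2 * E_polar m a b b + t ^ 3 * E_form m b"
  by (simp add: E_form_def E_polar_def power3_eq_cube power2_eq_square algebra_simps)

lemma cube_eq_iff: "(x :: 'a :: linordered_idom) ^ 3 = y ^ 3 \<longleftrightarrow> x = y"
proof
  assume h: "x ^ 3 = y ^ 3"
  show "x = y"
  proof (rule ccontr)
    assume n: "x \<noteq> y"
    have "(x - y) * (x\<^sup>2 + x * y + y\<^sup>2) = 0"
      using h by (simp add: power3_eq_cube power2_eq_square algebra_simps)
    then have "x\<^sup>2 + x * y + y\<^sup>2 = 0" using n by simp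
    then have z: "(2 * x + y)\<^sup>2 + 3 * y\<^sup>2 = 0"
      by (simp add: power2_eq_square algebra_simps)
    have "3 * y\<^sup>2 = 0" using z zero_le_power2[of "2 * x + y"] zero_le_power2[of y] by linarith
    with z n show False by simp
  qed
qed simp

text \<open>Rational cube roots are unique, so [1, -1, 0] is the only rational point with z =
  0.\<close>

lemma E_zero_at_infinity:
  assumes "E_form m a = 0" "a $ 3 = 0"
  shows "a $ 2 = - a $ 1"
proof -
  have "(a $ 2) ^ 3 = (- a $ 1) ^ 3" using assms by (simp add: E_form_def)
  then show ?thesis unfolding cube_eq_iff .
qed

lemma smooth_E_form:
  assumes "m \<noteq> 0"
  shows "smooth_form (E_form m)"
  unfolding smooth_form_def
proof (intro allI impI)
  fix a :: "rat ^ 3" assume a: "a \<noteq> 0" "E_form m a = 0"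
  show "\<exists>n :: rat ^ 3. n \<noteq> 0 \<and> (\<forall>b k l. (\<forall>s t. E_form m (s *s a + t *s b) = t\<^sup>2 * (s * k + t * l)) \<longrightarrow>
      n $ 1 * b $ 1 + n $ 2 * b $ 2 + n $ 3 * b $ 3 = 0)"
  \<comment> \<open>Up to a factor 3 the witness is the gradient of the form at
    \<open>a\<close>.\<close>
  proof (intro exI[of _ "vector [a $ 1 ^ 2, a $ 2 ^ 2, - m * a $ 3 ^ 2] :: rat ^ 3"] conjI allI impI)
    show "vector [a $ 1 ^ 2, a $ 2 ^ 2, - m * a $ 3 ^ 2] \<noteq> (0 :: rat ^ 3)"
      using a(1) assms by (simp add: vec3_eq_iff)
    fix b k l assume h: "\<forall>s t. E_form m (s *s a + t *s b) = t\<^sup>2 * (s * k + t * l)"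
    \<comment> \<open>The values at (1, 1), (-1, 1) and (0, 1) isolate the coefficient of s^2 t,
      which the right-hand side lacks.\<close>
    from h[rule_format, of 1 1] h[rule_format, of "-1" 1] h[rule_format, of 0 1]
    have "E_polar m a a b = 0" unfolding E_form_comb a(2) by simp
    then show "(vector [a $ 1 ^ 2, a $ 2 ^ 2, - m * a $ 3 ^ 2] :: rat ^ 3) $ 1 * b $ 1
       + (vector [a $ 1 ^ 2, a $ 2 ^ 2, - m * a $ 3 ^ 2] :: rat ^ 3) $ 2 * b $ 2
       + (vector [a $ 1 ^ 2, a $ 2 ^ 2, - m * a $ 3 ^ 2] :: rat ^ 3) $ 3 * b $ 3 = 0"
      by (simp add: E_polar_def power2_eq_square)
  qed
qed

text \<open>The hypotheses say that the curve contains the whole line. Such a line has a point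
  \<open>w\<close> with z = 0 and is tangent to the curve there, so it lies in x + y = 0; there the
  curve equation forces z = 0 throughout, which two independent vectors cannot satisfy.\<close>

lemma E_no_line:
  assumes m: "m \<noteq> 0" and ind: "independent2 a b" and a: "E_form m a = 0" and b: "E_form m b = 0"
    and 0: "E_polar m a a b = 0" "E_polar m a b b = 0"
  shows False
proof -
  have line: "E_form m (s *s a + t *s b) = 0" for s t unfolding E_form_comb using a b 0 by simp
  define w where "w = (b $ 3) *s a + (- a $ 3) *s b"
  have w3: "w $ 3 = 0" by (simp add: w_def)
  have w2: "w $ 2 = - w $ 1" by (rule E_zero_at_infinity[of m, OF _ w3]) (use line[of "b $ 3" "- a $ 3"] in \<open>simp add: w_def\<close>)
  have "w \<noteq> 0"
  proof
    assume "w = 0"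
    then have "a $ 3 = 0" "b $ 3 = 0" using independent2D[OF ind] unfolding w_def by fastforce+
    then have "a $ 2 = - a $ 1" "b $ 2 = - b $ 1" using a b E_zero_at_infinity by blast+
    then have "(b $ 1) *s a + (- a $ 1) *s b = 0"
      using \<open>a $ 3 = 0\<close> \<open>b $ 3 = 0\<close> by (simp add: vec3_eq_iff)
    then have "a $ 1 = 0" using independent2D[OF ind] by fastforce
    then have "a = 0" using \<open>a $ 2 = - a $ 1\<close> \<open>a $ 3 = 0\<close> by (simp add: vec3_eq_iff)
    then show False using independent2D[OF ind, of 1 0] by simp
  qed
  then have w1: "w $ 1 \<noteq> 0" using w2 w3 by (auto simp: vec3_eq_iff)
  have x3: "x $ 3 = 0" if x: "x = p *s a + q *s b" for x p q
  proof -
    have l: "E_form m (s *s w + t *s x) = 0" for s t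
    proof -
      have "s *s w + t *s x = (s * b $ 3 + t * p) *s a + (s * (- a $ 3) + t * q) *s b"
        unfolding x w_def by (simp add: vec3_eq_iff algebra_simps)
      then show ?thesis using line by metis
    qed
    have "E_form m w = 0" "E_form m x = 0" using l[of 1 0] l[of 0 1] by (simp_all)
    then have "E_polar m w w x = 0" using l[of 1 1] l[of "-1" 1] unfolding E_form_comb by simp
    then have "w $ 1 * w $ 1 * (x $ 1 + x $ 2) = 0" by (simp add: E_polar_def w2 w3 algebra_simps)
    then have "x $ 2 = - x $ 1" using w1 by (simp add: add_eq_0_iff)
    then show ?thesis using \<open>E_form m x = 0\<close> m by (simp add: E_form_def)
  qed
  have "a $ 3 = 0" "b $ 3 = 0" using x3[of a 1 0] x3[of b 0 1] by (simp_all)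
  then have "w = 0" by (simp add: w_def vec3_eq_iff)
  with \<open>w \<noteq> 0\<close> show False ..
qed

text \<open>On the chord the form is 3 s t times a linear form with the two mixed polars as
  coefficients. Its zero is the third point, and \<open>E_no_line\<close> keeps it from vanishing
  identically.\<close>

lemma E_chord:
  assumes m: "m \<noteq> 0" and ind: "independent2 a b" and a: "E_form m a = 0" and b: "E_form m b = 0"
  shows "line_section (E_form m) (pt a) (pt b) (pt (E_polar m a b b *s a + (- E_polar m a a b) *s b))"
proof (rule line_sectionI[OF ind, of 3 1 0 0 1 "E_polar m a b b" "- E_polar m a a b"])
  show "(E_polar m a b b, - E_polar m a a b) \<noteq> (0, 0)" using E_no_line[OF assms] by auto
qed (auto simp: E_form_comb a b power2_eq_square algebra_simps)

text \<open>\<open>V\<close> is the third point of the chord and \<open>T\<close> the negative of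
  the candidate sum, so they should be the same point. The vanishing minors are identities modulo
  the curve equations and hold also where one of the vectors is 0.\<close>

lemma add_law_chord:
  fixes s :: bool
  assumes a: "E_form m a = 0" and b: "E_form m b = 0"
  defines "V \<equiv> E_polar m a b b *s a + (- E_polar m a a b) *s b" and "T \<equiv> swap_xy (add_law m s a b)"
  shows "V $ 1 * T $ 2 = V $ 2 * T $ 1" "V $ 1 * T $ 3 = V $ 3 * T $ 1" "V $ 2 * T $ 3 = V $ 3 * T $ 2"
  unfolding V_def T_def
  by (cases s; simp add: add_law_def E_polar_def algebra_simps a[THEN E_form_0D] b[THEN E_form_0D]
      a[THEN E_form_0D, THEN cube_red] b[THEN E_form_0D, THEN cube_red])+

text \<open>Once m z^3 is replaced by x^3 + y^3, the first two coordinates are y (2 x^3 + y^3) and -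
  x (x^3 + 2 y^3), whose only common zero is x = y = 0.\<close>

lemma hessian_law_self_nonzero:
  assumes "m \<noteq> 0" "a \<noteq> 0" "E_form m a = 0"
  shows "hessian_law m a a \<noteq> 0"
proof
  assume h: "hessian_law m a a = 0"
  have c: "m * (a $ 3 * a $ 3 * a $ 3) = a $ 1 * a $ 1 * a $ 1 + a $ 2 * a $ 2 * a $ 2"
    using E_form_0D[OF assms(3)] by (simp add: mult_ac)
  have "a $ 2 * (2 * a $ 1 ^ 3 + a $ 2 ^ 3) = hessian_law m a a $ 1"
    "- a $ 1 * (a $ 1 ^ 3 + 2 * a $ 2 ^ 3) = hessian_law m a a $ 2"
    using c unfolding hessian_law_simps power3_eq_cube by algebra+
  then have 1: "a $ 2 * (2 * a $ 1 ^ 3 + a $ 2 ^ 3) = 0" "a $ 1 * (a $ 1 ^ 3 + 2 * a $ 2 ^ 3) = 0"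
    using h by simp_all
  have "a $ 1 = 0 \<and> a $ 2 = 0"
  proof (cases "a $ 1 = 0 \<or> a $ 2 = 0")
    case True
    then show ?thesis using 1 by auto
  next
    case False
    then have "2 * a $ 1 ^ 3 + a $ 2 ^ 3 = 0" "a $ 1 ^ 3 + 2 * a $ 2 ^ 3 = 0" using 1 by auto
    then have "a $ 1 ^ 3 = 0" by linarith
    with False show ?thesis by simp
  qed
  then have "a $ 3 = 0" using c assms(1) by simp
  with \<open>a $ 1 = 0 \<and> a $ 2 = 0\<close> assms(2) show False by (simp add: vec3_eq_iff)
qed

text \<open>If \<open>T\<close> differs from \<open>a\<close>, both span the tangent and the contact
  at \<open>a\<close> is double. Otherwise \<open>a\<close> is a flex; then one of its coordinates
  vanishes, and on the line through \<open>a\<close> and the corresponding coordinate point the form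
  is a multiple of t^3.\<close>

lemma E_tangent:
  assumes m: "m \<noteq> 0" and a: "a \<noteq> 0" "E_form m a = 0"
  shows "line_section (E_form m) (pt a) (pt a) (pt (swap_xy (hessian_law m a a)))"
proof -
  define T where "T = swap_xy (hessian_law m a a)"
  have T: "T \<noteq> 0" "E_form m T = 0"
    using hessian_law_self_nonzero[OF assms] E_form_hessian_law[OF a(2) a(2)] by (simp_all add: T_def)
  have tan: "E_polar m a a T = 0"
    by (simp add: T_def E_polar_def algebra_simps a(2)[THEN E_form_0D] a(2)[THEN E_form_0D, THEN cube_red])
  have a1: "pt a = pt (1 *s a + 0 *s w)" for w by simp
  have "line_section (E_form m) (pt a) (pt a) (pt T)"
  proof (cases "pt a = pt T")
    case False
    then have ind: "independent2 a T" using a T by (simp add: independent2_iff)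
    have nz: "E_polar m a T T \<noteq> 0" using E_no_line[OF m ind a(2) T(2) tan] by blast
    show ?thesis
      by (rule line_sectionI[OF ind, of "3 * E_polar m a T T" 1 0 1 0 0 1])
        (use nz in \<open>simp_all add: E_form_comb a T tan power2_eq_square\<close>)
  next
    case True
    have flex: ?thesis if "independent2 a b" "k \<noteq> 0" "\<And>s t. E_form m (s *s a + t *s b) = k * t ^ 3" for b k
      unfolding True[symmetric]
      by (rule line_sectionI[OF that(1), of "-k" 1 0 1 0 1 0])
        (use that in \<open>simp_all add: power3_eq_cube\<close>)
    obtain k where k: "T = k *s a" using True a T pt_eq_iff by (auto simp: proportional_def)
    have e: "- m * a $ 3 * a $ 3 * a $ 3 * a $ 1 - a $ 2 * a $ 2 * a $ 1 * a $ 2 = k * a $ 1"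
      "a $ 1 * a $ 1 * a $ 1 * a $ 2 + m * a $ 3 * a $ 3 * a $ 3 * a $ 2 = k * a $ 2"
      using k by (simp_all add: T_def vec3_eq_iff)
    \<comment> \<open>Eliminating \<open>k\<close> leaves x y (x^3 + y^3 + 2 m z^3) = 0, and x^3 +
      y^3 = m z^3 on the curve.\<close>
    have "a $ 1 * a $ 2 * (3 * m * a $ 3 ^ 3) = 0"
      using e E_form_0D[OF a(2)] by algebra
    then consider "a $ 1 = 0" | "a $ 2 = 0" | "a $ 3 = 0" using m by auto
    then show ?thesis
    proof cases
      case 1
      then have "a $ 2 \<noteq> 0 \<and> a $ 3 \<noteq> 0" using a m by (auto simp: vec3_eq_iff E_form_def)
      then have "independent2 a (vector [1, 0, 0])" using 1 by (auto simp: independent2_def vec3_eq_iff)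
      then show ?thesis using flex[of "vector [1, 0, 0]" 1] 1 a(2)
        by (simp add: E_form_def power_mult_distrib algebra_simps)
    next
      case 2
      then have "a $ 1 \<noteq> 0 \<and> a $ 3 \<noteq> 0" using a m by (auto simp: vec3_eq_iff E_form_def)
      then have "independent2 a (vector [0, 1, 0])" using 2 by (auto simp: independent2_def vec3_eq_iff)
      then show ?thesis using flex[of "vector [0, 1, 0]" 1] 2 a(2)
        by (simp add: E_form_def power_mult_distrib algebra_simps)
    next
      case 3
      then have a12: "a $ 2 = - a $ 1" using a E_zero_at_infinity by blast
      then have "a $ 1 \<noteq> 0" using a 3 by (auto simp: vec3_eq_iff)
      then have "independent2 a (vector [0, 0, 1])" using 3 by (auto simp: independent2_def vec3_eq_iff)
      then show ?thesis using flex[of "vector [0, 0, 1]" "- m"] 3 a12 m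
        by (simp add: E_form_def power_mult_distrib)
    qed
  qed
  then show ?thesis by (simp add: T_def)
qed

lemma add_law_self_scale: "add_law m s a (k *s a) = (if s then k\<^sup>2 else k\<^sup>2) *s hessian_law m a a"
  by (auto simp: add_law_def vec3_eq_iff power2_eq_square algebra_simps)

lemma E_line_section:
  assumes m: "m \<noteq> 0" and a: "a \<noteq> 0" "E_form m a = 0" and b: "b \<noteq> 0" "E_form m b = 0"
    and nz: "add_law m s a b \<noteq> 0"
  shows "line_section (E_form m) (pt a) (pt b) (pt (swap_xy (add_law m s a b)))"
proof (cases "pt a = pt b")
  case True
  then obtain k where k: "k \<noteq> 0" "b = k *s a" using a b by (auto simp: pt_eq_iff proportional_def)
  have "pt (swap_xy (add_law m s a b)) = pt (swap_xy (hessian_law m a a))"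
    using k hessian_law_self_nonzero[OF m a] by (simp add: add_law_self_scale swap_xy_scale pt_scale)
  then show ?thesis using E_tangent[OF m a] True by simp
next
  case False
  then have ind: "independent2 a b" using a b by (simp add: independent2_iff)
  define V where "V = E_polar m a b b *s a + (- E_polar m a a b) *s b"
  have V: "V \<noteq> 0" unfolding V_def
    by (rule independent2_nonzero[OF ind]) (use E_no_line[OF m ind a(2) b(2)] in auto)
  have "proportional V (swap_xy (add_law m s a b))"
    using V nz add_law_chord[OF a(2) b(2), of s] unfolding V_def by (intro proportionalI_cross) simp_all
  then have "pt V = pt (swap_xy (add_law m s a b))" using V nz by (simp add: pt_eq_iff)
  then show ?thesis using E_chord[OF m ind a(2) b(2)] by (simp add: V_def)
qed

text \<open>Both sides are products of coordinates of representatives of \<open>(a + b) + c\<close> and of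
  \<open>a + (b + c)\<close>. The two hypotheses on the choice of laws select one element from each orbit of the
  symmetry exchanging \<open>a\<close> and \<open>c\<close>.\<close>

lemma add_law_assoc_13_aux:
  assumes "E_form m a = 0" "E_form m b = 0" "E_form m c = 0" "a $ 3 = 1" "b $ 3 = 1" "c $ 3 = 1"
    and laws: "s \<or> w" "s = w \<or> t \<or> u"
  shows "add_law m t (add_law m s a b) c $ 1 * add_law m u a (add_law m w b c) $ 3 =
    add_law m t (add_law m s a b) c $ 3 * add_law m u a (add_law m w b c) $ 1"
proof -
  obtain x1 y1 x2 y2 x3 y3 where
    xy: "a $ 1 = x1" "a $ 2 = y1" "b $ 1 = x2" "b $ 2 = y2" "c $ 1 = x3" "c $ 2 = y3" by blast
  have E: "x1 * (x1 * x1) = m - y1 * (y1 * y1)" "x2 * (x2 * x2) = m - y2 * (y2 * y2)"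
    "x3 * (x3 * x3) = m - y3 * (y3 * y3)"
    using assms(1-3)[THEN E_form_0D] unfolding assms(4-6) xy by simp_all
  show ?thesis
    using laws
    by (cases s; cases t; cases u; cases w;
        simp only: simp_thms add_law_def if_True if_False hessian_law_simps xy assms(4-6);
        simp add: algebra_simps E E[THEN cube_red])
qed

lemma add_law_assoc_13:
  assumes "E_form m a = 0" "E_form m b = 0" "E_form m c = 0" "a $ 3 = 1" "b $ 3 = 1" "c $ 3 = 1"
  shows "add_law m t (add_law m s a b) c $ 1 * add_law m u a (add_law m w b c) $ 3 =
    add_law m t (add_law m s a b) c $ 3 * add_law m u a (add_law m w b c) $ 1"
proof (cases "(s \<or> w) \<and> (s = w \<or> t \<or> u)")
  case True
  then show ?thesis using add_law_assoc_13_aux[OF assms] by blast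
next
  case False
  \<comment> \<open>Read backwards, with \<open>a\<close> and \<open>c\<close> exchanged, the
    identity has the choices (s, t, u, w) replaced by (not w, not u, not t, not s), and these
    satisfy both conditions.\<close>
  then have "\<not> w \<or> \<not> s" "(\<not> w) = (\<not> s) \<or> \<not> u \<or> \<not> t" by blast+
  from add_law_assoc_13_aux[OF assms(3,2,1,6,5,4) this] show ?thesis
    using add_law_commute[of m "\<not> w" c b] add_law_commute[of m "\<not> u" _ a]
      add_law_commute[of m "\<not> t" c] add_law_commute[of m "\<not> s" b a]
    by (simp add: mult.commute)
qed

section \<open>Group axioms for the cubic with origin [1, -1, 0]\<close>

definition E_origin :: "rat ^ 3" where
  "E_origin = vector [1, -1, 0]"

lemma E_origin_simps [simp]: "E_origin $ 1 = 1" "E_origin $ 2 = - 1" "E_origin $ 3 = 0"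
  by (simp_all add: E_origin_def)

lemma E_origin_nonzero [simp]: "E_origin \<noteq> 0"
  by (simp add: vec3_eq_iff)

lemma E_form_origin [simp]: "E_form m E_origin = 0"
  by (simp add: E_form_def)

lemma E_normal_form:
  assumes "a \<noteq> 0" "E_form m a = 0"
  obtains k w where "k \<noteq> 0" "a = k *s w" "E_form m w = 0" "w $ 3 = 1 \<or> w = E_origin"
proof (cases "a $ 3 = 0")
  case True
  have "a $ 2 = - a $ 1" using assms(2) True by (rule E_zero_at_infinity)
  then have "a = (a $ 1) *s E_origin" "a $ 1 \<noteq> 0" using True assms(1) by (auto simp: vec3_eq_iff)
  then show ?thesis using that by (metis E_form_origin)
next
  case False
  show ?thesis
    by (rule that[of "a $ 3" "(inverse (a $ 3)) *s a"])
      (use False assms in \<open>simp_all add: vector_smult_assoc E_form_scale\<close>)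
qed

text \<open>The scalar may vanish for one of the choices, so even adding the origin takes both
  laws.\<close>

lemma add_law_origin: "add_law m s E_origin b = (if s then - b $ 1 else b $ 2) *s b"
  by (simp add: add_law_def vec3_eq_iff)

lemma add_law_scale_right: "add_law m s a (k *s b) = k\<^sup>2 *s add_law m s a b"
  using add_law_scale_left[of m "\<not> s" k b a] by (simp add: add_law_commute[of m _ _ a])

text \<open>\<open>l\<close> and \<open>r\<close> express that both laws vanish at a pair of affine
  points. They force x2 y1^2 = x1 y2^2, then equality of cubes, hence x1 = y1 and x2 = y2 over the
  rationals. Then all four coordinates agree, and x^4 = - m x = - 2 x^4 is impossible for x \<noteq>
  0.\<close>

lemma hessian_laws_cover:
  fixes x1 :: rat
  assumes m: "m \<noteq> 0" and e: "x1 ^ 3 + y1 ^ 3 = m" "x2 ^ 3 + y2 ^ 3 = m"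
    and l: "x2\<^sup>2 * x1 * y1 = - m * y2" "- m * x1 = y1\<^sup>2 * x2 * y2" "y2\<^sup>2 * y1 = x1\<^sup>2 * x2"
    and r: "x1\<^sup>2 * x2 * y2 = - m * y1" "- m * x2 = y2\<^sup>2 * x1 * y1" "y1\<^sup>2 * y2 = x2\<^sup>2 * x1"
  shows False
proof -
  have "x1 \<noteq> 0" using r(1) l(2) m e by auto
  moreover have "x2 \<noteq> 0" using r(2) l(1) m e by auto
  moreover have c: "x2 * y1\<^sup>2 = x1 * y2\<^sup>2"
  proof -
    have "x1 * x2 * (x2 * y1\<^sup>2 - x1 * y2\<^sup>2) = 0" using l(1) r(1) by algebra
    then show ?thesis using calculation by simp
  qed
  ultimately have nz: "x1 \<noteq> 0" "x2 \<noteq> 0" by blast+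
  have "x2 * y1 ^ 3 = x2 * x1 ^ 3" using c l(3) by algebra
  then have 1: "x1 = y1" using nz cube_eq_iff[of x1 y1] by simp
  have "x1 * y2 ^ 3 = x1 * x2 ^ 3" using c r(3) by algebra
  then have 2: "x2 = y2" using nz cube_eq_iff[of x2 y2] by simp
  have 3: "x2\<^sup>2 * x1 = x1\<^sup>2 * x2" using l(3) 1 2 by simp
  have 4: "x1 = x2" using 3 nz by (simp add: power2_eq_square)
  show False using l(1) e m nz unfolding 1[symmetric] 2[symmetric] 4[symmetric] by algebra
qed

lemma add_law_nonzero:
  assumes m: "m \<noteq> 0" and a: "a \<noteq> 0" "E_form m a = 0" and b: "b \<noteq> 0" "E_form m b = 0"
  shows "\<exists>s. add_law m s a b \<noteq> 0"
proof -
  obtain k v where v: "k \<noteq> 0" "a = k *s v" "E_form m v = 0" "v $ 3 = 1 \<or> v = E_origin" using E_normal_form[OF a] .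
  obtain l w where w: "l \<noteq> 0" "b = l *s w" "E_form m w = 0" "w $ 3 = 1 \<or> w = E_origin" using E_normal_form[OF b] .
  have origin: "\<exists>s. add_law m s E_origin x \<noteq> 0" if "x \<noteq> 0" "E_form m x = 0" for x
  proof -
    have "x $ 1 \<noteq> 0 \<or> x $ 2 \<noteq> 0" using that m by (auto simp: vec3_eq_iff E_form_def)
    then show ?thesis using that(1) unfolding add_law_origin by (metis neg_equal_0_iff_equal vector_mul_eq_0)
  qed
  have nz: "v \<noteq> 0" "w \<noteq> 0" using v(4) w(4) by auto
  have "\<exists>s. add_law m s v w \<noteq> 0"
  proof -
    consider "v = E_origin" | "w = E_origin" | "v $ 3 = 1" "w $ 3 = 1" using v(4) w(4) by blast
    then show ?thesis
    proof cases
      case 1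
      then show ?thesis using origin w(3) nz by blast
    next
      case 2
      obtain s where "add_law m s E_origin v \<noteq> 0" using origin[OF nz(1) v(3)] by blast
      with 2 show ?thesis using add_law_commute[of m s E_origin v] by auto
    next
      case 3
      show ?thesis
      proof (rule ccontr)
        assume "\<nexists>s. add_law m s v w \<noteq> 0"
        then have "add_law m True v w = 0" "add_law m False v w = 0" by blast+
        then show False
          using hessian_laws_cover[of m "v $ 1" "v $ 2" "w $ 1" "w $ 2"] m v(3) w(3) 3
          by (simp add: add_law_def vec3_eq_iff E_form_def power2_eq_square add_eq_0_iff algebra_simps)
      qed
    qed
  qed
  then show ?thesis using v(1,2) w(1,2) by (simp add: add_law_scale_left add_law_scale_right)
qed

abbreviation E_group :: "rat \<Rightarrow> proj_plane monoid" where
  "E_group m \<equiv> cubic_group (E_form m) (pt E_origin)"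

lemma curve_E_eq: "curve_E m0 = E_group (of_int m0)"
  by (simp add: curve_E_def E_form_def[abs_def] E_origin_def)

lemma carrier_cubic_group: "P \<in> carrier (cubic_group F Z) \<longleftrightarrow> (\<exists>v. v \<noteq> 0 \<and> F v = 0 \<and> P = pt v)"
  by (auto simp: cubic_group_def)

lemma one_cubic_group: "\<one>\<^bsub>cubic_group F Z\<^esub> = Z"
  by (simp add: cubic_group_def)

lemma mult_cubic_group: "P \<otimes>\<^bsub>cubic_group F Z\<^esub> Q = third_point F Z (third_point F P Q)"
  by (simp add: cubic_group_def)

lemma E_mult:
  assumes m: "m \<noteq> 0" and a: "a \<noteq> 0" "E_form m a = 0" and b: "b \<noteq> 0" "E_form m b = 0"
    and nz: "add_law m s a b \<noteq> 0"
  shows "pt a \<otimes>\<^bsub>E_group m\<^esub> pt b = pt (add_law m s a b)"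
proof -
  define T where "T = swap_xy (add_law m s a b)"
  have T: "T \<noteq> 0" "E_form m T = 0" using nz a b by (simp_all add: T_def E_form_add_law)
  have 1: "third_point (E_form m) (pt a) (pt b) = pt T"
    unfolding T_def by (rule third_point_eqI[OF smooth_E_form[OF m] E_line_section[OF assms]])
  \<comment> \<open>Joining with the origin exchanges x and y once more, which undoes the swap
    contained in \<open>T\<close>.\<close>
  obtain t where t: "add_law m t E_origin T \<noteq> 0" using add_law_nonzero[OF m E_origin_nonzero _ T] by auto
  have "third_point (E_form m) (pt E_origin) (pt T) = pt (swap_xy (add_law m t E_origin T))"
    by (rule third_point_eqI[OF smooth_E_form[OF m] E_line_section[OF m E_origin_nonzero E_form_origin T t]])
  also have "\<dots> = pt (swap_xy T)" using t T(1)
    by (auto simp: add_law_origin swap_xy_scale pt_scale)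
  finally show ?thesis using 1 by (simp add: mult_cubic_group T_def)
qed

text \<open>Two minors determine the point because only one point has z = 0: for z \<noteq> 0 the
  third minor follows by cancellation, and for z = 0 both points are the origin.\<close>

lemma E_pt_eqI:
  assumes e: "e \<noteq> 0" "E_form m e = 0" and g: "g \<noteq> 0" "E_form m g = 0"
    and c: "e $ 1 * g $ 3 = e $ 3 * g $ 1" "e $ 2 * g $ 3 = e $ 3 * g $ 2"
  shows "pt e = pt g"
proof -
  have "e $ 1 * g $ 2 = e $ 2 * g $ 1"
  proof (cases "e $ 3 = 0")
    case True
    then have "e $ 1 \<noteq> 0 \<or> e $ 2 \<noteq> 0" using e by (auto simp: vec3_eq_iff)
    then have "g $ 3 = 0" using c True by auto
    then show ?thesis using E_zero_at_infinity[OF e(2) True] E_zero_at_infinity[OF g(2)] by simp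
  next
    case False
    have "e $ 3 * (e $ 1 * g $ 2) = e $ 3 * (e $ 2 * g $ 1)" using c by algebra
    then show ?thesis using False by simp
  qed
  then have "proportional e g" using e g c by (intro proportionalI_cross) auto
  then show ?thesis using e g by (simp add: pt_eq_iff)
qed

text \<open>Exchanging x and y turns the second coordinate into the first and complements every
  choice of law; the signs cancel in each product.\<close>

lemma add_law_assoc_23:
  assumes "E_form m a = 0" "E_form m b = 0" "E_form m c = 0" "a $ 3 = 1" "b $ 3 = 1" "c $ 3 = 1"
  shows "add_law m t (add_law m s a b) c $ 2 * add_law m u a (add_law m w b c) $ 3 =
    add_law m t (add_law m s a b) c $ 3 * add_law m u a (add_law m w b c) $ 2"
proof -
  have "add_law m (\<not> t) (add_law m (\<not> s) (swap_xy a) (swap_xy b)) (swap_xy c)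
      = (-1) *s swap_xy (add_law m t (add_law m s a b) c)"
    "add_law m (\<not> u) (swap_xy a) (add_law m (\<not> w) (swap_xy b) (swap_xy c))
      = (-1) *s swap_xy (add_law m u a (add_law m w b c))"
    by (simp_all only: add_law_swap add_law_scale_left add_law_scale_right not_not) simp_all
  then show ?thesis
    using add_law_assoc_13[of m "swap_xy a" "swap_xy b" "swap_xy c" "\<not> t" "\<not> s" "\<not> u" "\<not> w"] assms by simp
qed

lemma E_mult_closed:
  assumes m: "m \<noteq> 0" and "P \<in> carrier (E_group m)" "Q \<in> carrier (E_group m)"
  shows "P \<otimes>\<^bsub>E_group m\<^esub> Q \<in> carrier (E_group m)"
proof -
  obtain a b where a: "a \<noteq> 0" "E_form m a = 0" "P = pt a" and b: "b \<noteq> 0" "E_form m b = 0" "Q = pt b"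
    using assms by (auto simp: carrier_cubic_group)
  obtain s where s: "add_law m s a b \<noteq> 0" using add_law_nonzero[OF m a(1,2) b(1,2)] by blast
  show ?thesis unfolding a(3) b(3) E_mult[OF m a(1,2) b(1,2) s] carrier_cubic_group
    using s a b by (blast intro: E_form_add_law)
qed

lemma E_origin_mult:
  assumes m: "m \<noteq> 0" and P: "P \<in> carrier (E_group m)"
  shows "pt E_origin \<otimes>\<^bsub>E_group m\<^esub> P = P"
proof -
  obtain a where a: "a \<noteq> 0" "E_form m a = 0" "P = pt a" using P by (auto simp: carrier_cubic_group)
  obtain s where s: "add_law m s E_origin a \<noteq> 0" using add_law_nonzero[OF m _ _ a(1,2)] E_origin_nonzero E_form_origin by blast
  show ?thesis unfolding a(3) E_mult[OF m E_origin_nonzero E_form_origin a(1,2) s]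
    using s a(1) by (auto simp: add_law_origin pt_scale)
qed

lemma E_mult_commute:
  assumes m: "m \<noteq> 0" and "P \<in> carrier (E_group m)" "Q \<in> carrier (E_group m)"
  shows "P \<otimes>\<^bsub>E_group m\<^esub> Q = Q \<otimes>\<^bsub>E_group m\<^esub> P"
proof -
  obtain a b where a: "a \<noteq> 0" "E_form m a = 0" "P = pt a" and b: "b \<noteq> 0" "E_form m b = 0" "Q = pt b"
    using assms by (auto simp: carrier_cubic_group)
  obtain s where s: "add_law m s a b \<noteq> 0" using add_law_nonzero[OF m a(1,2) b(1,2)] by blast
  then have "add_law m (\<not> s) b a \<noteq> 0" by (simp add: add_law_commute[of m _ b a])
  from E_mult[OF m b(1,2) a(1,2) this] E_mult[OF m a(1,2) b(1,2) s] show ?thesis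
    unfolding a(3) b(3) by (simp add: add_law_commute[of m _ b a])
qed

text \<open>The polynomial identities assume third coordinate 1. Triples containing the origin, the
  only point without such a representative, follow from neutrality.\<close>

lemma E_mult_assoc:
  assumes m: "m \<noteq> 0" and P: "P \<in> carrier (E_group m)" and Q: "Q \<in> carrier (E_group m)" and R: "R \<in> carrier (E_group m)"
  shows "P \<otimes>\<^bsub>E_group m\<^esub> Q \<otimes>\<^bsub>E_group m\<^esub> R = P \<otimes>\<^bsub>E_group m\<^esub> (Q \<otimes>\<^bsub>E_group m\<^esub> R)"
proof (cases "P = pt E_origin \<or> Q = pt E_origin \<or> R = pt E_origin")
  case True
  have origin: "pt E_origin \<in> carrier (E_group m)"
    unfolding carrier_cubic_group using E_origin_nonzero E_form_origin by blast
  have r: "S \<otimes>\<^bsub>E_group m\<^esub> pt E_origin = S" if "S \<in> carrier (E_group m)" for S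
    using E_mult_commute[OF m that origin] E_origin_mult[OF m that] by simp
  show ?thesis using True P Q R
    by (elim disjE) (simp_all add: r E_origin_mult[OF m] E_mult_closed[OF m])
next
  case False
  have affine: "\<exists>a. a \<noteq> 0 \<and> E_form m a = 0 \<and> a $ 3 = 1 \<and> S = pt a"
    if "S \<in> carrier (E_group m)" "S \<noteq> pt E_origin" for S
  proof -
    obtain v where v: "v \<noteq> 0" "E_form m v = 0" "S = pt v" using \<open>S \<in> _\<close> by (auto simp: carrier_cubic_group)
    obtain k w where w: "k \<noteq> 0" "v = k *s w" "E_form m w = 0" "w $ 3 = 1 \<or> w = E_origin"
      using E_normal_form[OF v(1,2)] .
    have "S = pt w" using v w pt_scale by auto
    then show ?thesis using w(3,4) that(2) by (intro exI[of _ w]) auto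
  qed
  from affine[OF P] obtain a where a: "a \<noteq> 0" "E_form m a = 0" "a $ 3 = 1" "P = pt a" using False by blast
  from affine[OF Q] obtain b where b: "b \<noteq> 0" "E_form m b = 0" "b $ 3 = 1" "Q = pt b" using False by blast
  from affine[OF R] obtain c where c: "c \<noteq> 0" "E_form m c = 0" "c $ 3 = 1" "R = pt c" using False by blast
  obtain s where s: "add_law m s a b \<noteq> 0" using add_law_nonzero[OF m a(1,2) b(1,2)] by blast
  obtain w where w: "add_law m w b c \<noteq> 0" using add_law_nonzero[OF m b(1,2) c(1,2)] by blast
  note d = E_form_add_law[OF a(2) b(2), of s] and f = E_form_add_law[OF b(2) c(2), of w]
  obtain t where t: "add_law m t (add_law m s a b) c \<noteq> 0" using add_law_nonzero[OF m s d c(1,2)] by blast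
  obtain u where u: "add_law m u a (add_law m w b c) \<noteq> 0" using add_law_nonzero[OF m a(1,2) w f] by blast
  have "pt (add_law m t (add_law m s a b) c) = pt (add_law m u a (add_law m w b c))"
    by (rule E_pt_eqI[OF t _ u])
      (use a b c d f add_law_assoc_13 add_law_assoc_23 in \<open>auto intro!: E_form_add_law\<close>)
  then show ?thesis unfolding a(4) b(4) c(4)
    by (simp add: E_mult[OF m a(1,2) b(1,2) s] E_mult[OF m b(1,2) c(1,2) w]
        E_mult[OF m s d c(1,2) t] E_mult[OF m a(1,2) w f u])
qed

lemma comm_group_E:
  assumes m: "m \<noteq> 0"
  shows "comm_group (E_group m)"
proof (rule comm_groupI)
  show "\<one>\<^bsub>E_group m\<^esub> \<in> carrier (E_group m)"
    unfolding one_cubic_group carrier_cubic_group using E_origin_nonzero E_form_origin by blast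
  show "\<exists>Q\<in>carrier (E_group m). Q \<otimes>\<^bsub>E_group m\<^esub> P = \<one>\<^bsub>E_group m\<^esub>" if P: "P \<in> carrier (E_group m)" for P
  proof -
    obtain a where a: "a \<noteq> 0" "E_form m a = 0" "P = pt a" using P by (auto simp: carrier_cubic_group)
    have sa: "swap_xy a \<noteq> 0" "E_form m (swap_xy a) = 0" using a by simp_all
    obtain s where s: "add_law m s (swap_xy a) a \<noteq> 0" using add_law_nonzero[OF m sa a(1,2)] by blast
    define k where "k = add_law m s (swap_xy a) a $ 1"
    \<comment> \<open>The inverse of [x, y, z] is [y, x, z]: under either law the third coordinate
      of the sum cancels, and the second is minus the first.\<close>
    have k: "add_law m s (swap_xy a) a = k *s E_origin"
      by (cases s) (simp_all add: k_def add_law_def vec3_eq_iff algebra_simps)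
    then have "k \<noteq> 0" using s by auto
    have "pt (swap_xy a) \<otimes>\<^bsub>E_group m\<^esub> P = pt E_origin"
      unfolding a(3) E_mult[OF m sa a(1,2) s] k using \<open>k \<noteq> 0\<close> by (simp add: pt_scale)
    moreover have "pt (swap_xy a) \<in> carrier (E_group m)" using sa unfolding carrier_cubic_group by blast
    ultimately show ?thesis by (auto simp: one_cubic_group)
  qed
qed (simp_all only: one_cubic_group E_mult_closed[OF m] E_mult_assoc[OF m] E_origin_mult[OF m],
    rule E_mult_commute[OF m])

subsection \<open>The Weierstrass model\<close>

definition W_form :: "rat \<Rightarrow> rat ^ 3 \<Rightarrow> rat" where
  "W_form B v = v $ 2 ^ 2 * v $ 3 - (v $ 1 ^ 3 - B * v $ 3 ^ 3)"

definition W_origin :: "rat ^ 3" where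
  "W_origin = vector [0, 1, 0]"

lemma W_origin_simps [simp]: "W_origin $ 1 = 0" "W_origin $ 2 = 1" "W_origin $ 3 = 0"
  by (simp_all add: W_origin_def)

lemma W_origin_nonzero [simp]: "W_origin \<noteq> 0"
  by (simp add: vec3_eq_iff)

abbreviation W_group :: "rat \<Rightarrow> proj_plane monoid" where
  "W_group B \<equiv> cubic_group (W_form B) (pt W_origin)"

lemma curve_E'_eq: "curve_E' m0 = W_group (432 * (of_int m0)\<^sup>2)"
  by (simp add: curve_E'_def W_form_def[abs_def] W_origin_def)

lemma smooth_W_form:
  assumes "B \<noteq> 0"
  shows "smooth_form (W_form B)"
  unfolding smooth_form_def
proof (intro allI impI)
  fix a :: "rat ^ 3" assume a: "a \<noteq> 0" "W_form B a = 0"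
  \<comment> \<open>The gradient of \<open>W_form B\<close> at \<open>a\<close>; for nonzero
    \<open>B\<close> it vanishes only at the zero vector.\<close>
  define n :: "rat ^ 3" where
    "n = vector [- 3 * a $ 1 ^ 2, 2 * a $ 2 * a $ 3, a $ 2 ^ 2 + 3 * B * a $ 3 ^ 2]"
  show "\<exists>n :: rat ^ 3. n \<noteq> 0 \<and> (\<forall>b k l. (\<forall>s t. W_form B (s *s a + t *s b) = t\<^sup>2 * (s * k + t * l)) \<longrightarrow>
      n $ 1 * b $ 1 + n $ 2 * b $ 2 + n $ 3 * b $ 3 = 0)"
  proof (intro exI[of _ n] conjI allI impI notI)
    assume "n = 0"
    then have 0: "a $ 1 = 0" "a $ 2 * a $ 3 = 0" "a $ 2 ^ 2 + 3 * B * a $ 3 ^ 2 = 0"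
      by (simp_all add: n_def vec3_eq_iff)
    then have "a $ 2 = 0 \<and> a $ 3 = 0" using assms by auto
    with 0 a(1) show False by (simp add: vec3_eq_iff)
  next
    fix b k l assume h: "\<forall>s t. W_form B (s *s a + t *s b) = t\<^sup>2 * (s * k + t * l)"
    have comb: "W_form B (s *s a + t *s b) = s ^ 3 * W_form B a
        + s\<^sup>2 * t * (n $ 1 * b $ 1 + n $ 2 * b $ 2 + n $ 3 * b $ 3)
        + s * t\<^sup>2 * (b $ 2 ^ 2 * a $ 3 + 2 * a $ 2 * b $ 2 * b $ 3 - 3 * a $ 1 * b $ 1 ^ 2 + 3 * B * a $ 3 * b $ 3 ^ 2)
        + t ^ 3 * W_form B b" for s t
      by (simp add: W_form_def n_def power3_eq_cube power2_eq_square algebra_simps)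
    from h[rule_format, of 1 1] h[rule_format, of "-1" 1] h[rule_format, of 0 1]
    show "n $ 1 * b $ 1 + n $ 2 * b $ 2 + n $ 3 * b $ 3 = 0" unfolding comb a(2) by simp
  qed
qed

text \<open>\<open>Phi\<close> with its denominators cleared. On the cubic, z = 0 implies x + y = 0,
  so the value is then a multiple of [0, 1, 0] and the case distinction disappears.\<close>

definition Phi_vec :: "rat \<Rightarrow> rat ^ 3 \<Rightarrow> rat ^ 3" where
  "Phi_vec m v = vector [12 * m * v $ 3, 36 * m * (v $ 2 - v $ 1), v $ 1 + v $ 2]"

lemma Phi_vec_simps [simp]:
  "Phi_vec m v $ 1 = 12 * m * v $ 3" "Phi_vec m v $ 2 = 36 * m * (v $ 2 - v $ 1)"
  "Phi_vec m v $ 3 = v $ 1 + v $ 2"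
  by (simp_all add: Phi_vec_def)

lemma Phi_vec_comb: "Phi_vec m (s *s u + t *s v) = s *s Phi_vec m u + t *s Phi_vec m v"
  by (simp add: vec3_eq_iff algebra_simps)

lemma Phi_vec_scale: "Phi_vec m (s *s u) = s *s Phi_vec m u"
  by (simp add: vec3_eq_iff algebra_simps)

lemma Phi_vec_inject:
  assumes "m \<noteq> 0"
  shows "Phi_vec m u = Phi_vec m v \<longleftrightarrow> u = v"
proof
  assume "Phi_vec m u = Phi_vec m v"
  then have "u $ 3 = v $ 3" "u $ 2 - u $ 1 = v $ 2 - v $ 1" "u $ 1 + u $ 2 = v $ 1 + v $ 2"
    using assms by (simp_all add: vec3_eq_iff)
  then show "u = v" by (simp add: vec3_eq_iff)
qed simp

lemma Phi_vec_eq_0: "m \<noteq> 0 \<Longrightarrow> Phi_vec m u = 0 \<longleftrightarrow> u = 0"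
  using Phi_vec_inject[of m u 0] by (simp add: vec3_eq_iff)

lemma W_form_Phi_vec: "W_form (432 * m\<^sup>2) (Phi_vec m v) = 1728 * m\<^sup>2 * E_form m v"
  by (simp add: W_form_def E_form_def power2_eq_square power3_eq_cube algebra_simps)

lemma Phi_pt:
  assumes "m0 \<noteq> 0" "v \<noteq> 0" "E_form (of_int m0) v = 0"
  shows "Phi m0 (pt v) = pt (Phi_vec (of_int m0) v)"
proof -
  have *: "Phi m0 (pt v) = pt (if v $ 3 \<noteq> 0
     then vector [12 * of_int m0 * (v $ 3 / (v $ 1 + v $ 2)),
                  36 * of_int m0 * ((v $ 2 - v $ 1) / (v $ 1 + v $ 2)), 1]
     else vector [0, 1, 0])"
    by (rule Phi.abs_eq) (rule proportional_refl[OF assms(2)])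
  show ?thesis
  proof (cases "v $ 3 = 0")
    case True
    then have v2: "v $ 2 = - v $ 1" using assms(3) E_zero_at_infinity by blast
    then have v1: "v $ 1 \<noteq> 0" using True assms(2) by (auto simp: vec3_eq_iff)
    have "Phi_vec (of_int m0) v = (- 72 * of_int m0 * v $ 1) *s W_origin"
      using True v2 by (simp add: vec3_eq_iff)
    then show ?thesis using True v1 assms(1) * pt_scale[of "- 72 * of_int m0 * v $ 1" W_origin]
      by (simp add: W_origin_def[symmetric])
  next
    case False
    have s: "v $ 1 + v $ 2 \<noteq> 0"
    proof
      assume "v $ 1 + v $ 2 = 0"
      then have "v $ 2 = - v $ 1" by (simp add: add_eq_0_iff)
      then have "of_int m0 * v $ 3 ^ 3 = 0" using assms(3) by (simp add: E_form_def)
      with False assms(1) show False by simp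
    qed
    define w :: "rat ^ 3" where "w = vector [12 * of_int m0 * (v $ 3 / (v $ 1 + v $ 2)),
                  36 * of_int m0 * ((v $ 2 - v $ 1) / (v $ 1 + v $ 2)), 1]"
    have "Phi_vec (of_int m0) v = (v $ 1 + v $ 2) *s w"
      using s by (simp add: w_def vec3_eq_iff divide_simps) (simp add: algebra_simps)
    moreover have "w \<noteq> 0" by (simp add: w_def vec3_eq_iff)
    moreover have "Phi m0 (pt v) = pt w" using * False by (simp add: w_def)
    ultimately show ?thesis using pt_scale[OF s] by metis
  qed
qed

lemma Phi_line_section:
  assumes m0: "m0 \<noteq> 0" and l: "line_section (E_form (of_int m0)) P Q R"
  shows "line_section (W_form (432 * (of_int m0)\<^sup>2)) (Phi m0 P) (Phi m0 Q) (Phi m0 R)"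
  using l
proof (rule line_sectionE)
  fix u v p1 p2 q1 q2 r1 r2 c
  assume h: "independent2 u v" "c \<noteq> 0" "(p1, p2) \<noteq> (0, 0)" "(q1, q2) \<noteq> (0, 0)" "(r1, r2) \<noteq> (0, 0)"
    "P = pt (p1 *s u + p2 *s v)" "Q = pt (q1 *s u + q2 *s v)" "R = pt (r1 *s u + r2 *s v)"
    "\<And>s t. E_form (of_int m0) (s *s u + t *s v) =
      c * (s * p2 - t * p1) * (s * q2 - t * q1) * (s * r2 - t * r1)"
  let ?A = "Phi_vec (of_int m0)"
  have m: "(of_int m0 :: rat) \<noteq> 0" using m0 by simp
  have Phi: "Phi m0 (pt (x *s u + y *s v)) = pt (x *s ?A u + y *s ?A v)"
    if "(x, y) \<noteq> (0, 0)" "E_form (of_int m0) (x *s u + y *s v) = 0" for x y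
    using Phi_pt[OF m0 independent2_nonzero[OF h(1) that(1)] that(2)] by (simp add: Phi_vec_comb)
  have ind: "independent2 (?A u) (?A v)"
    using h(1) unfolding independent2_def Phi_vec_comb[symmetric] Phi_vec_eq_0[OF m] .
  show ?thesis
  proof (rule line_sectionI[OF ind _ h(3-5)])
    show "1728 * (of_int m0)\<^sup>2 * c \<noteq> 0" using m h(2) by simp
    show "Phi m0 P = pt (p1 *s ?A u + p2 *s ?A v)" "Phi m0 Q = pt (q1 *s ?A u + q2 *s ?A v)"
      "Phi m0 R = pt (r1 *s ?A u + r2 *s ?A v)"
      unfolding h(6-8) by (rule Phi[OF h(3)] Phi[OF h(4)] Phi[OF h(5)]; simp add: h(9) mult.commute)+
    show "W_form (432 * (of_int m0)\<^sup>2) (s *s ?A u + t *s ?A v) =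
      1728 * (of_int m0)\<^sup>2 * c * (s * p2 - t * p1) * (s * q2 - t * q1) * (s * r2 - t * r1)" for s t
      unfolding Phi_vec_comb[symmetric] W_form_Phi_vec h(9) by simp
  qed
qed

lemma E_third_point_exists:
  assumes m: "m \<noteq> 0" and "P \<in> carrier (E_group m)" "Q \<in> carrier (E_group m)"
  shows "line_section (E_form m) P Q (third_point (E_form m) P Q)"
    and "third_point (E_form m) P Q \<in> carrier (E_group m)"
proof -
  obtain a b where a: "a \<noteq> 0" "E_form m a = 0" "P = pt a" and b: "b \<noteq> 0" "E_form m b = 0" "Q = pt b"
    using assms by (auto simp: carrier_cubic_group)
  obtain s where s: "add_law m s a b \<noteq> 0" using add_law_nonzero[OF m a(1,2) b(1,2)] by blast
  note l = E_line_section[OF m a(1,2) b(1,2) s]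
  show 1: "line_section (E_form m) P Q (third_point (E_form m) P Q)"
    using third_point_eqI[OF smooth_E_form[OF m] l] l a b by simp
  show "third_point (E_form m) P Q \<in> carrier (E_group m)"
    using line_section_on_curve[OF 1] by (auto simp: carrier_cubic_group)
qed

lemma Phi_third_point:
  assumes m0: "m0 \<noteq> 0" and "P \<in> carrier (E_group (of_int m0))" "Q \<in> carrier (E_group (of_int m0))"
  shows "third_point (W_form (432 * (of_int m0)\<^sup>2)) (Phi m0 P) (Phi m0 Q) = Phi m0 (third_point (E_form (of_int m0)) P Q)"
  using m0 assms by (intro third_point_eqI smooth_W_form Phi_line_section E_third_point_exists) auto

lemma Phi_origin:
  assumes "m0 \<noteq> 0"
  shows "Phi m0 (pt E_origin) = pt W_origin"
proof -
  have "Phi_vec (of_int m0) E_origin = (- 72 * of_int m0) *s W_origin" by (simp add: vec3_eq_iff)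
  then show ?thesis using assms Phi_pt[of m0 E_origin] pt_scale[of "- 72 * of_int m0" W_origin] by simp
qed

lemma Phi_iso:
  assumes m0: "m0 \<noteq> 0"
  shows "Phi m0 \<in> iso (curve_E m0) (curve_E' m0)"
proof -
  have m: "(of_int m0 :: rat) \<noteq> 0" using m0 by simp
  let ?G = "E_group (of_int m0)" and ?H = "W_group (432 * (of_int m0)\<^sup>2)"
  have O: "pt E_origin \<in> carrier ?G"
    unfolding carrier_cubic_group using E_origin_nonzero E_form_origin by blast
  have img: "Phi m0 P \<in> carrier ?H" if P: "P \<in> carrier ?G" for P
  proof -
    obtain a where a: "a \<noteq> 0" "E_form (of_int m0) a = 0" "P = pt a" using P by (auto simp: carrier_cubic_group)
    then show ?thesis unfolding carrier_cubic_group
      using Phi_pt[OF m0 a(1,2)] Phi_vec_eq_0[OF m] W_form_Phi_vec[of "of_int m0" a]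
      by (intro exI[of _ "Phi_vec (of_int m0) a"]) simp
  qed
  have "Phi m0 \<in> hom ?G ?H"
  proof (rule homI)
    fix P Q assume P: "P \<in> carrier ?G" and Q: "Q \<in> carrier ?G"
    show "Phi m0 (P \<otimes>\<^bsub>?G\<^esub> Q) = Phi m0 P \<otimes>\<^bsub>?H\<^esub> Phi m0 Q"
      using Phi_third_point[OF m0 P Q] Phi_third_point[OF m0 O E_third_point_exists(2)[OF m P Q]]
      by (simp add: mult_cubic_group Phi_origin[OF m0])
  qed (rule img)
  moreover have "inj_on (Phi m0) (carrier ?G)"
  proof (rule inj_onI)
    fix P Q assume P: "P \<in> carrier ?G" and Q: "Q \<in> carrier ?G" and e: "Phi m0 P = Phi m0 Q"
    obtain a where a: "a \<noteq> 0" "E_form (of_int m0) a = 0" "P = pt a" using P by (auto simp: carrier_cubic_group)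
    obtain b where b: "b \<noteq> 0" "E_form (of_int m0) b = 0" "Q = pt b" using Q by (auto simp: carrier_cubic_group)
    have "proportional (Phi_vec (of_int m0) a) (Phi_vec (of_int m0) b)"
      using e Phi_pt[OF m0 a(1,2)] Phi_pt[OF m0 b(1,2)] a b Phi_vec_eq_0[OF m] pt_eq_iff by simp
    then obtain k where "k \<noteq> 0" "b = k *s a"
      unfolding proportional_def Phi_vec_scale[symmetric] Phi_vec_inject[OF m] by blast
    then show "P = Q" using a b by (simp add: pt_scale)
  qed
  moreover have "carrier ?H \<subseteq> Phi m0 ` carrier ?G"
  proof
    fix Q assume "Q \<in> carrier ?H"
    then obtain w where w: "w \<noteq> 0" "W_form (432 * (of_int m0)\<^sup>2) w = 0" "Q = pt w" by (auto simp: carrier_cubic_group)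
    \<comment> \<open>The preimage of \<open>w\<close> under the invertible linear map
      \<open>Phi_vec\<close>.\<close>
    define a :: "rat ^ 3" where "a = vector [(w $ 3 - w $ 2 / (36 * of_int m0)) / 2,
      (w $ 3 + w $ 2 / (36 * of_int m0)) / 2, w $ 1 / (12 * of_int m0)]"
    have aw: "Phi_vec (of_int m0) a = w" using m by (simp add: vec3_eq_iff a_def field_simps)
    have a: "a \<noteq> 0" "E_form (of_int m0) a = 0"
      using aw w Phi_vec_eq_0[OF m, of a] W_form_Phi_vec[of "of_int m0" a] m by auto
    have "Phi m0 (pt a) = Q" using Phi_pt[OF m0 a] aw w by simp
    moreover have "pt a \<in> carrier ?G" using a unfolding carrier_cubic_group by blast
    ultimately show "Q \<in> Phi m0 ` carrier ?G" by blast
  qed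
  ultimately show ?thesis unfolding curve_E_eq curve_E'_eq iso_def bij_betw_def using img by auto
qed

lemma comm_group_curve_E: "m0 \<noteq> 0 \<Longrightarrow> comm_group (curve_E m0)"
  unfolding curve_E_eq by (rule comm_group_E) simp

lemma comm_group_curve_E':
  assumes m0: "m0 \<noteq> 0"
  shows "comm_group (curve_E' m0)"
proof -
  have "comm_group (curve_E' m0 \<lparr>one := Phi m0 \<one>\<^bsub>curve_E m0\<^esub>\<rparr>)"
    by (rule comm_group.iso_imp_img_comm_group[OF comm_group_curve_E[OF m0] Phi_iso[OF m0]])
  moreover have "curve_E' m0 \<lparr>one := Phi m0 \<one>\<^bsub>curve_E m0\<^esub>\<rparr> = curve_E' m0"
    using Phi_origin[OF m0] by (simp add: curve_E_eq curve_E'_eq cubic_group_def)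
  ultimately show ?thesis by simp
qed

section \<open>Explicit chord and tangent formulas on Y^2 = X^3 - B\<close>

definition affine_pt :: "rat \<Rightarrow> rat \<Rightarrow> proj_plane" where
  "affine_pt x y = pt (vector [x, y, 1])"

lemma affine_vec_nonzero: "vector [x, y, 1] \<noteq> (0 :: rat ^ 3)"
  by (simp add: vec3_eq_iff)

lemma pt_affine:
  assumes "v $ 3 \<noteq> 0"
  shows "pt v = affine_pt (v $ 1 / v $ 3) (v $ 2 / v $ 3)"
proof -
  define w :: "rat ^ 3" where "w = vector [v $ 1 / v $ 3, v $ 2 / v $ 3, 1]"
  have "v = (v $ 3) *s w" using assms by (simp add: w_def vec3_eq_iff)
  moreover have "w \<noteq> 0" unfolding w_def by (rule affine_vec_nonzero)
  ultimately have "pt v = pt w" using pt_scale[OF assms] by metis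
  then show ?thesis by (simp add: w_def affine_pt_def)
qed

lemma affine_pt_neq_origin: "affine_pt x y \<noteq> pt W_origin"
  unfolding affine_pt_def by (subst pt_eq_iff) (auto simp: affine_vec_nonzero proportional_def vec3_eq_iff)

lemma W_form_affine [simp]: "W_form B (vector [x, y, 1]) = 0 \<longleftrightarrow> y\<^sup>2 = x ^ 3 - B"
  by (simp add: W_form_def)

lemma affine_pt_carrier: "y\<^sup>2 = x ^ 3 - B \<Longrightarrow> affine_pt x y \<in> carrier (W_group B)"
  unfolding carrier_cubic_group affine_pt_def
  by (intro exI[of _ "vector [x, y, 1]"]) (simp add: affine_vec_nonzero)

lemma W_group_cases:
  assumes "P \<in> carrier (W_group B)"
  obtains "P = pt W_origin" | x y where "P = affine_pt x y" "y\<^sup>2 = x ^ 3 - B"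
proof -
  obtain v where v: "v \<noteq> 0" "W_form B v = 0" "P = pt v" using assms by (auto simp: carrier_cubic_group)
  show ?thesis
  proof (cases "v $ 3 = 0")
    case True
    then have "v $ 1 = 0" using v(2) by (simp add: W_form_def)
    then have "v = (v $ 2) *s W_origin" "v $ 2 \<noteq> 0" using True v(1) by (auto simp: vec3_eq_iff)
    then have "P = pt W_origin" using v(3) pt_scale[OF _ W_origin_nonzero] by metis
    then show ?thesis by (rule that(1))
  next
    case False
    have "v $ 2 ^ 2 * v $ 3 = v $ 1 ^ 3 - B * v $ 3 ^ 3" using v(2) by (simp add: W_form_def)
    then have "(v $ 2 / v $ 3)\<^sup>2 = (v $ 1 / v $ 3) ^ 3 - B"
      using False by (simp add: divide_simps power2_eq_square power3_eq_cube)
    then show ?thesis using that(2) v(3) pt_affine[OF False] by blast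
  qed
qed

lemma x_height_origin: "x_height (pt W_origin) = 0"
  by (simp add: x_height_def W_origin_def)

lemma x_height_affine: "x_height (affine_pt x y) = ln (real_of_int (rat_height x))"
proof -
  have "X_coord (affine_pt x y) = x"
    unfolding affine_pt_def using X_coord.abs_eq[OF proportional_refl[OF affine_vec_nonzero]] by simp
  then show ?thesis using affine_pt_neq_origin[of x y] by (simp add: x_height_def W_origin_def)
qed

text \<open>In the basis formed by (x, y, 1) and the origin the form is s t (t + 2 y s). This covers
  y = 0, where the vertical line is a tangent.\<close>

lemma W_vertical:
  assumes "y\<^sup>2 = x ^ 3 - B"
  shows "line_section (W_form B) (affine_pt x y) (affine_pt x (- y)) (pt W_origin)"
  unfolding affine_pt_def
proof (rule line_sectionI[of "vector [x, y, 1]" W_origin 1 1 0 1 "- 2 * y" 0 1])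
  show "independent2 (vector [x, y, 1]) W_origin" by (auto simp: independent2_def vec3_eq_iff)
  show "W_form B (s *s vector [x, y, 1] + t *s W_origin) =
      1 * (s * 0 - t * 1) * (s * (- 2 * y) - t * 1) * (s * 1 - t * 0)" for s t
  proof -
    have "x ^ 3 = y\<^sup>2 + B" using assms by simp
    then show ?thesis
      by (simp add: W_form_def power_mult_distrib) (simp add: power2_eq_square power3_eq_cube algebra_simps)
  qed
qed (auto intro!: arg_cong[where f = pt] simp: vec3_eq_iff)

lemma W_origin_flex: "line_section (W_form B) (pt W_origin) (pt W_origin) (pt W_origin)"
proof (rule line_sectionI[of W_origin "vector [1, 0, 0]" 1 1 0 1 0 1 0])
  show "independent2 W_origin (vector [1, 0, 0])" by (auto simp: independent2_def vec3_eq_iff)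
  show "W_form B (s *s W_origin + t *s vector [1, 0, 0]) =
      1 * (s * 0 - t * 1) * (s * 0 - t * 1) * (s * 0 - t * 1)" for s t
    by (simp add: W_form_def power3_eq_cube)
qed auto

lemma W_mult_affine:
  assumes B: "B \<noteq> 0" and e: "y\<^sup>2 = x ^ 3 - B" and l: "line_section (W_form B) P Q (affine_pt x y)"
  shows "P \<otimes>\<^bsub>W_group B\<^esub> Q = affine_pt x (- y)"
proof -
  have "line_section (W_form B) (pt W_origin) (affine_pt x y) (affine_pt x (- y))"
    using W_vertical[OF e] line_section_swap12 line_section_swap23 by blast
  from third_point_eqI[OF smooth_W_form[OF B] this] show ?thesis
    unfolding mult_cubic_group by (simp add: third_point_eqI[OF smooth_W_form[OF B] l])
qed

lemma W_mult_neg: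
  assumes B: "B \<noteq> 0" and e: "y\<^sup>2 = x ^ 3 - B"
  shows "affine_pt x y \<otimes>\<^bsub>W_group B\<^esub> affine_pt x (- y) = pt W_origin"
  unfolding mult_cubic_group
  by (simp add: third_point_eqI[OF smooth_W_form[OF B] W_vertical[OF e]]
      third_point_eqI[OF smooth_W_form[OF B] W_origin_flex])

text \<open>\<open>g1\<close> and \<open>g2\<close> are the coefficients of \<open>s^2 t\<close> and \<open>s t^2\<close> of the form on the chord.\<close>

lemma W_chord:
  assumes B: "B \<noteq> 0" and e: "y1\<^sup>2 = x1 ^ 3 - B" "y2\<^sup>2 = x2 ^ 3 - B" and n: "x1 \<noteq> x2"
  defines "g1 \<equiv> y1\<^sup>2 + 2 * y1 * y2 - 3 * x1\<^sup>2 * x2 + 3 * B"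
    and "g2 \<equiv> y2\<^sup>2 + 2 * y1 * y2 - 3 * x1 * x2\<^sup>2 + 3 * B"
  shows "\<exists>y3. affine_pt x1 y1 \<otimes>\<^bsub>W_group B\<^esub> affine_pt x2 y2
      = affine_pt ((g2 * x1 - g1 * x2) / (x2 - x1) ^ 3) y3"
proof -
  let ?u = "vector [x1, y1, 1] :: rat ^ 3" and ?v = "vector [x2, y2, 1] :: rat ^ 3"
  define R where "R = g2 *s ?u + (- g1) *s ?v"
  have c: "x1 ^ 3 = y1\<^sup>2 + B" "x2 ^ 3 = y2\<^sup>2 + B" using e by simp_all
  \<comment> \<open>On the curve the third coordinate g2 - g1 becomes a perfect cube, so distinct
    abscissas make the third point affine.\<close>
  have R3: "R $ 3 = (x2 - x1) ^ 3"
    using c unfolding R_def g1_def g2_def by (simp add: power2_eq_square power3_eq_cube algebra_simps)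
  have nz: "R $ 3 \<noteq> 0" using R3 n by simp
  have ind: "independent2 ?u ?v"
    unfolding independent2_def
  proof (intro allI impI)
    fix s t assume "s *s ?u + t *s ?v = 0"
    then have 1: "s * x1 + t * x2 = 0" "s + t = 0" by (simp_all add: vec3_eq_iff)
    then have "t * (x2 - x1) = 0" by algebra
    with n 1 show "s = 0 \<and> t = 0" by auto
  qed
  have l: "line_section (W_form B) (affine_pt x1 y1) (affine_pt x2 y2) (pt R)"
    unfolding affine_pt_def R_def
  proof (rule line_sectionI[OF ind, of 1 1 0 0 1 g2 "- g1"])
    show "(g2, - g1) \<noteq> (0, 0)" using nz by (auto simp: R_def)
    show "W_form B (s *s ?u + t *s ?v) = 1 * (s * 0 - t * 1) * (s * 1 - t * 0) * (s * (- g1) - t * g2)" for s t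
    proof -
      have "W_form B (s *s ?u + t *s ?v) = s ^ 3 * (y1\<^sup>2 + B - x1 ^ 3) + t ^ 3 * (y2\<^sup>2 + B - x2 ^ 3)
          + s * t * (s * g1 + t * g2)"
        by (simp add: W_form_def g1_def g2_def power2_eq_square power3_eq_cube algebra_simps)
      then show ?thesis using c by (simp add: algebra_simps)
    qed
  qed auto
  then have l': "line_section (W_form B) (affine_pt x1 y1) (affine_pt x2 y2) (affine_pt (R $ 1 / R $ 3) (R $ 2 / R $ 3))"
    using pt_affine[OF nz] by simp
  then obtain v where v: "v \<noteq> 0" "W_form B v = 0" "affine_pt (R $ 1 / R $ 3) (R $ 2 / R $ 3) = pt v"
    using line_section_on_curve by blast
  then obtain k where k: "vector [R $ 1 / R $ 3, R $ 2 / R $ 3, 1] = k *s v"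
    using pt_eq_iff[OF v(1) affine_vec_nonzero] unfolding affine_pt_def proportional_def by metis
  have sc: "W_form B (k *s v) = k ^ 3 * W_form B v"
    by (simp add: W_form_def power2_eq_square power3_eq_cube algebra_simps)
  have "(R $ 2 / R $ 3)\<^sup>2 = (R $ 1 / R $ 3) ^ 3 - B" using k sc v(2) W_form_affine by (metis mult_zero_right)
  from W_mult_affine[OF B this l'] R3 show ?thesis by (auto simp: R_def)
qed

lemma W_double:
  assumes B: "B \<noteq> 0" and e: "y\<^sup>2 = x ^ 3 - B" and n: "y \<noteq> 0"
  shows "\<exists>y3. affine_pt x y \<otimes>\<^bsub>W_group B\<^esub> affine_pt x y
      = affine_pt ((x ^ 4 + 8 * B * x) / (4 * (x ^ 3 - B))) y3"
proof -
  \<comment> \<open>\<open>?v\<close> is the point at infinity of the tangent, whose slope is 3 x^2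
    / (2 y). On the tangent the form is t^2 (s k - 8 y^3 t), which gives the coordinates of
    \<open>R\<close>.\<close>
  let ?u = "vector [x, y, 1] :: rat ^ 3" and ?v = "vector [2 * y, 3 * x\<^sup>2, 0] :: rat ^ 3"
  define k where "k = 9 * x ^ 4 - 12 * x * y\<^sup>2"
  define R where "R = (8 * y ^ 3) *s ?u + k *s ?v"
  have c: "x ^ 3 = y\<^sup>2 + B" using e by simp
  have R3: "R $ 3 = 8 * y ^ 3" by (simp add: R_def)
  have nz: "R $ 3 \<noteq> 0" using R3 n by simp
  have ind: "independent2 ?u ?v"
    using n by (auto simp: independent2_def vec3_eq_iff)
  have l: "line_section (W_form B) (affine_pt x y) (affine_pt x y) (pt R)"
    unfolding affine_pt_def R_def
  proof (rule line_sectionI[OF ind, of 1 1 0 1 0 "8 * y ^ 3" k])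
    show "(8 * y ^ 3, k) \<noteq> (0, 0)" using n by simp
    show "W_form B (s *s ?u + t *s ?v) = 1 * (s * 0 - t * 1) * (s * 0 - t * 1) * (s * k - t * (8 * y ^ 3))" for s t
    proof -
      have "W_form B (s *s ?u + t *s ?v) = s ^ 3 * (y\<^sup>2 + B - x ^ 3) + t\<^sup>2 * (s * k - t * (8 * y ^ 3))"
        by (simp add: W_form_def k_def power2_eq_square power3_eq_cube power4_eq_xxxx algebra_simps)
      then show ?thesis using c by (simp add: power2_eq_square)
    qed
  qed auto
  then have l': "line_section (W_form B) (affine_pt x y) (affine_pt x y) (affine_pt (R $ 1 / R $ 3) (R $ 2 / R $ 3))"
    using pt_affine[OF nz] by simp
  then obtain v where v: "v \<noteq> 0" "W_form B v = 0" "affine_pt (R $ 1 / R $ 3) (R $ 2 / R $ 3) = pt v"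
    using line_section_on_curve by blast
  then obtain k' where k': "vector [R $ 1 / R $ 3, R $ 2 / R $ 3, 1] = k' *s v"
    using pt_eq_iff[OF v(1) affine_vec_nonzero] unfolding affine_pt_def proportional_def by metis
  have sc: "W_form B (k' *s v) = k' ^ 3 * W_form B v"
    by (simp add: W_form_def power2_eq_square power3_eq_cube algebra_simps)
  have "(R $ 2 / R $ 3)\<^sup>2 = (R $ 1 / R $ 3) ^ 3 - B" using k' sc v(2) W_form_affine by (metis mult_zero_right)
  note m = W_mult_affine[OF B this l']
  have y2: "x ^ 3 - B = y\<^sup>2" using e by simp
  have "R $ 1 / R $ 3 = (x ^ 4 + 8 * B * x) / (4 * (x ^ 3 - B))"
  proof -
    have "R $ 1 = 2 * y * (4 * y\<^sup>2 * x + k)" by (simp add: R_def power2_eq_square power3_eq_cube algebra_simps)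
    also have "4 * y\<^sup>2 * x + k = x ^ 4 + 8 * B * x"
      unfolding k_def using c by algebra
    finally show ?thesis unfolding R3 y2 using n by (simp add: power2_eq_square power3_eq_cube divide_simps)
  qed
  with m show ?thesis by auto
qed

subsection \<open>Heights of rationals\<close>

lemma rat_heightE:
  obtains a b :: int where "t = of_int a / of_int b" "b > 0" "coprime a b" "rat_height t = max \<bar>a\<bar> b"
proof -
  obtain a b where q: "quotient_of t = (a, b)" by (cases "quotient_of t")
  note b = quotient_of_denom_pos[OF q]
  have "rat_height t = max \<bar>a\<bar> b" unfolding rat_height_def q using b by simp
  from that[OF quotient_of_div[OF q] b quotient_of_coprime[OF q] this] show ?thesis .
qed

lemma rat_height_ge_1: "rat_height t \<ge> 1"
  by (rule rat_heightE[of t]) auto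

lemma coprime_fraction_multiple:
  fixes a b n d :: int
  assumes "coprime a b" "n * b = a * d"
  obtains k where "n = k * a" "d = k * b"
proof (cases "b = 0")
  case True
  then have "\<bar>a\<bar> = 1" "d = 0" using assms by auto
  then show ?thesis using that[of "n * a"] True by (simp add: abs_if split: if_splits)
next
  case False
  have "b dvd d" using assms by (metis coprime_commute coprime_dvd_mult_right_iff dvd_triv_right)
  then obtain k where "d = k * b" by (metis dvdE mult.commute)
  with assms(2) False that[of k] show ?thesis by simp
qed

lemma rat_height_fraction:
  fixes n d :: int
  assumes "t = of_int n / of_int d" "d \<noteq> 0"
  obtains k where "k \<noteq> 0" "k dvd n" "k dvd d" "\<bar>k\<bar> * rat_height t = max \<bar>n\<bar> \<bar>d\<bar>"
proof -
  obtain a b where ab: "t = of_int a / of_int b" "b > 0" "coprime a b" "rat_height t = max \<bar>a\<bar> b"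
    using rat_heightE .
  have "of_int (n * b) = (of_int (a * d) :: rat)" using assms ab(1,2) by (simp add: field_simps)
  then have "n * b = a * d" by (simp only: of_int_eq_iff)
  from coprime_fraction_multiple[OF ab(3) this] obtain k where k: "n = k * a" "d = k * b" .
  then have "k \<noteq> 0" using assms by auto
  moreover have "\<bar>k\<bar> * rat_height t = max \<bar>n\<bar> \<bar>d\<bar>"
    using ab(2) unfolding ab(4) k abs_mult by (simp add: max_mult_distrib_left)
  ultimately show ?thesis using that k by simp
qed

lemma rat_height_le:
  assumes "t = of_int n / of_int d" "d \<noteq> 0"
  shows "rat_height t \<le> max \<bar>n\<bar> \<bar>d\<bar>"
proof -
  obtain k where k: "k \<noteq> 0" "\<bar>k\<bar> * rat_height t = max \<bar>n\<bar> \<bar>d\<bar>" using rat_height_fraction[OF assms] .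
  have "1 * rat_height t \<le> \<bar>k\<bar> * rat_height t"
    using k(1) rat_height_ge_1[of t] by (intro mult_right_mono) auto
  with k show ?thesis by simp
qed

text \<open>\<open>p\<close> and \<open>q\<close> are the roots of W X^2 - S X + T. For p = a / b
  and q = c / d in lowest terms, (b X - a) (d X - c) is primitive, so W, S, T are the same integer
  multiple of b d, a d + b c, a c. Thus a c and b d are bounded by M, and a d and b c, with bounded
  sum and product, by 2 M.\<close>

lemma rat_height_mult_le:
  fixes S T W :: int
  assumes "p + q = of_int S / of_int W" "p * q = of_int T / of_int W" "W \<noteq> 0"
    and M: "\<bar>S\<bar> \<le> M" "\<bar>T\<bar> \<le> M" "\<bar>W\<bar> \<le> M"
  shows "rat_height p * rat_height q \<le> 2 * M"
proof -
  obtain a b where ab: "p = of_int a / of_int b" "b > 0" "coprime a b" "rat_height p = max \<bar>a\<bar> b"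
    using rat_heightE .
  obtain c d where cd: "q = of_int c / of_int d" "d > 0" "coprime c d" "rat_height q = max \<bar>c\<bar> d"
    using rat_heightE .
  have "of_int (W * (a * d + b * c)) = (of_int (S * (b * d)) :: rat)" "of_int (W * (a * c)) = (of_int (T * (b * d)) :: rat)"
    using assms(1-3) ab(1,2) cd(1,2) by (simp_all add: field_simps)
  then have e: "W * (a * d + b * c) = S * (b * d)" "W * (a * c) = T * (b * d)" by (simp_all only: of_int_eq_iff)
  \<comment> \<open>Gauss's lemma by hand: \<open>b\<close> is split off \<open>W\<close> with the
    help of both coprimality assumptions, and then \<open>d\<close> in the same way.\<close>
  have "b * d dvd W"
  proof -
    have 1: "b * d dvd W * a * c" using e(2) by (metis dvd_triv_right mult.assoc)
    have 2: "b * d dvd W * (a * d) + W * (b * c)" using e(1) by (metis dvd_triv_right distrib_left)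
    have "b dvd W * (a * d)"
      using 2 by (meson dvd_add_left_iff dvd_mult dvd_mult_left dvd_triv_left)
    then have "b dvd W * d" using ab(3)
      by (metis coprime_commute coprime_dvd_mult_right_iff mult.left_commute)
    moreover have "b dvd W * c" using 1 ab(3)
      by (metis coprime_commute coprime_dvd_mult_right_iff dvd_mult_left mult.assoc mult.left_commute)
    ultimately have "b dvd gcd (W * d) (W * c)" by simp
    then have bW: "b dvd W" using cd(3) by (simp add: gcd_mult_distrib_int[symmetric] gcd.commute)
    then obtain w where w: "W = b * w" by blast
    have "b * d dvd b * (w * a * c)" using 1 w by (simp add: mult.assoc)
    then have "d dvd w * a * c" using ab(2) by simp
    then have da: "d dvd w * a" using cd(3) by (metis coprime_commute coprime_dvd_mult_left_iff)
    have "b * d dvd b * (w * (a * d) + w * (b * c))" using 2 w by (simp add: algebra_simps)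
    then have "d dvd w * (a * d) + w * (b * c)" using ab(2) by simp
    then have "d dvd w * b * c" by (metis dvd_add_right_iff dvd_mult dvd_triv_right mult.assoc)
    then have db: "d dvd w * b" using cd(3) by (metis coprime_commute coprime_dvd_mult_left_iff)
    have "d dvd gcd (w * a) (w * b)" using da db by simp
    then have "d dvd w" using ab(3) by (simp add: gcd_mult_distrib_int[symmetric])
    then show ?thesis using w by simp
  qed
  then obtain k where k: "W = b * d * k" by blast
  then have k0: "k \<noteq> 0" using assms(3) by auto
  have bd: "b * d \<noteq> 0" using ab(2) cd(2) by simp
  have "b * d * S = b * d * (k * (a * d + b * c))" "b * d * T = b * d * (k * (a * c))"
    using e unfolding k by algebra+
  then have ST: "S = k * (a * d + b * c)" "T = k * (a * c)" using bd by (metis mult_left_cancel)+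
  have le: "\<bar>x\<bar> \<le> M" if "\<bar>k * x\<bar> \<le> M" for x
  proof -
    have "1 * \<bar>x\<bar> \<le> \<bar>k\<bar> * \<bar>x\<bar>" using k0 by (intro mult_right_mono) auto
    with that show ?thesis by (simp add: abs_mult)
  qed
  have M': "\<bar>a * d + b * c\<bar> \<le> M" "\<bar>a * c\<bar> \<le> M" "\<bar>b * d\<bar> \<le> M"
    using le M ST k by (simp_all add: mult.commute)
  have mixed: "\<bar>u\<bar> \<le> 2 * M" if "\<bar>u + v\<bar> \<le> M" "\<bar>u\<bar> * \<bar>v\<bar> \<le> M * M" for u v
  proof (rule ccontr)
    assume n: "\<not> \<bar>u\<bar> \<le> 2 * M"
    have M0: "M \<ge> 0" using that(1) by linarith
    have v: "\<bar>v\<bar> > M" using n that(1) by linarith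
    have "M * M < \<bar>u\<bar> * \<bar>v\<bar>" using n v M0 by (intro mult_strict_mono) auto
    with that(2) show False by simp
  qed
  have prod: "\<bar>a * d\<bar> * \<bar>b * c\<bar> \<le> M * M"
  proof -
    have "\<bar>a * c\<bar> * \<bar>b * d\<bar> \<le> M * M" using M' by (intro mult_mono) auto
    then show ?thesis by (simp add: abs_mult mult_ac)
  qed
  have "\<bar>a * d\<bar> \<le> 2 * M" using mixed[of "a * d" "b * c"] M'(1) prod by simp
  moreover have "\<bar>b * c\<bar> \<le> 2 * M" using mixed[of "b * c" "a * d"] M'(1) prod by (simp add: add.commute mult.commute)
  moreover have "0 \<le> M" using M(1) by linarith
  ultimately show ?thesis using M'(2,3) ab(2) cd(2) unfolding ab(4) cd(4)
    by (auto simp: max_def abs_mult mult_ac)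
qed

text \<open>With \<open>dup_den\<close>, the homogeneous form at x = a / d of (x^4 + 8 B x) / (4
  (x^3 - B)), the abscissa of the doubled point.\<close>

definition dup_num :: "int \<Rightarrow> int \<Rightarrow> int \<Rightarrow> int" where
  "dup_num B a d = a ^ 4 + 8 * B * a * d ^ 3"

definition dup_den :: "int \<Rightarrow> int \<Rightarrow> int \<Rightarrow> int" where
  "dup_den B a d = 4 * d * (a ^ 3 - B * d ^ 3)"

lemma dup_abs_le:
  assumes B: "B \<ge> 0" and H: "\<bar>a\<bar> \<le> H" "\<bar>d\<bar> \<le> H"
  shows "\<bar>dup_num B a d\<bar> \<le> (4 + 8 * B) * H ^ 4" "\<bar>dup_den B a d\<bar> \<le> (4 + 8 * B) * H ^ 4"
proof -
  have H0: "H \<ge> 0" using H by linarith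
  have p: "\<bar>a\<bar> ^ i * \<bar>d\<bar> ^ j \<le> H ^ (i + j)" for i j
    using H H0 by (auto simp: power_add intro!: mult_mono power_mono)
  have "\<bar>dup_num B a d\<bar> \<le> \<bar>a ^ 4\<bar> + \<bar>8 * B * a * d ^ 3\<bar>" unfolding dup_num_def by (rule abs_triangle_ineq)
  also have "\<dots> = \<bar>a\<bar> ^ 4 * \<bar>d\<bar> ^ 0 + 8 * B * (\<bar>a\<bar> ^ 1 * \<bar>d\<bar> ^ 3)"
    using B by (simp add: abs_mult power_abs)
  also have "\<dots> \<le> H ^ 4 + 8 * B * H ^ 4" using p[of 4 0] p[of 1 3] B by (intro add_mono mult_left_mono) auto
  also have "\<dots> \<le> (4 + 8 * B) * H ^ 4" using H0 by (simp add: algebra_simps)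
  finally show "\<bar>dup_num B a d\<bar> \<le> (4 + 8 * B) * H ^ 4" .
  have "\<bar>dup_den B a d\<bar> = \<bar>4 * a ^ 3 * d - 4 * B * d ^ 4\<bar>"
    unfolding dup_den_def by (simp add: algebra_simps power_numeral_reduce)
  also have "\<dots> \<le> \<bar>4 * a ^ 3 * d\<bar> + \<bar>4 * B * d ^ 4\<bar>" by (rule abs_triangle_ineq4)
  also have "\<dots> = 4 * (\<bar>a\<bar> ^ 3 * \<bar>d\<bar> ^ 1) + 4 * B * (\<bar>a\<bar> ^ 0 * \<bar>d\<bar> ^ 4)"
    using B by (simp add: abs_mult power_abs)
  also have "\<dots> \<le> 4 * H ^ 4 + 4 * B * H ^ 4" using p[of 3 1] p[of 0 4] B by (intro add_mono mult_left_mono) auto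
  also have "\<dots> \<le> (4 + 8 * B) * H ^ 4" using H0 B by (simp add: algebra_simps)
  finally show "\<bar>dup_den B a d\<bar> \<le> (4 + 8 * B) * H ^ 4" .
qed

text \<open>The two Bezout identities for the duplication forms bound both the cancellation between
  numerator and denominator and the loss of size.\<close>

lemma dup_common_divisor:
  assumes B: "B > 0" and c: "coprime a d" and k: "k dvd dup_num B a d" "k dvd dup_den B a d"
  shows "\<bar>k\<bar> \<le> 108 * B\<^sup>2"
proof -
  have "12 * a\<^sup>2 * d * dup_num B a d - (3 * a ^ 3 + 27 * B * d ^ 3) * dup_den B a d = 108 * B\<^sup>2 * d ^ 7"
    "(9 * a ^ 3 - 8 * B * d ^ 3) * dup_num B a d - 16 * B * a * d\<^sup>2 * dup_den B a d = 9 * a ^ 7"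
    unfolding dup_num_def dup_den_def by algebra+
  then have "k dvd 108 * B\<^sup>2 * d ^ 7" "k dvd 9 * a ^ 7"
    using k by (metis dvd_diff dvd_mult)+
  then have "k dvd 108 * B\<^sup>2 * d ^ 7" "k dvd 108 * B\<^sup>2 * a ^ 7"
    using dvd_mult[of k "9 * a ^ 7" "12 * B\<^sup>2"] by (simp_all add: mult_ac)
  then have "k dvd gcd (108 * B\<^sup>2 * d ^ 7) (108 * B\<^sup>2 * a ^ 7)" by simp
  also have "gcd (108 * B\<^sup>2 * d ^ 7) (108 * B\<^sup>2 * a ^ 7) = 108 * B\<^sup>2"
    using c B by (simp add: gcd_mult_distrib_int[symmetric] coprime_commute)
  finally show ?thesis using B by (intro zdvd_imp_le) auto
qed

lemma dup_size:
  assumes B: "B > 0" and H: "H = max \<bar>a\<bar> \<bar>d\<bar>"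
  shows "H ^ 4 \<le> (15 + 27 * B) * max \<bar>dup_num B a d\<bar> \<bar>dup_den B a d\<bar>"
proof (cases "H = 0")
  case False
  define M where "M = max \<bar>dup_num B a d\<bar> \<bar>dup_den B a d\<bar>"
  have H0: "H > 0" using H False by auto
  have M0: "M \<ge> 0" by (simp add: M_def)
  have p: "\<bar>a\<bar> ^ i * \<bar>d\<bar> ^ j \<le> H ^ (i + j)" for i j
    using H H0 by (auto simp: power_add intro!: mult_mono power_mono)
  have bound: "\<bar>f * dup_num B a d - g * dup_den B a d\<bar> \<le> (u + v) * H ^ 3 * M"
    if "\<bar>f\<bar> \<le> u * H ^ 3" "\<bar>g\<bar> \<le> v * H ^ 3" for f g u v
  proof -
    have "\<bar>f * dup_num B a d - g * dup_den B a d\<bar> \<le> \<bar>f\<bar> * \<bar>dup_num B a d\<bar> + \<bar>g\<bar> * \<bar>dup_den B a d\<bar>"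
      unfolding abs_mult[symmetric] by (rule abs_triangle_ineq4)
    also have "\<dots> \<le> (u * H ^ 3) * M + (v * H ^ 3) * M"
      using that by (intro add_mono mult_mono) (auto simp: M_def)
    finally show ?thesis by (simp add: algebra_simps)
  qed
  \<comment> \<open>When |d| is the maximum, the cofactors of the identity are at most 12 H^3 and (3
    + 27 B) H^3, whence 15 + 27 B; the identity for |a| needs only 9 + 24 B.\<close>
  have "H ^ 7 \<le> (15 + 27 * B) * H ^ 3 * M"
  proof (cases "H = \<bar>d\<bar>")
    case True
    have "108 * B\<^sup>2 * d ^ 7 = 12 * a\<^sup>2 * d * dup_num B a d - (3 * a ^ 3 + 27 * B * d ^ 3) * dup_den B a d"
      unfolding dup_num_def dup_den_def by algebra
    moreover have "\<bar>12 * a\<^sup>2 * d\<bar> \<le> 12 * H ^ 3" using p[of 2 1] by (simp add: abs_mult power_abs)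
    moreover have "\<bar>3 * a ^ 3 + 27 * B * d ^ 3\<bar> \<le> (3 + 27 * B) * H ^ 3"
    proof -
      have "\<bar>3 * a ^ 3 + 27 * B * d ^ 3\<bar> \<le> 3 * \<bar>a\<bar> ^ 3 + 27 * B * \<bar>d\<bar> ^ 3"
        using abs_triangle_ineq[of "3 * a ^ 3" "27 * B * d ^ 3"] B by (simp add: abs_mult power_abs)
      also have "\<dots> \<le> 3 * H ^ 3 + 27 * B * H ^ 3" using p[of 3 0] p[of 0 3] B by (intro add_mono mult_left_mono) auto
      finally show ?thesis by (simp add: algebra_simps)
    qed
    ultimately have "\<bar>108 * B\<^sup>2 * d ^ 7\<bar> \<le> (15 + 27 * B) * H ^ 3 * M"
      using bound[of "12 * a\<^sup>2 * d" 12 "3 * a ^ 3 + 27 * B * d ^ 3" "3 + 27 * B"] by simp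
    moreover have "\<bar>108 * B\<^sup>2 * d ^ 7\<bar> = 108 * B\<^sup>2 * H ^ 7" using True B by (simp add: abs_mult power_abs)
    moreover have "1 * H ^ 7 \<le> 108 * B\<^sup>2 * H ^ 7"
    proof (rule mult_right_mono)
      have "1 \<le> B\<^sup>2" using B by simp
      then show "1 \<le> 108 * B\<^sup>2" by linarith
    qed (use H0 in simp)
    ultimately show ?thesis by linarith
  next
    case False
    then have Ha: "H = \<bar>a\<bar>" using H by (auto simp: max_def split: if_splits)
    have "9 * a ^ 7 = (9 * a ^ 3 - 8 * B * d ^ 3) * dup_num B a d - 16 * B * a * d\<^sup>2 * dup_den B a d"
      unfolding dup_num_def dup_den_def by algebra
    moreover have "\<bar>16 * B * a * d\<^sup>2\<bar> \<le> 16 * B * H ^ 3" using p[of 1 2] B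
      by (simp add: abs_mult power_abs mult.assoc power3_eq_cube)
    moreover have "\<bar>9 * a ^ 3 - 8 * B * d ^ 3\<bar> \<le> (9 + 8 * B) * H ^ 3"
    proof -
      have "\<bar>9 * a ^ 3 - 8 * B * d ^ 3\<bar> \<le> 9 * \<bar>a\<bar> ^ 3 + 8 * B * \<bar>d\<bar> ^ 3"
        using abs_triangle_ineq4[of "9 * a ^ 3" "8 * B * d ^ 3"] B by (simp add: abs_mult power_abs)
      also have "\<dots> \<le> 9 * H ^ 3 + 8 * B * H ^ 3" using p[of 3 0] p[of 0 3] B by (intro add_mono mult_left_mono) auto
      finally show ?thesis by (simp add: algebra_simps)
    qed
    ultimately have "\<bar>9 * a ^ 7\<bar> \<le> (9 + 24 * B) * H ^ 3 * M"
      using bound[of "9 * a ^ 3 - 8 * B * d ^ 3" "9 + 8 * B" "16 * B * a * d\<^sup>2" "16 * B"] by (simp add: add.commute)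
    moreover have "\<bar>9 * a ^ 7\<bar> = 9 * H ^ 7" using Ha by (simp add: abs_mult power_abs)
    moreover have "(9 + 24 * B) * H ^ 3 * M \<le> (15 + 27 * B) * H ^ 3 * M"
      using B H0 M0 by (intro mult_right_mono) auto
    moreover have "0 \<le> H ^ 7" using H0 by simp
    ultimately show ?thesis by linarith
  qed
  then have "H ^ 3 * H ^ 4 \<le> H ^ 3 * ((15 + 27 * B) * M)"
    by (simp add: power_add[symmetric] mult_ac)
  moreover have "0 < H ^ 3" using H0 by simp
  ultimately have "H ^ 4 \<le> (15 + 27 * B) * M" by (simp only: mult_le_cancel_left_pos)
  then show ?thesis unfolding M_def .
qed (use B in simp)

subsection \<open>Canonical heights\<close>

text \<open>Tate's averaging argument for a quasi-quadratic function on an abelian group.\<close>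

locale quasi_quadratic = comm_group G for G (structure) +
  fixes h :: "'a \<Rightarrow> real" and C :: real
  assumes h_nonneg: "x \<in> carrier G \<Longrightarrow> 0 \<le> h x"
    and h_parallelogram: "x \<in> carrier G \<Longrightarrow> y \<in> carrier G \<Longrightarrow>
      h (x \<otimes> y) + h (x \<otimes> inv y) \<le> 2 * h x + 2 * h y + C"
    and h_double: "x \<in> carrier G \<Longrightarrow> 4 * h x \<le> h (x \<otimes> x) + C"
begin

text \<open>For \<open>x_height\<close> on \<open>curve_E'\<close> this is twice
  \<open>canonical_height\<close>.\<close>

definition tate_limit :: "'a \<Rightarrow> real" where
  "tate_limit x = lim (\<lambda>k. h (x [^] (2 ^ k :: nat)) / 4 ^ k)"

lemma C_nonneg: "0 \<le> C"
proof -
  have "2 * h \<one> \<le> 4 * h \<one> + C" "4 * h \<one> \<le> h \<one> + C"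
    using h_parallelogram[OF one_closed one_closed] h_double[OF one_closed] by simp_all
  with h_nonneg[OF one_closed] show ?thesis by linarith
qed

lemma h_double_upper:
  assumes "x \<in> carrier G"
  shows "h (x \<otimes> x) \<le> 4 * h x + C"
  using h_parallelogram[OF assms assms] assms h_nonneg[of "x \<otimes> inv x"] by simp

lemma pow_double: "x \<in> carrier G \<Longrightarrow> x [^] (2 ^ Suc k :: nat) = x [^] (2 ^ k :: nat) \<otimes> x [^] (2 ^ k :: nat)"
  by (simp add: nat_pow_mult mult_2)

lemma
  assumes x: "x \<in> carrier G"
  shows tate_limit_LIMSEQ: "(\<lambda>k. h (x [^] (2 ^ k :: nat)) / 4 ^ k) \<longlonglongrightarrow> tate_limit x"
    and tate_limit_lower: "h x \<le> tate_limit x + C / 3"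
proof -
  define a where "a k = h (x [^] (2 ^ k :: nat)) / 4 ^ k" for k
  have up: "a (Suc k) \<le> a k + C / 4 ^ Suc k" for k
    using divide_right_mono[OF h_double_upper[of "x [^] (2 ^ k :: nat)"], of "4 ^ Suc k"] x
    unfolding a_def pow_double[OF x] by (simp add: add_divide_distrib)
  have lo: "a k - C / 4 ^ Suc k \<le> a (Suc k)" for k
    using divide_right_mono[OF h_double[of "x [^] (2 ^ k :: nat)"], of "4 ^ Suc k"] x
    unfolding a_def pow_double[OF x] by (simp add: add_divide_distrib)
  \<comment> \<open>\<open>C / (3 * 4 ^ k)\<close> is the sum of the errors
    \<open>C / 4 ^ Suc j\<close> over j \<ge> k. Added to the sequence it yields a decreasing one,
    subtracted an increasing one; the latter at k = 0 gives the comparison of \<open>h\<close> with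
    its limit.\<close>
  have geo: "C / (3 * 4 ^ k) = C / 4 ^ Suc k + C / (3 * 4 ^ Suc k)" for k
    by (simp add: field_simps)
  have "decseq (\<lambda>k. a k + C / (3 * 4 ^ k))"
    by (rule decseq_SucI) (use up geo in \<open>smt (verit)\<close>)
  moreover have "0 \<le> a k + C / (3 * 4 ^ k)" for k
    using h_nonneg[of "x [^] (2 ^ k :: nat)"] x C_nonneg by (simp add: a_def)
  ultimately obtain L where L: "(\<lambda>k. a k + C / (3 * 4 ^ k)) \<longlonglongrightarrow> L"
    using decseq_convergent by blast
  have z: "(\<lambda>k. C / (3 * 4 ^ k)) \<longlonglongrightarrow> 0"
  proof -
    have "(\<lambda>k. C / 3 * (1 / 4) ^ k) \<longlonglongrightarrow> C / 3 * 0"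
      by (intro tendsto_mult_left LIMSEQ_power_zero) simp
    then show ?thesis by (simp add: power_divide)
  qed
  have aL: "a \<longlonglongrightarrow> L" using tendsto_diff[OF L z] by simp
  then have tate_limit: "tate_limit x = L" unfolding tate_limit_def a_def[abs_def] by (rule limI)
  show "(\<lambda>k. h (x [^] (2 ^ k :: nat)) / 4 ^ k) \<longlonglongrightarrow> tate_limit x"
    using aL tate_limit by (simp add: a_def[abs_def])
  have "incseq (\<lambda>k. a k - C / (3 * 4 ^ k))"
    by (rule incseq_SucI) (use lo geo in \<open>smt (verit)\<close>)
  moreover have "(\<lambda>k. a k - C / (3 * 4 ^ k)) \<longlonglongrightarrow> L" using tendsto_diff[OF aL z] by simp
  ultimately have "a 0 - C / (3 * 4 ^ 0) \<le> L" by (rule incseq_le)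
  then show "h x \<le> tate_limit x + C / 3" unfolding tate_limit using x by (simp add: a_def)
qed

lemma tate_limit_nonneg:
  assumes x: "x \<in> carrier G"
  shows "0 \<le> tate_limit x"
  by (rule LIMSEQ_le_const[OF tate_limit_LIMSEQ[OF x]]) (use h_nonneg x in auto)

lemma tate_limit_double:
  assumes x: "x \<in> carrier G"
  shows "tate_limit (x \<otimes> x) = 4 * tate_limit x"
proof -
  have "(\<lambda>k. h (x [^] (2 ^ Suc k :: nat)) / 4 ^ Suc k) \<longlonglongrightarrow> tate_limit x"
    by (rule LIMSEQ_Suc[OF tate_limit_LIMSEQ[OF x]])
  then have "(\<lambda>k. 4 * (h (x [^] (2 ^ Suc k :: nat)) / 4 ^ Suc k)) \<longlonglongrightarrow> 4 * tate_limit x"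
    by (rule tendsto_mult_left)
  moreover have "(x \<otimes> x) [^] (2 ^ k :: nat) = x [^] (2 ^ Suc k :: nat)" for k
    unfolding pow_double[OF x] using x by (simp add: nat_pow_distrib)
  ultimately show ?thesis
    using LIMSEQ_unique[OF tate_limit_LIMSEQ[of "x \<otimes> x"]] x by simp
qed

lemma tate_limit_parallelogram_le:
  assumes x: "x \<in> carrier G" and y: "y \<in> carrier G"
  shows "tate_limit (x \<otimes> y) + tate_limit (x \<otimes> inv y) \<le> 2 * tate_limit x + 2 * tate_limit y"
proof -
  let ?a = "\<lambda>x k. h (x [^] (2 ^ k :: nat)) / 4 ^ k"
  have z: "(\<lambda>k. C * (1 / 4) ^ k) \<longlonglongrightarrow> C * 0"
    by (intro tendsto_mult_left LIMSEQ_power_zero) simp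
  have "(\<lambda>k. 2 * ?a x k + 2 * ?a y k + C * (1 / 4) ^ k) \<longlonglongrightarrow> 2 * tate_limit x + 2 * tate_limit y + C * 0"
    by (rule tendsto_add[OF _ z], intro tendsto_add tendsto_mult_left tate_limit_LIMSEQ x y)
  moreover have "(\<lambda>k. ?a (x \<otimes> y) k + ?a (x \<otimes> inv y) k) \<longlonglongrightarrow> tate_limit (x \<otimes> y) + tate_limit (x \<otimes> inv y)"
    by (intro tendsto_add tate_limit_LIMSEQ) (use x y in auto)
  moreover have "?a (x \<otimes> y) k + ?a (x \<otimes> inv y) k \<le> 2 * ?a x k + 2 * ?a y k + C * (1 / 4) ^ k" for k
  proof -
    have "h ((x \<otimes> y) [^] (2 ^ k :: nat)) + h ((x \<otimes> inv y) [^] (2 ^ k :: nat))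
        \<le> 2 * h (x [^] (2 ^ k :: nat)) + 2 * h (y [^] (2 ^ k :: nat)) + C"
      using h_parallelogram[of "x [^] (2 ^ k :: nat)" "y [^] (2 ^ k :: nat)"] x y
      by (simp add: nat_pow_distrib nat_pow_inv)
    from divide_right_mono[OF this, of "4 ^ k"] show ?thesis
      by (simp add: add_divide_distrib power_divide)
  qed
  ultimately show ?thesis using LIMSEQ_le[of _ _ _ "2 * tate_limit x + 2 * tate_limit y"] by fastforce
qed

text \<open>Applied to x + y and x - y, whose sum and difference are 2x and 2y, the inequality
  becomes its own converse by the exact factor 4 under doubling.\<close>

lemma tate_limit_parallelogram:
  assumes x: "x \<in> carrier G" and y: "y \<in> carrier G"
  shows "tate_limit (x \<otimes> y) + tate_limit (x \<otimes> inv y) = 2 * tate_limit x + 2 * tate_limit y"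
proof -
  have "x \<otimes> y \<otimes> (x \<otimes> inv y) = x \<otimes> x"
  proof -
    have "x \<otimes> y \<otimes> (x \<otimes> inv y) = x \<otimes> x \<otimes> (y \<otimes> inv y)" using x y by (simp only: m_ac m_closed inv_closed)
    then show ?thesis using x y by simp
  qed
  moreover have "x \<otimes> y \<otimes> inv (x \<otimes> inv y) = y \<otimes> y"
  proof -
    have "x \<otimes> y \<otimes> inv (x \<otimes> inv y) = x \<otimes> inv x \<otimes> (y \<otimes> y)"
      using x y by (simp only: inv_mult inv_inv m_ac m_closed inv_closed)
    then show ?thesis using x y by simp
  qed
  ultimately have "4 * tate_limit x + 4 * tate_limit y \<le> 2 * tate_limit (x \<otimes> y) + 2 * tate_limit (x \<otimes> inv y)"
    using tate_limit_parallelogram_le[of "x \<otimes> y" "x \<otimes> inv y"] x y tate_limit_double[OF x] tate_limit_double[OF y] by simp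
  with tate_limit_parallelogram_le[OF x y] show ?thesis by linarith
qed

lemma tate_limit_one: "tate_limit \<one> = 0"
  using tate_limit_double[OF one_closed] by simp

lemma tate_limit_mult_le:
  assumes "x \<in> carrier G" "y \<in> carrier G"
  shows "tate_limit (x \<otimes> y) \<le> 2 * tate_limit x + 2 * tate_limit y"
  using tate_limit_parallelogram_le[OF assms] tate_limit_nonneg[of "x \<otimes> inv y"] assms by simp

text \<open>Induction through the parallelogram law for (n + 1) x and x, whose difference is n
  x.\<close>

lemma tate_limit_pow:
  assumes x: "x \<in> carrier G"
  shows "tate_limit (x [^] (n :: nat)) = (real n)\<^sup>2 * tate_limit x"
proof (induction n rule: induct_nat_012)
  case (ge2 n)
  have "x [^] Suc n \<otimes> inv x = x [^] n" using x by (simp add: m_assoc)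
  with tate_limit_parallelogram[of "x [^] Suc n" x] x ge2 show ?case
    by (simp add: power2_eq_square algebra_simps)
qed (use x in \<open>simp_all add: tate_limit_one\<close>)

text \<open>The factor solves a(1) = 1 and a(k + 1) = 2 a(k) + 2, the cost of splitting off one
  summand by \<open>tate_limit_mult_le\<close>.\<close>

lemma tate_limit_finprod_le:
  assumes k: "k \<ge> 1" and x: "\<And>i. i \<in> {1..k} \<Longrightarrow> x i \<in> carrier G"
    and n: "\<And>i. i \<in> {1..k} \<Longrightarrow> n i \<le> N" and M: "\<And>i. i \<in> {1..k} \<Longrightarrow> tate_limit (x i) \<le> M"
  shows "tate_limit (\<Otimes>i\<in>{1..k}. x i [^] (n i :: nat)) \<le> (3 * 2 ^ (k - 1) - 2) * ((real N)\<^sup>2 * M)"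
  using k x n M
proof (induction k rule: nat_induct_at_least)
  case base
  have "tate_limit (x 1 [^] n 1) \<le> (real N)\<^sup>2 * M"
    using base tate_limit_pow[of "x 1" "n 1"] tate_limit_nonneg[of "x 1"] by (auto intro!: mult_mono power_mono)
  then show ?case using base by simp
next
  case (Suc k)
  let ?y = "\<Otimes>i\<in>{1..k}. x i [^] n i"
  have c: "(\<lambda>i. x i [^] n i) \<in> {1..k} \<rightarrow> carrier G" "x (Suc k) \<in> carrier G" using Suc.prems(1) by auto
  have y: "tate_limit ?y \<le> (3 * 2 ^ (k - 1) - 2) * ((real N)\<^sup>2 * M)" using Suc by auto
  have p: "tate_limit (x (Suc k) [^] n (Suc k)) \<le> (real N)\<^sup>2 * M"
    using Suc.prems tate_limit_pow[of "x (Suc k)" "n (Suc k)"] tate_limit_nonneg[of "x (Suc k)"]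
    by (auto intro!: mult_mono power_mono)
  have "{1..Suc k} = insert (Suc k) {1..k}" by auto
  then have "(\<Otimes>i\<in>{1..Suc k}. x i [^] n i) = x (Suc k) [^] n (Suc k) \<otimes> ?y"
    using c by (simp add: finprod_insert)
  then have "tate_limit (\<Otimes>i\<in>{1..Suc k}. x i [^] n i) \<le> 2 * ((real N)\<^sup>2 * M) + 2 * ((3 * 2 ^ (k - 1) - 2) * ((real N)\<^sup>2 * M))"
    using tate_limit_mult_le[of "x (Suc k) [^] n (Suc k)" ?y] c p y by simp
  also have "\<dots> = (3 * 2 ^ (Suc k - 1) - 2) * ((real N)\<^sup>2 * M)"
    using Suc.hyps by (cases k) (simp_all add: algebra_simps)
  finally show ?case .
qed

end

section \<open>Height inequalities for addition and duplication on Y^2 = X^3 - B\<close>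

lemma x_height_nonneg: "0 \<le> x_height P"
  using rat_height_ge_1[of "X_coord P"] by (simp add: x_height_def)

text \<open>\<open>x3 y2\<close> and \<open>x3 (- y2)\<close> are the abscissas of P + Q and P - Q.
  Only even powers of the ordinates survive in their sum and product, so the curve equations leave
  expressions in x1 and x2, and all but two factors x2 - x1 cancel from the denominators.\<close>

lemma chord_symmetric_functions:
  fixes x1 :: rat
  assumes e: "y1\<^sup>2 = x1 ^ 3 - B" "y2\<^sup>2 = x2 ^ 3 - B" and n: "x1 \<noteq> x2"
  defines "g1 \<equiv> \<lambda>y. y1\<^sup>2 + 2 * y1 * y - 3 * x1\<^sup>2 * x2 + 3 * B"
    and "g2 \<equiv> \<lambda>y. y\<^sup>2 + 2 * y1 * y - 3 * x1 * x2\<^sup>2 + 3 * B"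
  defines "x3 \<equiv> \<lambda>y. (g2 y * x1 - g1 y * x2) / (x2 - x1) ^ 3"
  shows "x3 y2 + x3 (- y2) = (2 * x1 * x2 * (x1 + x2) - 4 * B) / (x1 - x2)\<^sup>2"
    and "x3 y2 * x3 (- y2) = (x1\<^sup>2 * x2\<^sup>2 + 4 * B * (x1 + x2)) / (x1 - x2)\<^sup>2"
proof -
  define d where "d = x2 - x1"
  have d: "d \<noteq> 0" using n by (simp add: d_def)
  have dd: "(x1 - x2)\<^sup>2 = d\<^sup>2" by (simp add: d_def power2_commute)
  define N where "N y = g2 y * x1 - g1 y * x2" for y
  have "N y2 + N (- y2) = (2 * x1 * x2 * (x1 + x2) - 4 * B) * d"
    unfolding N_def g1_def g2_def d_def using e by algebra
  moreover have "N y2 * N (- y2) = (x1\<^sup>2 * x2\<^sup>2 + 4 * B * (x1 + x2)) * d ^ 4"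
    unfolding N_def g1_def g2_def d_def using e by algebra
  moreover have "x3 y = N y / d ^ 3" for y by (simp add: x3_def N_def d_def)
  ultimately show "x3 y2 + x3 (- y2) = (2 * x1 * x2 * (x1 + x2) - 4 * B) / (x1 - x2)\<^sup>2"
    "x3 y2 * x3 (- y2) = (x1\<^sup>2 * x2\<^sup>2 + 4 * B * (x1 + x2)) / (x1 - x2)\<^sup>2"
    unfolding dd using d
    by (simp_all add: add_divide_distrib[symmetric] power2_eq_square power3_eq_cube power4_eq_xxxx)
qed

text \<open>Over the common denominator \<open>W\<close> the numerators \<open>S\<close> and
  \<open>T\<close> are, like \<open>W\<close>, of bidegree (2, 2) in (a, b) and (c, d), with
  coefficients of absolute sum at most 4 + 8 B; \<open>rat_height_mult_le\<close> doubles
  this.\<close>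

lemma rat_height_chord:
  assumes B: "B > 0" and n: "x1 \<noteq> x2"
    and s: "p + q = (2 * x1 * x2 * (x1 + x2) - 4 * of_int B) / (x1 - x2)\<^sup>2"
    and t: "p * q = (x1\<^sup>2 * x2\<^sup>2 + 4 * of_int B * (x1 + x2)) / (x1 - x2)\<^sup>2"
  shows "rat_height p * rat_height q \<le> (8 + 16 * B) * ((rat_height x1)\<^sup>2 * (rat_height x2)\<^sup>2)"
proof -
  obtain a b where ab: "x1 = of_int a / of_int b" "b > 0" "rat_height x1 = max \<bar>a\<bar> b" using rat_heightE .
  obtain c d where cd: "x2 = of_int c / of_int d" "d > 0" "rat_height x2 = max \<bar>c\<bar> d" using rat_heightE .
  define H K where "H = rat_height x1" and "K = rat_height x2"
  have le: "\<bar>a\<bar> \<le> H" "\<bar>b\<bar> \<le> H" "\<bar>c\<bar> \<le> K" "\<bar>d\<bar> \<le> K" using ab cd by (auto simp: H_def K_def)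
  have pos: "0 \<le> H" "0 \<le> K" using le by linarith+
  define S where "S = 2 * a * c * (a * d + c * b) - 4 * B * (b * b * d * d)"
  define T where "T = a * a * c * c + 4 * B * b * d * (a * d + c * b)"
  define W where "W = (a * d - c * b)\<^sup>2"
  have ndc: "a * d - c * b \<noteq> 0"
  proof
    assume "a * d - c * b = 0"
    then have "of_int (a * d) = (of_int (c * b) :: rat)" by simp
    then show False using n ab(1,2) cd(1,2) by (simp add: field_simps)
  qed
  have x12: "x1 - x2 = of_int (a * d - c * b) / of_int (b * d)"
    unfolding ab(1) cd(1) using ab(2) cd(2) by (simp add: divide_simps)
  have "p + q = of_int S / of_int W"
    unfolding s x12 using ab(2) cd(2) ndc unfolding ab(1) cd(1) S_def W_def
    by (simp add: power2_eq_square divide_simps)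
  moreover have "p * q = of_int T / of_int W"
    unfolding t x12 using ab(2) cd(2) ndc unfolding ab(1) cd(1) T_def W_def
    by (simp add: power2_eq_square divide_simps)
  moreover have "W \<noteq> 0" using ndc by (simp add: W_def)
  moreover have quad: "\<bar>u * v * w * z\<bar> \<le> H\<^sup>2 * K\<^sup>2"
    if "\<bar>u\<bar> \<le> H" "\<bar>v\<bar> \<le> H" "\<bar>w\<bar> \<le> K" "\<bar>z\<bar> \<le> K" for u v w z
  proof -
    have "\<bar>u\<bar> * \<bar>v\<bar> * (\<bar>w\<bar> * \<bar>z\<bar>) \<le> H * H * (K * K)" using that pos by (intro mult_mono) auto
    then show ?thesis by (simp add: abs_mult power2_eq_square mult.assoc)
  qed
  define Z where "Z = H\<^sup>2 * K\<^sup>2"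
  have Z: "0 \<le> Z" by (simp add: Z_def)
  have BZ: "0 \<le> B * Z" using B Z by simp
  note q = quad[folded Z_def]
  have scale: "\<bar>k * B * u\<bar> \<le> k * (B * Z)" if "\<bar>u\<bar> \<le> Z" "k \<ge> 0" for k u
    using that B by (simp add: abs_mult mult_left_mono mult.assoc)
  have "\<bar>S\<bar> \<le> (4 + 8 * B) * Z"
  proof -
    have "S = 2 * (a * a * c * d) + 2 * (a * b * c * c) - 4 * B * (b * b * d * d)"
      by (simp add: S_def algebra_simps)
    then show ?thesis using q[of a a c d] q[of a b c c] scale[OF q[of b b d d], of 4] le Z BZ
      by (simp add: algebra_simps abs_le_iff)
  qed
  moreover have "\<bar>T\<bar> \<le> (4 + 8 * B) * Z"
  proof -
    have "T = a * a * c * c + 4 * B * (a * b * d * d) + 4 * B * (b * b * c * d)"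
      by (simp add: T_def algebra_simps)
    then show ?thesis using q[of a a c c] scale[OF q[of a b d d], of 4] scale[OF q[of b b c d], of 4] le Z BZ
      by (simp add: algebra_simps abs_le_iff)
  qed
  moreover have "\<bar>W\<bar> \<le> (4 + 8 * B) * Z"
  proof -
    have "W = a * a * d * d - 2 * (a * b * c * d) + b * b * c * c"
      by (simp add: W_def power2_eq_square algebra_simps)
    then show ?thesis using q[of a a d d] q[of a b c d] q[of b b c c] le Z BZ
      by (simp add: algebra_simps abs_le_iff)
  qed
  ultimately have "rat_height p * rat_height q \<le> 2 * ((4 + 8 * B) * Z)" by (rule rat_height_mult_le)
  then show ?thesis by (simp add: Z_def H_def K_def algebra_simps)
qed

lemma rat_height_dup:
  assumes B: "B > 0" and n: "x ^ 3 \<noteq> of_int B"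
  defines "t \<equiv> (x ^ 4 + 8 * of_int B * x) / (4 * (x ^ 3 - of_int B))"
  shows "rat_height t \<le> (4 + 8 * B) * rat_height x ^ 4"
    and "rat_height x ^ 4 \<le> (15 + 27 * B) * (108 * B\<^sup>2) * rat_height t"
proof -
  obtain a d where ad: "x = of_int a / of_int d" "d > 0" "coprime a d" "rat_height x = max \<bar>a\<bar> d" using rat_heightE .
  have H: "rat_height x = max \<bar>a\<bar> \<bar>d\<bar>" using ad by simp
  have num: "x ^ 4 + 8 * of_int B * x = of_int (dup_num B a d) / of_int d ^ 4"
    using ad(2) by (simp add: ad(1) dup_num_def divide_simps power4_eq_xxxx power3_eq_cube)
  have den: "4 * (x ^ 3 - of_int B) = of_int (dup_den B a d) / of_int d ^ 4"
    using ad(2) by (simp add: ad(1) dup_den_def divide_simps power4_eq_xxxx power3_eq_cube)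
  have nz: "dup_den B a d \<noteq> 0" using n den by auto
  have t: "t = of_int (dup_num B a d) / of_int (dup_den B a d)"
    unfolding t_def num den using ad(2) by simp
  have "rat_height t \<le> max \<bar>dup_num B a d\<bar> \<bar>dup_den B a d\<bar>" by (rule rat_height_le[OF t nz])
  also have "\<dots> \<le> (4 + 8 * B) * rat_height x ^ 4"
    using dup_abs_le[of B a "rat_height x" d] B H by simp
  finally show "rat_height t \<le> (4 + 8 * B) * rat_height x ^ 4" .
  obtain k where k: "k dvd dup_num B a d" "k dvd dup_den B a d"
    "\<bar>k\<bar> * rat_height t = max \<bar>dup_num B a d\<bar> \<bar>dup_den B a d\<bar>" using rat_height_fraction[OF t nz] .
  have "rat_height x ^ 4 \<le> (15 + 27 * B) * (\<bar>k\<bar> * rat_height t)"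
    using dup_size[OF B H] k(3) by simp
  also have "\<dots> \<le> (15 + 27 * B) * (108 * B\<^sup>2 * rat_height t)"
    using dup_common_divisor[OF B ad(3) k(1,2)] B rat_height_ge_1[of t]
    by (intro mult_left_mono mult_right_mono) auto
  finally show "rat_height x ^ 4 \<le> (15 + 27 * B) * (108 * B\<^sup>2) * rat_height t" by (simp add: mult.assoc)
qed

text \<open>Here the doubled point is the origin, of height 0, so the lower bound for doubling
  requires an absolute bound. As \<open>dup_den\<close> vanishes, \<open>dup_num\<close> is itself a
  common divisor and is limited by \<open>dup_common_divisor\<close>.\<close>

lemma rat_height_two_torsion:
  assumes B: "B > 0" and x: "x ^ 3 = of_int B"
  shows "rat_height x ^ 4 \<le> (15 + 27 * B) * (108 * B\<^sup>2)"
proof -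
  obtain a d where ad: "x = of_int a / of_int d" "d > 0" "coprime a d" "rat_height x = max \<bar>a\<bar> d" using rat_heightE .
  have H: "rat_height x = max \<bar>a\<bar> \<bar>d\<bar>" using ad by simp
  have "of_int (a ^ 3) = (of_int (B * d ^ 3) :: rat)" using x ad(1,2) by (simp add: power_divide field_simps)
  then have "a ^ 3 = B * d ^ 3" by (simp only: of_int_eq_iff)
  then have 0: "dup_den B a d = 0" by (simp add: dup_den_def)
  have "\<bar>dup_num B a d\<bar> \<le> 108 * B\<^sup>2"
    by (rule dup_common_divisor[OF B ad(3)]) (simp_all add: 0)
  then have "(15 + 27 * B) * max \<bar>dup_num B a d\<bar> \<bar>dup_den B a d\<bar> \<le> (15 + 27 * B) * (108 * B\<^sup>2)"
    using B 0 by (intro mult_left_mono) auto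
  with dup_size[OF B H] show ?thesis by linarith
qed

lemma ln_le_of_int_le:
  fixes x y :: int
  assumes "0 < x" "x \<le> y"
  shows "ln (real_of_int x) \<le> ln (real_of_int y)"
  using assms by simp

text \<open>Distinct abscissas are handled by the sum and product formulas. Equal ones mean Q = P or
  Q = -P, where the claim is the upper bound for doubling. If a point is the origin, its
  conventional height 0 settles the matter.\<close>

lemma x_height_quasi_quadratic:
  assumes m0: "m0 \<noteq> 0"
  shows "\<exists>C. quasi_quadratic (curve_E' m0) x_height C"
proof -
  define B :: int where "B = 432 * m0\<^sup>2"
  have B: "B > 0" using m0 by (simp add: B_def)
  have B0: "(of_int B :: rat) \<noteq> 0" using B by simp
  let ?G = "W_group (of_int B)"
  have G: "curve_E' m0 = ?G" by (simp add: curve_E'_eq B_def)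
  interpret comm_group ?G using comm_group_curve_E'[OF m0] G by simp
  have one: "\<one>\<^bsub>?G\<^esub> = pt W_origin" by (rule one_cubic_group)
  have inv_affine: "inv\<^bsub>?G\<^esub> (affine_pt x y) = affine_pt x (- y)" if "y\<^sup>2 = x ^ 3 - of_int B" for x y
  proof (rule inv_equality)
    show "affine_pt x (- y) \<otimes>\<^bsub>?G\<^esub> affine_pt x y = \<one>\<^bsub>?G\<^esub>"
      using W_mult_neg[OF B0, of "- y" x] that by (simp add: one)
  qed (use that in \<open>auto intro: affine_pt_carrier\<close>)
  have h_inv: "x_height (inv\<^bsub>?G\<^esub> P) = x_height P" if "P \<in> carrier ?G" for P
    using that
  proof (cases rule: W_group_cases)
    case 1
    then show ?thesis using one by (metis inv_one)
  next
    case (2 x y)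
    then show ?thesis by (simp add: inv_affine x_height_affine)
  qed
  define K1 K2 where "K1 = 8 + 16 * B" and "K2 = (15 + 27 * B) * (108 * B\<^sup>2)"
  have K: "K1 \<ge> 1" "K2 \<ge> 1"
  proof -
    show "K1 \<ge> 1" using B by (simp add: K1_def)
    have "0 < K2" unfolding K2_def using B by (intro mult_pos_pos) auto
    then show "K2 \<ge> 1" by linarith
  qed
  define C where "C = ln (real_of_int K1) + ln (real_of_int K2)"
  have lnK: "0 \<le> ln (real_of_int K1)" "0 \<le> ln (real_of_int K2)" using K by simp_all
  have C: "0 \<le> C" using lnK by (simp add: C_def)
  have rpos: "0 < rat_height t" for t using rat_height_ge_1[of t] by linarith
  have double: "x_height (P \<otimes>\<^bsub>?G\<^esub> P) \<le> 4 * x_height P + C \<and> 4 * x_height P \<le> x_height (P \<otimes>\<^bsub>?G\<^esub> P) + C"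
    if "P \<in> carrier ?G" for P
    using that
  proof (cases rule: W_group_cases)
    case 1
    then have "P \<otimes>\<^bsub>?G\<^esub> P = P" using r_one[OF that] one by simp
    then show ?thesis using 1 C by (simp add: x_height_origin)
  next
    case (2 x y)
    show ?thesis
    proof (cases "y = 0")
      case True
      then have "x ^ 3 = of_int B" using 2 by simp
      then have "rat_height x ^ 4 \<le> K2" unfolding K2_def by (rule rat_height_two_torsion[OF B])
      then have "ln (real_of_int (rat_height x ^ 4)) \<le> ln (real_of_int K2)"
        using rpos[of x] by (intro ln_le_of_int_le) auto
      then have "4 * ln (real_of_int (rat_height x)) \<le> ln (real_of_int K2)"
        using rpos[of x] by (simp add: ln_realpow)
      moreover have "P \<otimes>\<^bsub>?G\<^esub> P = pt W_origin"
        using W_mult_neg[OF B0 2(2)] 2 True by simp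
      ultimately show ?thesis using C lnK x_height_nonneg[of P] 2(1) by (simp add: x_height_origin x_height_affine C_def)
    next
      case False
      define t where "t = (x ^ 4 + 8 * of_int B * x) / (4 * (x ^ 3 - of_int B))"
      obtain y3 where y3: "P \<otimes>\<^bsub>?G\<^esub> P = affine_pt t y3"
        using W_double[OF B0 2(2) False] 2(1) by (auto simp: t_def)
      have n: "x ^ 3 \<noteq> of_int B" using 2(2) False by auto
      have up: "rat_height t \<le> K1 * rat_height x ^ 4"
      proof -
        have "rat_height t \<le> (4 + 8 * B) * rat_height x ^ 4" unfolding t_def by (rule rat_height_dup(1)[OF B n])
        also have "\<dots> \<le> K1 * rat_height x ^ 4" unfolding K1_def using B by (intro mult_right_mono) auto
        finally show ?thesis .
      qed
      have lo: "rat_height x ^ 4 \<le> K2 * rat_height t"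
        unfolding t_def K2_def by (rule rat_height_dup(2)[OF B n])
      have "ln (real_of_int (rat_height t)) \<le> ln (real_of_int K1) + 4 * ln (real_of_int (rat_height x))"
        using ln_le_of_int_le[OF rpos up] K rpos[of x] by (simp add: ln_mult ln_realpow)
      moreover have "4 * ln (real_of_int (rat_height x)) \<le> ln (real_of_int K2) + ln (real_of_int (rat_height t))"
        using ln_le_of_int_le[OF _ lo] K rpos[of x] rpos[of t] by (simp add: ln_mult ln_realpow)
      ultimately show ?thesis using lnK
        unfolding y3 unfolding 2(1) x_height_affine C_def by linarith
    qed
  qed
  have "quasi_quadratic ?G x_height C"
  proof unfold_locales
    show "0 \<le> x_height P" for P by (rule x_height_nonneg)
    show "4 * x_height P \<le> x_height (P \<otimes>\<^bsub>?G\<^esub> P) + C" if "P \<in> carrier ?G" for P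
      using double[OF that] by simp
    fix P Q assume P: "P \<in> carrier ?G" and Q: "Q \<in> carrier ?G"
    show "x_height (P \<otimes>\<^bsub>?G\<^esub> Q) + x_height (P \<otimes>\<^bsub>?G\<^esub> inv\<^bsub>?G\<^esub> Q) \<le> 2 * x_height P + 2 * x_height Q + C"
      using P
    proof (cases rule: W_group_cases)
      case 1
      then have "P = \<one>\<^bsub>?G\<^esub>" by (simp add: one)
      then show ?thesis using Q C h_inv[OF Q] x_height_nonneg[of P] by simp
    next
      case P': (2 x1 y1)
      show ?thesis using Q
      proof (cases rule: W_group_cases)
        case 1
        then have "Q = \<one>\<^bsub>?G\<^esub>" by (simp add: one)
        then show ?thesis using P C x_height_nonneg[of Q] by simp
      next
        case Q': (2 x2 y2)
        have iQ: "inv\<^bsub>?G\<^esub> Q = affine_pt x2 (- y2)" using Q' inv_affine by simp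
        show ?thesis
        proof (cases "x1 = x2")
          case True
          then have "y1\<^sup>2 = y2\<^sup>2" using P' Q' by simp
          then have "y2 = y1 \<or> y2 = - y1" by (auto simp: power2_eq_iff)
          then have "Q = P \<or> Q = inv\<^bsub>?G\<^esub> P" using True P' Q' inv_affine by auto
          then show ?thesis
          proof
            assume "Q = P"
            then show ?thesis using double[OF P] P by (simp add: one x_height_origin)
          next
            assume q: "Q = inv\<^bsub>?G\<^esub> P"
            show ?thesis using double[OF P] P h_inv[OF P] unfolding q by (simp add: one x_height_origin)
          qed
        next
          case False
          have e2: "(- y2)\<^sup>2 = x2 ^ 3 - of_int B" using Q' by simp
          obtain p y3 where p: "P \<otimes>\<^bsub>?G\<^esub> Q = affine_pt p y3"
            "p = ((y2\<^sup>2 + 2 * y1 * y2 - 3 * x1 * x2\<^sup>2 + 3 * of_int B) * x1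
              - (y1\<^sup>2 + 2 * y1 * y2 - 3 * x1\<^sup>2 * x2 + 3 * of_int B) * x2) / (x2 - x1) ^ 3"
            using W_chord[OF B0 P'(2) Q'(2) False] P'(1) Q'(1) by blast
          obtain q y4 where q: "P \<otimes>\<^bsub>?G\<^esub> inv\<^bsub>?G\<^esub> Q = affine_pt q y4"
            "q = (((- y2)\<^sup>2 + 2 * y1 * (- y2) - 3 * x1 * x2\<^sup>2 + 3 * of_int B) * x1
              - (y1\<^sup>2 + 2 * y1 * (- y2) - 3 * x1\<^sup>2 * x2 + 3 * of_int B) * x2) / (x2 - x1) ^ 3"
            using W_chord[OF B0 P'(2) e2 False] P'(1) iQ by metis
          note st = chord_symmetric_functions[OF P'(2) Q'(2) False, folded p(2) q(2)]
          have "rat_height p * rat_height q \<le> K1 * ((rat_height x1)\<^sup>2 * (rat_height x2)\<^sup>2)"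
            unfolding K1_def by (rule rat_height_chord[OF B False st])
          then have "ln (real_of_int (rat_height p * rat_height q))
              \<le> ln (real_of_int (K1 * ((rat_height x1)\<^sup>2 * (rat_height x2)\<^sup>2)))"
            using rpos[of p] rpos[of q] by (intro ln_le_of_int_le) auto
          then have "ln (real_of_int (rat_height p)) + ln (real_of_int (rat_height q))
              \<le> ln (real_of_int K1) + (2 * ln (real_of_int (rat_height x1)) + 2 * ln (real_of_int (rat_height x2)))"
            using rpos[of p] rpos[of q] rpos[of x1] rpos[of x2] K
            by (simp add: ln_mult ln_realpow)
          then show ?thesis using lnK unfolding p(1) q(1) unfolding P'(1) Q'(1) x_height_affine C_def by linarith
        qed
      qed
    qed
  qed
  then show ?thesis unfolding G by blast
qed

subsection \<open>Counting representations\<close>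

text \<open>By coprimality q^2 and d^3 divide each other, so they are equal; then d divides q, and
  the quotient e satisfies e^2 = d.\<close>

lemma square_denominator:
  fixes a d p q B :: int
  assumes cop: "coprime a d" "coprime p q" and pos: "d > 0" "q > 0"
    and e: "p\<^sup>2 * d ^ 3 = q\<^sup>2 * (a ^ 3 - B * d ^ 3)"
  obtains e where "e > 0" "d = e\<^sup>2" "q = e ^ 3"
proof -
  have "q\<^sup>2 dvd d ^ 3"
  proof -
    have "q\<^sup>2 dvd p\<^sup>2 * d ^ 3" using e by simp
    moreover have "coprime (q\<^sup>2) (p\<^sup>2)" using cop(2) by (simp add: coprime_commute)
    ultimately show ?thesis by (simp add: coprime_dvd_mult_right_iff)
  qed
  moreover have "d ^ 3 dvd q\<^sup>2"
  proof -
    have "d ^ 3 dvd q\<^sup>2 * (a ^ 3 - B * d ^ 3)" using e by (metis dvd_triv_right)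
    moreover have "coprime (d ^ 3) (a ^ 3 - B * d ^ 3)"
    proof -
      have "gcd (d ^ 3) (a ^ 3 - B * d ^ 3) = gcd (d ^ 3) (a ^ 3)"
        using gcd_add_mult[of "d ^ 3" "- B" "a ^ 3"] by (simp add: algebra_simps)
      moreover have "gcd d a = 1" using cop(1) by (simp add: gcd.commute)
      ultimately show ?thesis by (simp add: coprime_iff_gcd_eq_1)
    qed
    ultimately show ?thesis by (simp add: coprime_dvd_mult_left_iff)
  qed
  ultimately have qd: "q\<^sup>2 = d ^ 3" using pos by (intro zdvd_antisym_nonneg) auto
  then have "d\<^sup>2 dvd q\<^sup>2" by (simp add: le_imp_power_dvd)
  then have "d dvd q" by simp
  then obtain e where e: "q = d * e" by blast
  have "e > 0" using e pos by (simp add: zero_less_mult_iff)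
  moreover have "d = e\<^sup>2"
  proof -
    have "d\<^sup>2 * e\<^sup>2 = d\<^sup>2 * d" using qd e by (simp add: power_mult_distrib power2_eq_square power3_eq_cube)
    then show ?thesis using pos by simp
  qed
  moreover have "q = e ^ 3" using e calculation(2) by (simp add: power2_eq_square power3_eq_cube)
  ultimately show ?thesis using that by blast
qed

lemma integral_representative:
  assumes m0: "m0 \<noteq> 0" and P: "P \<in> carrier (curve_E m0)" "P \<noteq> \<one>\<^bsub>curve_E m0\<^esub>"
  obtains u v z :: int where "z \<noteq> 0" "P = pt (vector [of_int u, of_int v, of_int z])"
    "u ^ 3 + v ^ 3 = m0 * z ^ 3"
    "ln \<bar>real_of_int z\<bar> \<le> ln 6 + 3 / 2 * x_height (Phi m0 P)"
proof -
  define B :: int where "B = 432 * m0\<^sup>2"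
  have B: "B > 0" using m0 by (simp add: B_def)
  have m: "(of_int m0 :: rat) \<noteq> 0" using m0 by simp
  have G': "curve_E' m0 = W_group (of_int B)" by (simp add: curve_E'_eq B_def)
  have B': "432 * (of_int m0)\<^sup>2 = (of_int B :: rat)" by (simp add: B_def)
  have inj: "inj_on (Phi m0) (carrier (curve_E m0))" and img: "Phi m0 P \<in> carrier (curve_E' m0)"
    using Phi_iso[OF m0] P(1) by (auto simp: iso_def bij_betw_def)
  have O: "pt E_origin \<in> carrier (curve_E m0)"
    unfolding curve_E_eq carrier_cubic_group using E_origin_nonzero E_form_origin by blast
  have "Phi m0 P \<noteq> pt W_origin"
    using inj_onD[OF inj _ P(1) O] P(2) by (auto simp: Phi_origin[OF m0] curve_E_eq one_cubic_group)
  then obtain X Y where XY: "Phi m0 P = affine_pt X Y" "Y\<^sup>2 = X ^ 3 - of_int B"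
    using img unfolding G' by (elim W_group_cases) auto
  obtain a d where ad: "X = of_int a / of_int d" "d > 0" "coprime a d" "rat_height X = max \<bar>a\<bar> d" using rat_heightE .
  obtain p q where pq: "Y = of_int p / of_int q" "q > 0" "coprime p q" using rat_heightE .
  have "of_int (p\<^sup>2 * d ^ 3) = (of_int (q\<^sup>2 * (a ^ 3 - B * d ^ 3)) :: rat)"
    using XY(2) ad(1,2) pq(1,2) by (simp add: power_divide divide_simps)
  then have "p\<^sup>2 * d ^ 3 = q\<^sup>2 * (a ^ 3 - B * d ^ 3)" by (simp only: of_int_eq_iff)
  then obtain e where e: "e > 0" "d = e\<^sup>2" "q = e ^ 3"
    using square_denominator[OF ad(3) pq(3) ad(2) pq(2)] by blast
  \<comment> \<open>This keeps the denominator 6 a e nonzero: X = 0 would give Y^2 = - B <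
    0.\<close>
  have a0: "a \<noteq> 0"
  proof
    assume "a = 0"
    then have "Y\<^sup>2 = - of_int B" using XY(2) ad(1) by simp
    moreover have "- of_int B < (0 :: rat)" using B by simp
    ultimately show False using zero_le_power2[of Y] by simp
  qed
  \<comment> \<open>The inverse of \<open>Phi_vec\<close> at (a / e^2, p / e^3, 1), multiplied by 72
    m0 e^3 to make it integral. Both |a| and e^2 are at most the height of X, so |a| e is at most
    its power 3 / 2.\<close>
  define u v z where "u = 36 * m0 * e ^ 3 - p" and "v = 36 * m0 * e ^ 3 + p" and "z = 6 * a * e"
  define w :: "rat ^ 3" where "w = vector [of_int u, of_int v, of_int z]"
  define k :: rat where "k = 72 * of_int m0 * of_int e ^ 3"
  have k: "k \<noteq> 0" using m e(1) by (simp add: k_def)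
  have Pw: "Phi_vec (of_int m0) w = k *s vector [X, Y, 1]"
    using e unfolding ad(1) pq(1) w_def u_def v_def z_def k_def
    by (simp add: vec3_eq_iff power2_eq_square power3_eq_cube)
  have w0: "w \<noteq> 0"
  proof
    assume "w = 0"
    then have "k *s vector [X, Y, 1] = (0 :: rat ^ 3)" using Pw Phi_vec_eq_0[OF m, of w] by simp
    then show False using k by (simp add: vec3_eq_iff)
  qed
  have "W_form (of_int B) (k *s vector [X, Y, 1]) = k ^ 3 * W_form (of_int B) (vector [X, Y, 1])"
    by (simp add: W_form_def power2_eq_square power3_eq_cube algebra_simps)
  also have "\<dots> = 0" using W_form_affine XY(2) by simp
  finally have Ew: "E_form (of_int m0) w = 0" using W_form_Phi_vec[of "of_int m0" w] m unfolding B' Pw by simp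
  have "Phi m0 (pt w) = Phi m0 P"
    using Phi_pt[OF m0 w0 Ew] pt_scale[OF k affine_vec_nonzero] unfolding Pw XY(1) affine_pt_def by simp
  moreover have "pt w \<in> carrier (curve_E m0)"
    unfolding curve_E_eq carrier_cubic_group using w0 Ew by blast
  ultimately have "P = pt w" using inj P(1) by (metis inj_onD)
  moreover have "z \<noteq> 0" using a0 e(1) by (simp add: z_def)
  moreover have "u ^ 3 + v ^ 3 = m0 * z ^ 3"
  proof -
    have "(of_int (u ^ 3 + v ^ 3) :: rat) = of_int (m0 * z ^ 3)"
      using Ew by (simp add: E_form_def w_def)
    then show ?thesis by (simp only: of_int_eq_iff)
  qed
  moreover have "ln \<bar>real_of_int z\<bar> \<le> ln 6 + 3 / 2 * x_height (Phi m0 P)"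
  proof -
    let ?h = "ln (real_of_int (rat_height X))"
    have "ln \<bar>real_of_int z\<bar> = ln 6 + ln (real_of_int \<bar>a\<bar>) + ln (real_of_int e)"
      using a0 e(1) by (simp add: z_def abs_mult ln_mult)
    moreover have "ln (real_of_int \<bar>a\<bar>) \<le> ?h"
      by (rule ln_le_of_int_le) (use a0 ad(4) in auto)
    moreover have "ln (real_of_int d) \<le> ?h"
      by (rule ln_le_of_int_le) (use ad in auto)
    moreover have "ln (real_of_int d) = 2 * ln (real_of_int e)"
      using e(1,2) by (simp add: ln_realpow)
    ultimately show ?thesis unfolding XY(1) x_height_affine by linarith
  qed
  ultimately show ?thesis using that unfolding w_def by blast
qed

text \<open>Finiteness is what lets a lower bound pass to \<open>num_reps\<close>, since
  \<open>card\<close> of an infinite set is 0. In m = (x + y) s the integer x + y is nonzero, so |s|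
  \<le> |m|, and 4 s = (2 y - x)^2 + 3 x^2 bounds x.\<close>

lemma finite_sum_of_cubes:
  assumes "m \<noteq> 0"
  shows "finite {(x, y). sum_of_cubes x y = m}"
proof (rule finite_subset)
  have bound: "\<bar>x\<bar> \<le> 4 * \<bar>m\<bar>" if "x ^ 3 + y ^ 3 = m" for x y :: int
  proof -
    define s where "s = x\<^sup>2 - x * y + y\<^sup>2"
    have m: "m = (x + y) * s"
      using that by (simp add: s_def power2_eq_square power3_eq_cube algebra_simps)
    have "1 * \<bar>s\<bar> \<le> \<bar>x + y\<bar> * \<bar>s\<bar>" using m assms by (intro mult_right_mono) auto
    then have "\<bar>s\<bar> \<le> \<bar>m\<bar>" using m by (simp add: abs_mult)
    moreover have "4 * s = (2 * y - x)\<^sup>2 + 3 * x\<^sup>2" by (simp add: s_def power2_eq_square algebra_simps)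
    then have "3 * x\<^sup>2 \<le> 4 * s" by simp
    moreover have "\<bar>x\<bar> \<le> x\<^sup>2"
    proof (cases "x = 0")
      case False
      then have "\<bar>x\<bar> * 1 \<le> \<bar>x\<bar> * \<bar>x\<bar>" by (intro mult_left_mono) auto
      then show ?thesis by (simp add: power2_eq_square)
    qed simp
    moreover have "0 \<le> x\<^sup>2" by simp
    ultimately show ?thesis by linarith
  qed
  have abs_bound: "x \<in> {- 4 * \<bar>m\<bar>..4 * \<bar>m\<bar>}" if "\<bar>x\<bar> \<le> 4 * \<bar>m\<bar>" for x
    using that by auto
  show "{(x, y). sum_of_cubes x y = m} \<subseteq> {- 4 * \<bar>m\<bar>..4 * \<bar>m\<bar>} \<times> {- 4 * \<bar>m\<bar>..4 * \<bar>m\<bar>}"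
  proof (rule subsetI, elim CollectE case_prodE)
    fix w x y assume w: "w = (x, y)" and "sum_of_cubes x y = m"
    then have "x ^ 3 + y ^ 3 = m" "y ^ 3 + x ^ 3 = m" by (simp_all add: sum_of_cubes_def)
    then show "w \<in> {- 4 * \<bar>m\<bar>..4 * \<bar>m\<bar>} \<times> {- 4 * \<bar>m\<bar>..4 * \<bar>m\<bar>}"
      unfolding w using abs_bound bound by blast
  qed
qed simp

text \<open>Clearing denominators of finitely many rational solutions of \<open>x^3 + y^3 = m0\<close>.\<close>

lemma card_le_num_reps:
  fixes u v z :: "'a \<Rightarrow> int"
  assumes m0: "m0 \<noteq> 0" and S: "finite S" and z: "\<And>s. s \<in> S \<Longrightarrow> z s \<noteq> 0"
    and e: "\<And>s. s \<in> S \<Longrightarrow> u s ^ 3 + v s ^ 3 = m0 * z s ^ 3"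
    and inj: "\<And>s t. s \<in> S \<Longrightarrow> t \<in> S \<Longrightarrow> u s * z t = u t * z s \<Longrightarrow> v s * z t = v t * z s \<Longrightarrow> s = t"
  shows "card S \<le> num_reps sum_of_cubes (m0 * (\<Prod>s\<in>S. z s) ^ 3)"
proof -
  define Z where "Z = (\<Prod>s\<in>S. z s)"
  define c where "c s = (\<Prod>t\<in>S - {s}. z t)" for s
  have Z: "Z = z s * c s" if "s \<in> S" for s
    unfolding Z_def c_def using S that by (rule prod.remove)
  have Z0: "Z \<noteq> 0" unfolding Z_def using S z by simp
  define f where "f s = (u s * c s, v s * c s)" for s
  have "inj_on f S"
  proof (rule inj_onI)
    fix s t assume s: "s \<in> S" and t: "t \<in> S" and "f s = f t"
    then have "u s * c s = u t * c t" "v s * c s = v t * c t" by (simp_all add: f_def)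
    then have "u s * z t * Z = u t * z s * Z" "v s * z t * Z = v t * z s * Z"
      using Z[OF s] Z[OF t] by algebra+
    then show "s = t" using Z0 s t inj by simp
  qed
  moreover have "f ` S \<subseteq> {(x, y). sum_of_cubes x y = m0 * Z ^ 3}"
  proof (rule image_subsetI)
    fix s assume s: "s \<in> S"
    have "(u s * c s) ^ 3 + (v s * c s) ^ 3 = m0 * Z ^ 3"
      unfolding Z[OF s] power_mult_distrib distrib_right[symmetric] e[OF s] by simp
    then show "f s \<in> {(x, y). sum_of_cubes x y = m0 * Z ^ 3}" by (simp add: f_def sum_of_cubes_def)
  qed
  moreover have "finite {(x, y). sum_of_cubes x y = m0 * Z ^ 3}"
    by (rule finite_sum_of_cubes) (use m0 Z0 in simp)
  ultimately show ?thesis unfolding num_reps_def Z_def[symmetric] by (rule card_inj_on_le)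
qed

section \<open>Distinct combinations of independent points\<close>

lemma hom_finprod:
  assumes "comm_group G" "comm_group H" "\<phi> \<in> hom G H" "f \<in> A \<rightarrow> carrier G" "finite A"
  shows "\<phi> (finprod G f A) = finprod H (\<lambda>i. \<phi> (f i)) A"
proof -
  interpret G: comm_group G by fact
  interpret H: comm_group H by fact
  interpret group_hom G H \<phi> using assms(3) by unfold_locales
  show ?thesis
    using assms(5,4)
  proof (induction A rule: finite_induct)
    case (insert a A)
    then have "f \<in> A \<rightarrow> carrier G" "f a \<in> carrier G" "(\<lambda>i. \<phi> (f i)) \<in> A \<rightarrow> carrier H"
      by (auto simp: Pi_iff)
    with insert show ?case by simp
  qed simp
qed

text \<open>Two equal sums give a relation whose value is the identity, hence torsion, so all
  exponent differences vanish. Excluding the exponent 0 keeps the sums away from the origin, which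
  has no affine coordinates.\<close>

lemma (in comm_group) indep_mod_torsion_nat_combinations:
  assumes ind: "indep_mod_torsion G r P"
  shows "inj_on (\<lambda>n :: nat \<Rightarrow> nat. \<Otimes>i\<in>{1..r}. P i [^] n i) ({1..r} \<rightarrow>\<^sub>E A)"
    and "r \<ge> 1 \<Longrightarrow> 0 \<notin> A \<Longrightarrow> n \<in> {1..r} \<rightarrow>\<^sub>E A \<Longrightarrow> (\<Otimes>i\<in>{1..r}. P i [^] (n i :: nat)) \<noteq> \<one>"
proof -
  have P: "P i \<in> carrier G" if "i \<in> {1..r}" for i using ind that by (auto simp: indep_mod_torsion_def)
  have tor: "\<one> \<in> torsion_points G" by (auto simp: torsion_points_def intro: exI[of _ "1 :: nat"])
  have zero: "n i = 0" if "(\<Otimes>i\<in>{1..r}. P i [^] (n i :: int)) = \<one>" "i \<in> {1..r}" for n i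
    using ind tor that unfolding indep_mod_torsion_def by metis
  show "inj_on (\<lambda>n :: nat \<Rightarrow> nat. \<Otimes>i\<in>{1..r}. P i [^] n i) ({1..r} \<rightarrow>\<^sub>E A)"
  proof (rule inj_onI)
    fix n n' assume n: "n \<in> {1..r} \<rightarrow>\<^sub>E A" "n' \<in> {1..r} \<rightarrow>\<^sub>E A"
      and eq: "(\<Otimes>i\<in>{1..r}. P i [^] n i) = (\<Otimes>i\<in>{1..r}. P i [^] n' i)"
    let ?D = "\<Otimes>i\<in>{1..r}. P i [^] (int (n i) - int (n' i))"
    have cl: "(\<lambda>i. P i [^] k i) \<in> {1..r} \<rightarrow> carrier G" "(\<lambda>i. P i [^] l i) \<in> {1..r} \<rightarrow> carrier G"
      for k :: "nat \<Rightarrow> int" and l :: "nat \<Rightarrow> nat" using P by auto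
    have "?D \<otimes> (\<Otimes>i\<in>{1..r}. P i [^] n' i) = (\<Otimes>i\<in>{1..r}. P i [^] (int (n i) - int (n' i)) \<otimes> P i [^] n' i)"
      by (rule finprod_multf[symmetric]) (use cl in auto)
    also have "\<dots> = (\<Otimes>i\<in>{1..r}. P i [^] n i)"
    proof (rule finprod_cong')
      fix i assume i: "i \<in> {1..r}"
      show "P i [^] (int (n i) - int (n' i)) \<otimes> P i [^] n' i = P i [^] n i"
        using int_pow_mult[OF P[OF i], of "int (n i) - int (n' i)" "int (n' i)"] by (simp add: int_pow_int)
    qed (use P in auto)
    finally have "?D \<otimes> (\<Otimes>i\<in>{1..r}. P i [^] n' i) = (\<Otimes>i\<in>{1..r}. P i [^] n' i)" using eq by simp
    then have "?D = \<one>" using finprod_closed[OF cl(1)] finprod_closed[OF cl(2)] by (simp add: r_cancel_one')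
    then have "int (n i) - int (n' i) = 0" if "i \<in> {1..r}" for i using zero[of "\<lambda>i. int (n i) - int (n' i)"] that by blast
    then have "n i = n' i" if "i \<in> {1..r}" for i using that by simp
    then show "n = n'" using n by (intro PiE_ext) auto
  qed
  show "(\<Otimes>i\<in>{1..r}. P i [^] (n i :: nat)) \<noteq> \<one>" if r: "r \<ge> 1" and A: "0 \<notin> A" and n: "n \<in> {1..r} \<rightarrow>\<^sub>E A"
  proof
    assume "(\<Otimes>i\<in>{1..r}. P i [^] n i) = \<one>"
    then have "(\<Otimes>i\<in>{1..r}. P i [^] int (n i)) = \<one>" by (simp add: int_pow_int)
    then have "int (n 1) = 0" using r by (intro zero) auto
    moreover have "n 1 \<in> A" using n r by auto
    ultimately show False using A by simp
  qed
qed

lemma many_representations: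
  assumes m0: "m0 \<noteq> 0" and r: "r \<ge> 1" and ind: "indep_mod_torsion (curve_E m0) r P"
    and M: "\<And>i. i \<in> {1..r} \<Longrightarrow> canonical_height m0 (Phi m0 (P i)) \<le> M"
  shows "\<exists>C\<ge>0. \<forall>N :: nat. \<exists>m. m \<noteq> 0 \<and> real N ^ r \<le> real (num_reps sum_of_cubes m) \<and>
    ln \<bar>real_of_int m\<bar> \<le> C * real N ^ r + C + 9 * (3 * 2 ^ (r - 1) - 2) * M * real N ^ (r + 2)"
proof -
  let ?G = "curve_E m0" and ?H = "curve_E' m0"
  interpret G: comm_group ?G by (rule comm_group_curve_E[OF m0])
  obtain C0 where "quasi_quadratic ?H x_height C0" using x_height_quasi_quadratic[OF m0] by blast
  then interpret H: quasi_quadratic ?H x_height C0 .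
  have hom: "Phi m0 \<in> hom ?G ?H" using Phi_iso[OF m0] by (simp add: iso_def)
  have P: "P i \<in> carrier ?G" if "i \<in> {1..r}" for i using ind that by (auto simp: indep_mod_torsion_def)
  have Q: "Phi m0 (P i) \<in> carrier ?H" if "i \<in> {1..r}" for i using hom P[OF that] by (simp add: hom_in_carrier)
  have lim_le: "H.tate_limit (Phi m0 (P i)) \<le> 2 * M" if "i \<in> {1..r}" for i
    using M[OF that] by (simp add: canonical_height_def H.tate_limit_def)
  \<comment> \<open>Everything independent of \<open>N\<close>: \<open>C0 / 2\<close> is 3 / 2 times
    the error \<open>C0 / 3\<close> between \<open>x_height\<close> and its limit, and the outer 3
    comes from cubing the common denominator.\<close>
  define C where "C = \<bar>ln \<bar>real_of_int m0\<bar>\<bar> + 3 * (ln 6 + C0 / 2)"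
  have C0: "0 \<le> C0" by (rule H.C_nonneg)
  have C: "C \<ge> 0" "ln \<bar>real_of_int m0\<bar> \<le> C" "3 * (ln 6 + C0 / 2) \<le> C"
  proof -
    have "0 \<le> ln (6 :: real)" by simp
    with C0 show "C \<ge> 0" "ln \<bar>real_of_int m0\<bar> \<le> C" "3 * (ln 6 + C0 / 2) \<le> C"
      unfolding C_def by argo+
  qed
  show ?thesis
  proof (intro exI[of _ C] conjI allI C(1))
    fix N :: nat
    define S where "S = (\<lambda>n. \<Otimes>\<^bsub>?G\<^esub>i\<in>{1..r}. P i [^]\<^bsub>?G\<^esub> n i) ` ({1..r} \<rightarrow>\<^sub>E {1..N})"
    note comb = G.indep_mod_torsion_nat_combinations[OF ind, where A = "{1..N}"]
    have fin: "finite S" unfolding S_def by (intro finite_imageI finite_PiE) auto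
    have card: "card S = N ^ r"
      unfolding S_def card_image[OF comb(1)] by (simp add: card_PiE)
    \<comment> \<open>The bound is \<open>2 * M\<close> because \<open>tate_limit\<close> is twice
      the canonical height.\<close>
    define c :: real where "c = (3 * 2 ^ (r - 1) - 2) * ((real N)\<^sup>2 * (2 * M))"
    have S: "s \<in> carrier ?G \<and> s \<noteq> \<one>\<^bsub>?G\<^esub> \<and> H.tate_limit (Phi m0 s) \<le> c" if "s \<in> S" for s
    proof -
      obtain n where n: "n \<in> {1..r} \<rightarrow>\<^sub>E {1..N}" "s = (\<Otimes>\<^bsub>?G\<^esub>i\<in>{1..r}. P i [^]\<^bsub>?G\<^esub> n i)"
        using \<open>s \<in> S\<close> by (auto simp: S_def)
      have cl: "(\<lambda>i. P i [^]\<^bsub>?G\<^esub> n i) \<in> {1..r} \<rightarrow> carrier ?G" using P by auto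
      have "Phi m0 s = (\<Otimes>\<^bsub>?H\<^esub>i\<in>{1..r}. Phi m0 (P i [^]\<^bsub>?G\<^esub> n i))"
        unfolding n(2) by (rule hom_finprod[OF G.comm_group_axioms H.comm_group_axioms hom cl]) simp
      also have "\<dots> = (\<Otimes>\<^bsub>?H\<^esub>i\<in>{1..r}. Phi m0 (P i) [^]\<^bsub>?H\<^esub> n i)"
        by (rule H.finprod_cong') (use P Q hom_nat_pow[OF hom _ G.is_group H.is_group] in auto)
      finally have "Phi m0 s = (\<Otimes>\<^bsub>?H\<^esub>i\<in>{1..r}. Phi m0 (P i) [^]\<^bsub>?H\<^esub> n i)" .
      moreover have "n i \<le> N" if "i \<in> {1..r}" for i using PiE_mem[OF n(1) that] by simp
      ultimately have "H.tate_limit (Phi m0 s) \<le> c"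
        unfolding c_def using H.tate_limit_finprod_le[OF r Q _ lim_le] by simp
      moreover have "s \<noteq> \<one>\<^bsub>?G\<^esub>" unfolding n(2) by (rule comb(2)[OF r _ n(1)]) simp
      moreover have "s \<in> carrier ?G" unfolding n(2) using cl by (rule G.finprod_closed)
      ultimately show ?thesis by blast
    qed
    have "\<forall>s\<in>S. \<exists>u v z :: int. z \<noteq> 0 \<and> s = pt (vector [of_int u, of_int v, of_int z]) \<and>
        u ^ 3 + v ^ 3 = m0 * z ^ 3 \<and> ln \<bar>real_of_int z\<bar> \<le> ln 6 + 3 / 2 * x_height (Phi m0 s)"
      using S integral_representative[OF m0] by metis
    then obtain u v z :: "proj_plane \<Rightarrow> int" where uvz: "\<And>s. s \<in> S \<Longrightarrow> z s \<noteq> 0"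
      "\<And>s. s \<in> S \<Longrightarrow> s = pt (vector [of_int (u s), of_int (v s), of_int (z s)])"
      "\<And>s. s \<in> S \<Longrightarrow> u s ^ 3 + v s ^ 3 = m0 * z s ^ 3"
      "\<And>s. s \<in> S \<Longrightarrow> ln \<bar>real_of_int (z s)\<bar> \<le> ln 6 + 3 / 2 * x_height (Phi m0 s)"
      by metis
    define Z where "Z = (\<Prod>s\<in>S. z s)"
    have Z0: "Z \<noteq> 0" unfolding Z_def using fin uvz(1) by simp
    have "card S \<le> num_reps sum_of_cubes (m0 * Z ^ 3)"
      unfolding Z_def
    proof (rule card_le_num_reps[OF m0 fin uvz(1) uvz(3)])
      fix s t assume s: "s \<in> S" and t: "t \<in> S" and e: "u s * z t = u t * z s" "v s * z t = v t * z s"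
      have "(of_int (u s * z t) :: rat) = of_int (u t * z s)" "(of_int (v s * z t) :: rat) = of_int (v t * z s)"
        using e by simp_all
      then have "vector [of_int (u s), of_int (v s), of_int (z s)]
          = ((of_int (z s) / of_int (z t)) *s vector [of_int (u t), of_int (v t), of_int (z t)] :: rat ^ 3)"
        using uvz(1)[OF s] uvz(1)[OF t] by (simp add: vec3_eq_iff field_simps)
      moreover have "(vector [of_int (u t), of_int (v t), of_int (z t)] :: rat ^ 3) \<noteq> 0"
        using uvz(1)[OF t] by (simp add: vec3_eq_iff)
      moreover have "(of_int (z s) / of_int (z t) :: rat) \<noteq> 0" using uvz(1)[OF s] uvz(1)[OF t] by simp
      ultimately show "s = t" using uvz(2)[OF s] uvz(2)[OF t] pt_scale by metis
    qed
    then have "real N ^ r \<le> real (num_reps sum_of_cubes (m0 * Z ^ 3))"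
      unfolding card of_nat_power[symmetric] of_nat_le_iff .
    moreover have "ln \<bar>real_of_int (m0 * Z ^ 3)\<bar> \<le> C * real N ^ r + C + 9 * (3 * 2 ^ (r - 1) - 2) * M * real N ^ (r + 2)"
    proof -
      have zs: "ln \<bar>real_of_int (z s)\<bar> \<le> ln 6 + C0 / 2 + 3 / 2 * c" if "s \<in> S" for s
        using uvz(4)[OF that] S[OF that] H.tate_limit_lower[of "Phi m0 s"] hom by (auto simp: hom_in_carrier)
      have "ln \<bar>real_of_int Z\<bar> = (\<Sum>s\<in>S. ln \<bar>real_of_int (z s)\<bar>)"
        unfolding Z_def of_int_prod abs_prod using fin uvz(1) by (intro ln_prod) auto
      also have "\<dots> \<le> real (card S) * (ln 6 + C0 / 2 + 3 / 2 * c)" using zs by (rule sum_bounded_above)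
      finally have lnZ: "ln \<bar>real_of_int Z\<bar> \<le> real N ^ r * (ln 6 + C0 / 2 + 3 / 2 * c)" by (simp add: card)
      have "ln \<bar>real_of_int (m0 * Z ^ 3)\<bar> = ln \<bar>real_of_int m0\<bar> + 3 * ln \<bar>real_of_int Z\<bar>"
        using m0 Z0 by (simp add: abs_mult power_abs ln_mult ln_realpow)
      also have "\<dots> \<le> C + 3 * (real N ^ r * (ln 6 + C0 / 2 + 3 / 2 * c))" using C(2) lnZ by linarith
      also have "\<dots> = C + real N ^ r * (3 * (ln 6 + C0 / 2)) + 9 / 2 * c * real N ^ r" by (simp add: algebra_simps)
      also have "\<dots> \<le> C + real N ^ r * C + 9 / 2 * c * real N ^ r"
        using mult_left_mono[OF C(3), of "real N ^ r"] by simp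
      also have "\<dots> = C * real N ^ r + C + 9 * (3 * 2 ^ (r - 1) - 2) * M * real N ^ (r + 2)"
        by (simp add: c_def power_add power2_eq_square algebra_simps)
      finally show ?thesis .
    qed
    ultimately show "\<exists>m. m \<noteq> 0 \<and> real N ^ r \<le> real (num_reps sum_of_cubes m) \<and>
      ln \<bar>real_of_int m\<bar> \<le> C * real N ^ r + C + 9 * (3 * 2 ^ (r - 1) - 2) * M * real N ^ (r + 2)"
      using m0 Z0 by (intro exI[of _ "m0 * Z ^ 3"]) simp
  qed
qed

theorem theorem1p1:
  fixes m0 :: int and r :: nat and P :: "nat \<Rightarrow> proj_plane" and Pbar :: proj_plane
  assumes "m0 \<noteq> 0"
    and "abelian_rank (curve_E m0) = enat r"
    and "r \<ge> 1"
    and "indep_mod_torsion (curve_E m0) r P"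
    and "Pbar \<in> (\<lambda>i. Phi m0 (P i)) ` {1..r}"
    and "canonical_height m0 Pbar = Max ((\<lambda>i. canonical_height m0 (Phi m0 (P i))) ` {1..r})"
  shows "infinite {m :: int. m \<noteq> 0 \<and>
    real (num_reps sum_of_cubes m) >
      1 / ((9 * 2 ^ (r + 1) - 20) powr (real r / (real r + 2)) *
           canonical_height m0 Pbar powr (real r / (real r + 2))) *
      ln \<bar>real_of_int m\<bar> powr (real r / (real r + 2))}"
    (is "infinite ?A")
proof (cases "canonical_height m0 Pbar = 0")
  \<comment> \<open>Division by zero makes the lower bound \<open>0\<close> here, so the cubes suffice.\<close>
  case True
  have "(\<lambda>n :: nat. (int n + 1) ^ 3) ` UNIV \<subseteq> ?A"
  proof (rule image_subsetI)
    fix n :: nat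
    let ?m = "(int n + 1) ^ 3"
    have "(int n + 1, 0) \<in> {(x, y). sum_of_cubes x y = ?m}" by (simp add: sum_of_cubes_def)
    moreover have "finite {(x, y). sum_of_cubes x y = ?m}" by (rule finite_sum_of_cubes) simp
    ultimately have "num_reps sum_of_cubes ?m > 0" unfolding num_reps_def by (auto simp: card_gt_0_iff)
    then show "?m \<in> ?A" by (simp add: True)
  qed
  moreover have "inj (\<lambda>n :: nat. (int n + 1) ^ 3)" by (rule injI) (simp add: cube_eq_iff)
  ultimately show ?thesis by (meson finite_imageD finite_subset infinite_UNIV_nat)
next
  case False
  define M where "M = canonical_height m0 Pbar"
  define K :: real where "K = 9 * 2 ^ (r + 1) - 20"
  define e where "e = real r / (real r + 2)"
  define c :: real where "c = 9 * (3 * 2 ^ (r - 1) - 2)"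
  have M_max: "canonical_height m0 (Phi m0 (P i)) \<le> M" if "i \<in> {1..r}" for i
    unfolding M_def assms(6) using that by (intro Max_ge) auto
  \<comment> \<open>As a limit of nonnegative terms the height is nonnegative, and in this case it
    is not 0.\<close>
  have M0: "M > 0"
  proof -
    obtain C0 where "quasi_quadratic (curve_E' m0) x_height C0" using x_height_quasi_quadratic[OF assms(1)] by blast
    then interpret H: quasi_quadratic "curve_E' m0" x_height C0 .
    obtain i where i: "i \<in> {1..r}" "Pbar = Phi m0 (P i)" using assms(5) by blast
    have "P i \<in> carrier (curve_E m0)" using assms(4) i(1) by (auto simp: indep_mod_torsion_def)
    then have "Pbar \<in> carrier (curve_E' m0)" using Phi_iso[OF assms(1)] i(2) by (auto simp: iso_def hom_in_carrier)
    then have "0 \<le> M" using H.tate_limit_nonneg by (simp add: M_def canonical_height_def H.tate_limit_def)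
    with False show ?thesis by (simp add: M_def)
  qed
  \<comment> \<open>With t = 2^(r-1) \<ge> 1 the constants are c = 27 t - 18 and K = 36 t - 20, so
    the gap is 9 t - 2.\<close>
  have Kc: "c < K"
  proof -
    have e: "(2 :: real) ^ (r + 1) = 4 * 2 ^ (r - 1)" using assms(3) by (cases r) auto
    have "9 * (3 * t - 2) < 9 * (4 * t) - 20" if "1 \<le> t" for t :: real using that by argo
    then show ?thesis unfolding K_def c_def e by (metis one_le_power one_le_numeral)
  qed
  have K0: "K > 0"
  proof -
    have "(2 :: real) ^ (1 + 1) \<le> 2 ^ (r + 1)" using assms(3) by (intro power_increasing) auto
    then show ?thesis by (simp add: K_def)
  qed
  have "\<exists>C\<ge>0. \<forall>N :: nat. \<exists>m. m \<noteq> 0 \<and> real N ^ r \<le> real (num_reps sum_of_cubes m) \<and>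
    ln \<bar>real_of_int m\<bar> \<le> C * real N ^ r + C + c * M * real N ^ (r + 2)"
    unfolding c_def using assms(1,3,4) M_max by (rule many_representations)
  then obtain C where "C \<ge> 0 \<and> (\<forall>N :: nat. \<exists>m. m \<noteq> 0 \<and> real N ^ r \<le> real (num_reps sum_of_cubes m) \<and>
    ln \<bar>real_of_int m\<bar> \<le> C * real N ^ r + C + c * M * real N ^ (r + 2))" by (elim exE) (rule that)
  then have C: "C \<ge> 0" "\<And>N :: nat. \<exists>m. m \<noteq> 0 \<and> real N ^ r \<le> real (num_reps sum_of_cubes m) \<and>
    ln \<bar>real_of_int m\<bar> \<le> C * real N ^ r + C + c * M * real N ^ (r + 2)" by simp_all
  have A: "?A = {m. m \<noteq> 0 \<and> real (num_reps sum_of_cubes m) >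
      1 / (K powr e * M powr e) * ln \<bar>real_of_int m\<bar> powr e}"
    unfolding K_def e_def M_def ..
  \<comment> \<open>Beyond this threshold the error C N^r + C, at most 2 C N^r, is smaller than (K -
    c) M N^(r+2).\<close>
  have large: "\<exists>m \<in> ?A. N \<le> num_reps sum_of_cubes m" if N: "real N > 2 * C / ((K - c) * M)" "N \<ge> 1" for N :: nat
  proof -
    obtain m where m: "m \<noteq> 0" "real N ^ r \<le> real (num_reps sum_of_cubes m)"
      "ln \<bar>real_of_int m\<bar> \<le> C * real N ^ r + C + c * M * real N ^ (r + 2)" using C(2)[of N] by blast
    define L where "L = ln \<bar>real_of_int m\<bar>"
    have L0: "0 \<le> L" using m(1) by (simp add: L_def)
    have Nr: "1 \<le> real N ^ r" using N(2) by simp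
    have "2 * C < (K - c) * M * real N" using N(1) Kc M0 by (simp add: divide_less_eq mult.commute)
    also have "\<dots> \<le> (K - c) * M * (real N)\<^sup>2"
      using N(2) Kc M0 by (intro mult_left_mono) (auto simp: power2_eq_square)
    finally have "2 * C * real N ^ r < (K - c) * M * (real N)\<^sup>2 * real N ^ r"
      by (rule mult_strict_right_mono) (use Nr in linarith)
    moreover have "C \<le> C * real N ^ r" using mult_left_mono[OF Nr C(1)] by simp
    ultimately have "L < K * M * real N ^ (r + 2)"
      using m(3) unfolding L_def by (simp add: power_add power2_eq_square algebra_simps)
    then have "L / (K * M) < real N ^ (r + 2)" using K0 M0 by (simp add: divide_less_eq mult_ac)
    then have "(L / (K * M)) powr e < (real N ^ (r + 2)) powr e"
      using L0 K0 M0 assms(3) by (intro powr_less_mono2) (auto simp: e_def)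
    \<comment> \<open>The exponent r / (r + 2) turns the growth N^(r+2) of log |m| into the growth
      N^r of the count.\<close>
    also have "(real N ^ (r + 2)) powr e = real N ^ r"
    proof -
      have "(real N ^ (r + 2)) powr e = real N powr (real (r + 2) * e)"
        using N(2) by (simp only: powr_powr[symmetric] powr_realpow)
      also have "real (r + 2) * e = real r" by (simp add: e_def field_simps)
      finally show ?thesis using N(2) by (simp add: powr_realpow)
    qed
    also have "(L / (K * M)) powr e = 1 / (K powr e * M powr e) * L powr e"
      using L0 K0 M0 by (simp add: powr_divide powr_mult)
    finally have "1 / (K powr e * M powr e) * L powr e < real (num_reps sum_of_cubes m)" using m(2) by linarith
    then have "m \<in> ?A" unfolding A using m(1) by (simp add: L_def)
    moreover have "N \<le> num_reps sum_of_cubes m"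
    proof -
      have "N ^ 1 \<le> N ^ r" using N(2) assms(3) by (intro power_increasing) auto
      also have "\<dots> \<le> num_reps sum_of_cubes m" using m(2) unfolding of_nat_power[symmetric] of_nat_le_iff .
      finally show ?thesis by simp
    qed
    ultimately show ?thesis by blast
  qed
  show ?thesis
  proof
    assume fin: "finite ?A"
    \<comment> \<open>A finite set would bound the counts, while \<open>large\<close> supplies
      members with arbitrarily many representations; the inserted 0 makes the maximum meaningful
      even for an empty set.\<close>
    define b where "b = Max (insert 0 (num_reps sum_of_cubes ` ?A))"
    have b: "num_reps sum_of_cubes m \<le> b" if "m \<in> ?A" for m
      unfolding b_def using fin that by (intro Max_ge) auto
    obtain N0 :: nat where N0: "2 * C / ((K - c) * M) < real N0" using reals_Archimedean2 by blast
    have "real (N0 + b + 1) > 2 * C / ((K - c) * M)" using N0 by simp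
    then obtain m where "m \<in> ?A" "N0 + b + 1 \<le> num_reps sum_of_cubes m" using large[of "N0 + b + 1"] by auto
    with b show False by fastforce
  qed
qed

end
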